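(* Let $T$ be a piecewise real-analytic Bernoulli expanding map of the unit interval $[0,1]$ (whose endpoints may be identified to give $\mathbb R/\mathbb Z$), let $\mu$ be its unique absolutely continuous invariant probability measure, and let $$L(\mu)=\int \log|T'(x)|\,d\mu(x)$$ be its Lyapunov exponent. For $t\in\mathbb R$ define $a_1(t),a_2(t),\ldots$ by the Taylor expansion in $z$ (about $z=0$) $$\exp\left(-\sum_{n=1}^\infty\frac{z^n}{n}\sum_{T^nx=x}\frac{|(T^n)'(x)|^{-(1+t)}}{1-((T^n)'(x))^{-1}}\right)=1+\sum_{n=1}^\infty a_n(t)z^n .$$ Then the series $\sum_{n=1}^\infty a_n'(0)$ and $\sum_{n=1}^\infty n\,a_n(0)$ are absolutely convergent, and $$L(\mu)=\frac{-\sum_{n=1}^\infty a_n'(0)}{\sum_{n=1}^\infty n\,a_n(0)} .$$ Consequently, setting $L_N=\dfrac{-\sum_{n=1}^N a_n'(0)}{\sum_{n=1}^N n\,a_n(0)}$, one has $L_N\to L(\mu)$ as $N\to+\infty$.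
   Context: A piecewise real-analytic Bernoulli expanding map of $[0,1]$ means: $[0,1]$ is a union of finitely many (at least two) closed intervals $X_1,\ldots,X_k$ with disjoint interiors, and on each $X_i$ the map $T$ is given by a real-analytic bijection $T|_{X_i}:X_i\to[0,1]$ (extending analytically to a complex neighbourhood of $X_i$, with inverse $T_i:[0,1]\to X_i$ extending analytically to a complex neighbourhood of $[0,1]$), and there is $\lambda>1$ such that $|T'(x)|\ge\lambda$ for all $x$. Such a map has a unique $T$-invariant probability measure absolutely continuous with respect to Lebesgue measure. The sum over $T^nx=x$ is over period-$n$ points counted by branches: for each word $(i_1,\ldots,i_n)\in\{1,\ldots,k\}^n$ one takes the unique fixed point $x$ of $T_{i_1}\circ\cdots\circ T_{i_n}:[0,1]\to[0,1]$, and $(T^n)'(x)$ denotes the reciprocal of the derivative of this composition at $x$. The prime in $a_n'(0)$ denotes differentiation in $t$ at $t=0$. The quantity $L_N$ is considered for those $N$ (all sufficiently large $N$) for which its denominator is non-zero. *)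

theory Defs
  imports "HOL-Complex_Analysis.Complex_Analysis" "HOL-Probability.Probability"
begin

definition real_analytic_on :: "(real \<Rightarrow> real) \<Rightarrow> real set \<Rightarrow> bool"  (infixl "real'_analytic'_on" 50)
  where "f real_analytic_on S \<longleftrightarrow>
    (\<exists>g. g analytic_on (complex_of_real ` S) \<and> (\<forall>x\<in>S. g (complex_of_real x) = complex_of_real (f x)))"

text \<open>
  At a common endpoint of two of the intervals the branches may take different values.
  The branches \<open>F i\<close> on the closed intervals \<open>X i\<close> are therefore kept separate from the map \<open>T\<close>,
  which has to agree with \<open>F i\<close> only on the interior of \<open>X i\<close>: its values at the finitely many
  endpoints are immaterial for an absolutely continuous measure. Nothing is assumed about
  the values of \<open>T\<close> outside the unit interval, or of \<open>F i\<close> outside \<open>X i\<close>, so derivatives of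
  branches are taken within these sets.
\<close>

locale bernoulli_expanding_map =
  fixes T :: "real \<Rightarrow> real" and k :: nat and X :: "nat \<Rightarrow> real set" and F :: "nat \<Rightarrow> real \<Rightarrow> real"
  assumes at_least_two: "k \<ge> 2"
    and intervals: "\<And>i. i \<in> {1..k} \<Longrightarrow> \<exists>a b. X i = {a..b}"
    and cover: "(\<Union>i\<in>{1..k}. X i) = {0..1}"
    and disjoint_interiors: "\<And>i j. i \<in> {1..k} \<Longrightarrow> j \<in> {1..k} \<Longrightarrow> i \<noteq> j \<Longrightarrow>
           interior (X i) \<inter> interior (X j) = {}"
    and branch_bij: "\<And>i. i \<in> {1..k} \<Longrightarrow> bij_betw (F i) (X i) {0..1}"
    and branch_analytic: "\<And>i. i \<in> {1..k} \<Longrightarrow> F i real_analytic_on X i"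
    and inverse_analytic: "\<And>i. i \<in> {1..k} \<Longrightarrow> the_inv_into (X i) (F i) real_analytic_on {0..1}"
    and expanding: "\<exists>c>1. \<forall>i\<in>{1..k}. \<forall>x\<in>X i.
           \<bar>vector_derivative (F i) (at x within X i)\<bar> \<ge> c"
    and maps_to: "T \<in> {0..1} \<rightarrow> {0..1}"
    and agrees: "\<And>i x. i \<in> {1..k} \<Longrightarrow> x \<in> interior (X i) \<Longrightarrow> T x = F i x"

definition abs_cont_invariant_prob :: "(real \<Rightarrow> real) \<Rightarrow> real measure \<Rightarrow> bool"
  where "abs_cont_invariant_prob T \<mu> \<longleftrightarrow>
    prob_space \<mu> \<and> sets \<mu> = sets (restrict_space borel {0..1}) \<and>
    absolutely_continuous (restrict_space lborel {0..1}) \<mu> \<and>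
    T \<in> measurable \<mu> \<mu> \<and> distr \<mu> \<mu> T = \<mu>"

definition lyapunov_exponent :: "(real \<Rightarrow> real) \<Rightarrow> real measure \<Rightarrow> real"
  where "lyapunov_exponent T \<mu> = (\<integral>x. ln \<bar>deriv T x\<bar> \<partial>\<mu>)"

definition words :: "nat \<Rightarrow> nat \<Rightarrow> nat list set"
  where "words k n = {w. length w = n \<and> set w \<subseteq> {1..k}}"

text \<open>For \<open>w = [i\<^sub>1, \<dots>, i\<^sub>n]\<close> this is the composition of the inverse branches with indices
  \<open>i\<^sub>1, \<dots>, i\<^sub>n\<close>, the last one being applied first.\<close>

definition inverse_branch :: "(nat \<Rightarrow> real set) \<Rightarrow> (nat \<Rightarrow> real \<Rightarrow> real) \<Rightarrow> nat list \<Rightarrow> real \<Rightarrow> real"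
  where "inverse_branch X F w = foldr (\<lambda>i. the_inv_into (X i) (F i)) w"

definition word_fixpoint :: "(nat \<Rightarrow> real set) \<Rightarrow> (nat \<Rightarrow> real \<Rightarrow> real) \<Rightarrow> nat list \<Rightarrow> real"
  where "word_fixpoint X F w = (THE x. x \<in> {0..1} \<and> inverse_branch X F w x = x)"

text \<open>The derivative of the \<open>n\<close>-th iterate at the period-\<open>n\<close> point coded by a word of length \<open>n\<close>.\<close>

definition multiplier :: "(nat \<Rightarrow> real set) \<Rightarrow> (nat \<Rightarrow> real \<Rightarrow> real) \<Rightarrow> nat list \<Rightarrow> real"
  where "multiplier X F w =
    1 / vector_derivative (inverse_branch X F w) (at (word_fixpoint X F w) within {0..1})"

definition periodic_sum :: "nat \<Rightarrow> (nat \<Rightarrow> real set) \<Rightarrow> (nat \<Rightarrow> real \<Rightarrow> real) \<Rightarrow> nat \<Rightarrow> real \<Rightarrow> real"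
  where "periodic_sum k X F n t =
    (\<Sum>w\<in>words k n. \<bar>multiplier X F w\<bar> powr (-(1 + t)) / (1 - inverse (multiplier X F w)))"

text \<open>The series below converges only for \<open>z\<close> near \<open>0\<close>, which determines the Taylor
  coefficients at \<open>0\<close>.\<close>

definition determinant :: "nat \<Rightarrow> (nat \<Rightarrow> real set) \<Rightarrow> (nat \<Rightarrow> real \<Rightarrow> real) \<Rightarrow> real \<Rightarrow> real \<Rightarrow> real"
  where "determinant k X F t z =
    exp (- (\<Sum>n. z ^ Suc n / real (Suc n) * periodic_sum k X F (Suc n) t))"

definition taylor_coeff :: "nat \<Rightarrow> (nat \<Rightarrow> real set) \<Rightarrow> (nat \<Rightarrow> real \<Rightarrow> real) \<Rightarrow> nat \<Rightarrow> real \<Rightarrow> real"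
  where "taylor_coeff k X F n t = (deriv ^^ n) (determinant k X F t) 0 / fact n"

end

theory Submission
  imports Defs
begin

text \<open>
  No Fredholm theory is needed: it suffices to know the periodic sums \<open>Z n t\<close> and their
  \<open>t\<close>-derivatives at \<open>t = 0\<close> up to exponentially small errors,
  \<open>Z n 0 = 1 + O(\<sigma>^n)\<close> and \<open>Z' n 0 = - n L + O(n \<sigma>^n)\<close> with \<open>\<sigma> < 1\<close>. The first turns the determinant into
  \<open>(1 - z) E(z)\<close>, where the coefficients of \<open>E\<close> decay exponentially and \<open>E(1) \<noteq> 0\<close>, so \<open>\<Sum> n a\<^sub>n = - E(1)\<close>;
  the second gives \<open>\<Sum> a'\<^sub>n = L E(1)\<close>.

  The factor \<open>1 / (1 - 1/(T^n)')\<close> changes the periodic sums only by \<open>O(\<theta>^n)\<close>. The remaining sums of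
  \<open>1/|(T^n)'|\<close> over periodic points are compared with the transfer operator by Ruelle's telescoping
  over words, using that the operator has a spectral gap on Lipschitz functions; the gap follows
  from an elementary contraction of the cone of functions with Lipschitz logarithm. Since
  \<open>ln |(T^n)'|\<close> is a Birkhoff sum, rotating the words reduces its weighted periodic sum to \<open>n\<close> times
  that of \<open>ln |T'|\<close>.
\<close>

text \<open>Since \<open>Z n 0\<close> tends to 1, the exponent of the determinant diverges at
  \<open>z = 1\<close>, which is exactly where both sums have to be evaluated. The factor
  \<open>1 - z\<close> is therefore split off among formal power series, and only series with
  exponentially small coefficients are evaluated at 1. \<open>E(1) \<noteq> 0\<close> because
  \<open>1 / E\<close> is the exponential of the opposite series and its coefficients are summable
  too. The cone contains positive functions only, while \<open>ln G\<close> is negative for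
  \<open>G = |S'|\<close>. Hence the second trace is taken with the weight
  \<open>(ln G + M) * G\<close> for a large constant \<open>M\<close>, and \<open>M\<close> times
  the first trace is subtracted. The product of two log-Lipschitz factors is what forces
  \<open>2 * A \<le> a\<close>. The measure is given only by its properties, so its density is
  merely integrable and cannot be fed into the cone argument. It is identified with the
  log-Lipschitz fixed density by approximating it in L1 and letting correlations decay. The map
  agrees with its branches only in the interiors of the intervals; finite exceptional sets absorb
  the difference.\<close>

unbundle no vec_syntax
unbundle fps_syntax

section \<open>Exponentials of formal power series\<close>

text \<open>Coefficient \<open>n + 1\<close> of a solution is determined by the coefficients up to
  \<open>n\<close>; characteristic 0 allows the division by \<open>n + 1\<close>.\<close>

lemma fps_linear_ode_unique:
  fixes A B C :: "'a :: field_char_0 fps"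
  assumes "fps_deriv A = C * A" and "fps_deriv B = C * B" and "A $ 0 = B $ 0"
  shows "A = B"
proof (rule fps_ext)
  fix n
  show "A $ n = B $ n"
  proof (induction n rule: less_induct)
    case (less n)
    show ?case
    proof (cases n)
      case 0
      then show ?thesis using assms(3) by simp
    next
      case (Suc m)
      have "of_nat (m+1) * A $ Suc m = (C * A) $ m"
        using arg_cong[OF assms(1), of "\<lambda>F. F $ m"] by simp
      also have "\<dots> = (C * B) $ m"
        unfolding fps_mult_nth using less Suc by (intro sum.cong) auto
      also have "\<dots> = of_nat (m+1) * B $ Suc m"
        using arg_cong[OF assms(2), of "\<lambda>F. F $ m"] by simp
      finally show ?thesis unfolding Suc
        by (metis Suc_eq_plus1 mult_left_cancel of_nat_neq_0)
    qed
  qed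
qed

text \<open>The formal series exp(-P). Composition has its usual meaning only if
  \<open>P $ 0 = 0\<close>, which the lemmas below assume wherever it matters.\<close>

definition fps_exp_neg :: "real fps \<Rightarrow> real fps"
  where "fps_exp_neg P = fps_exp 1 oo (- P)"

lemma fps_exp_neg_nth_0 [simp]: "fps_exp_neg P $ 0 = 1"
  by (simp add: fps_exp_neg_def)

lemma fps_deriv_exp_neg:
  assumes "P $ 0 = 0"
  shows "fps_deriv (fps_exp_neg P) = - fps_deriv P * fps_exp_neg P"
  using assms by (simp add: fps_exp_neg_def fps_compose_deriv)

lemma fps_exp_neg_unique:
  assumes "P $ 0 = 0" "A $ 0 = 1" "fps_deriv A = - fps_deriv P * A"
  shows "A = fps_exp_neg P"
  using assms fps_deriv_exp_neg[OF assms(1)] by (intro fps_linear_ode_unique[of A "- fps_deriv P"]) auto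

lemma fps_exp_neg_mult_uminus:
  assumes "P $ 0 = 0"
  shows "fps_exp_neg P * fps_exp_neg (- P) = 1"
proof -
  have "fps_deriv (fps_exp_neg P * fps_exp_neg (- P)) = 0"
    using fps_deriv_exp_neg[of P] fps_deriv_exp_neg[of "-P"] assms
    by (simp add: algebra_simps)
  hence "fps_exp_neg P * fps_exp_neg (- P) = fps_const ((fps_exp_neg P * fps_exp_neg (- P)) $ 0)"
    by (rule iffD1[OF fps_deriv_eq_0_iff])
  thus ?thesis by simp
qed

lemma fps_exp_neg_recurrence:
  assumes "P $ 0 = 0"
  shows "real (Suc n) * fps_exp_neg P $ Suc n
       = - (\<Sum>i\<le>n. real (Suc i) * P $ Suc i * fps_exp_neg P $ (n - i))"
proof -
  have "real (Suc n) * fps_exp_neg P $ Suc n = fps_deriv (fps_exp_neg P) $ n"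
    by simp
  also have "\<dots> = - (\<Sum>i=0..n. fps_deriv P $ i * fps_exp_neg P $ (n - i))"
    unfolding fps_deriv_exp_neg[OF assms] fps_mult_nth by (simp add: sum_negf)
  finally show ?thesis by (simp add: atLeast0AtMost)
qed

text \<open>Inserting the induction hypothesis into the recurrence bounds \<open>n\<close> times the
  coefficient by \<open>M * K * s ^ n\<close>, where \<open>M = C * g / (s - g)\<close> comes from a
  geometric series. The induction closes once \<open>n \<ge> M\<close>, and \<open>K\<close> absorbs
  the finitely many earlier coefficients. Heuristically the series is dominated by the power
  \<open>-C\<close> of \<open>1 - g z\<close>, so every base above \<open>g\<close> works.\<close>

lemma fps_exp_neg_nth_bound:
  assumes P0: "P $ 0 = 0" and "0 < g" "g < s"
    and bound: "\<And>n. \<bar>real (Suc n) * P $ Suc n\<bar> \<le> C * g ^ Suc n"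
  shows "\<exists>K. \<forall>n. \<bar>fps_exp_neg P $ n\<bar> \<le> K * s ^ n"
proof -
  let ?E = "fps_exp_neg P"
  define M where "M = C * g / (s - g)"
  obtain N :: nat where N: "real N \<ge> M" using real_arch_simple by blast
  have C: "C \<ge> 0"
    using bound[of 0] \<open>0 < g\<close> by (smt (verit) abs_ge_zero mult_neg_pos power_one_right One_nat_def)
  define K where "K = Max ((\<lambda>n. \<bar>?E $ n\<bar> / s ^ n) ` {..N})"
  have K: "\<bar>?E $ n\<bar> \<le> K * s ^ n" if "n \<le> N" for n
  proof -
    have "\<bar>?E $ n\<bar> / s ^ n \<le> K" unfolding K_def using that by (intro Max_ge) auto
    thus ?thesis using assms by (simp add: field_simps)
  qed
  have K0: "K \<ge> 0" using K[of 0] by (simp add: fps_exp_neg_def)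
  have "\<bar>?E $ n\<bar> \<le> K * s ^ n" for n
  proof (induction n rule: less_induct)
    case (less n)
    show ?case
    proof (cases "n \<le> N")
      case False
      then obtain m where m: "n = Suc m" by (cases n) auto
      have geo: "(\<Sum>i\<le>m. (g/s) ^ i) \<le> s / (s - g)"
      proof -
        have "(\<Sum>i\<le>m. (g/s) ^ i) \<le> (\<Sum>i. (g/s) ^ i)"
          using assms by (intro sum_le_suminf summable_geometric) auto
        also have "\<dots> = s / (s - g)"
          using assms by (subst suminf_geometric) (auto simp: field_simps)
        finally show ?thesis .
      qed
      have "real n * \<bar>?E $ n\<bar> = \<bar>\<Sum>i\<le>m. real (Suc i) * P $ Suc i * ?E $ (m - i)\<bar>"
        using fps_exp_neg_recurrence[OF P0, of m] unfolding m
        by (metis abs_minus abs_mult abs_of_nat)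
      also have "\<dots> \<le> (\<Sum>i\<le>m. C * g ^ Suc i * (K * s ^ (m - i)))"
      proof (rule order.trans[OF sum_abs], rule sum_mono)
        fix i assume "i \<in> {..m}"
        have "\<bar>real (Suc i) * P $ Suc i\<bar> * \<bar>?E $ (m - i)\<bar> \<le> C * g ^ Suc i * (K * s ^ (m - i))"
          by (rule mult_mono[OF bound less.IH]) (use m C assms in auto)
        thus "\<bar>real (Suc i) * P $ Suc i * ?E $ (m - i)\<bar> \<le> C * g ^ Suc i * (K * s ^ (m - i))"
          by (simp only: abs_mult)
      qed
      also have "\<dots> = C * g * K * s ^ m * (\<Sum>i\<le>m. (g/s) ^ i)"
        unfolding sum_distrib_left using assms
        by (intro sum.cong) (auto simp: power_diff power_divide)
      also have "\<dots> \<le> C * g * K * s ^ m * (s / (s - g))"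
        using geo assms C K0 by (intro mult_left_mono) auto
      also have "\<dots> = M * (K * s ^ n)"
        by (simp add: M_def m)
      also have "\<dots> \<le> real n * (K * s ^ n)"
        using N False K0 assms by (intro mult_right_mono) auto
      finally show ?thesis using False by (simp add: m)
    qed (use K in auto)
  qed
  thus ?thesis by blast
qed

section \<open>Evaluation of power series at 1\<close>

lemma sums_fps_mult_at_1:
  fixes F G :: "real fps"
  assumes "summable (\<lambda>n. \<bar>F $ n\<bar>)" "summable (\<lambda>n. \<bar>G $ n\<bar>)"
  shows "summable (\<lambda>n. \<bar>(F * G) $ n\<bar>)" "(\<Sum>n. (F * G) $ n) = (\<Sum>n. F $ n) * (\<Sum>n. G $ n)"
proof -
  have s: "summable (\<lambda>n. \<Sum>i\<le>n. norm (F $ i) * norm (G $ (n - i)))"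
    using assms by (intro summable_Cauchy_product) auto
  show "summable (\<lambda>n. \<bar>(F * G) $ n\<bar>)"
    by (rule summable_comparison_test[OF _ s])
       (auto simp: fps_mult_nth atLeast0AtMost abs_mult intro!: exI[of _ 0] order.trans[OF sum_abs])
  show "(\<Sum>n. (F * G) $ n) = (\<Sum>n. F $ n) * (\<Sum>n. G $ n)"
    using Cauchy_product[of "fps_nth F" "fps_nth G"] assms
    by (simp add: fps_mult_nth atLeast0AtMost)
qed

lemma summable_geometric_bound:
  fixes f :: "nat \<Rightarrow> real"
  assumes "0 \<le> s" "s < 1" "\<And>n. \<bar>f n\<bar> \<le> K * s ^ n"
  shows "summable (\<lambda>n. \<bar>f n\<bar>)"
  by (rule summable_comparison_test[of _ "\<lambda>n. K * s ^ n"])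
     (use assms in \<open>auto intro!: summable_mult summable_geometric exI[of _ 0]\<close>)

lemma summable_nat_geometric_bound:
  fixes f :: "nat \<Rightarrow> real"
  assumes "0 \<le> s" "s < 1" "\<And>n. \<bar>f n\<bar> \<le> K * s ^ n"
  shows "summable (\<lambda>n. \<bar>real n * f n\<bar>)"
proof (rule summable_comparison_test[of _ "\<lambda>n. K * (real (Suc n) * s ^ n)"])
  show "summable (\<lambda>n. K * (real (Suc n) * s ^ n))"
    using geometric_deriv_sums[of s] assms by (intro summable_mult) (auto simp: sums_iff)
  have "\<bar>real n * f n\<bar> \<le> K * (real (Suc n) * s ^ n)" for n
  proof -
    have "\<bar>real n * f n\<bar> = real n * \<bar>f n\<bar>" by (simp add: abs_mult)
    also have "\<dots> \<le> real (Suc n) * (K * s ^ n)"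
      using assms(3)[of n] by (intro mult_mono) auto
    finally show ?thesis by (simp add: algebra_simps)
  qed
  thus "\<exists>N. \<forall>n\<ge>N. norm \<bar>real n * f n\<bar> \<le> K * (real (Suc n) * s ^ n)" by auto
qed

text \<open>Removing the main parts from \<open>P\<close> and \<open>Q\<close> leaves
  \<open>r\<close> and \<open>s\<close> with exponentially small coefficients:
  \<open>P = - ln (1 - X) + r\<close> and \<open>Q = s - L * X / (1 - X)\<close>. Hence
  \<open>A = (1 - X) * E\<close> and \<open>B = L * X * E - (1 - X) * s * E\<close>, where
  \<open>E\<close> is the exponential of \<open>-r\<close>. At 1 the terms with the factor
  \<open>1 - X\<close> vanish, so \<open>B\<close> sums to \<open>L * E(1)\<close>, while the
  derivative of \<open>A\<close> at 1 is \<open>- E(1)\<close>.\<close>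

lemma determinant_coefficient_sums:
  fixes A B P Q :: "real fps" and L \<rho> C :: real
  assumes P0: "P $ 0 = 0" and Q0: "Q $ 0 = 0" and A: "A = fps_exp_neg P" and B: "B = - Q * A"
    and rho: "0 < \<rho>" "\<rho> < 1"
    and P: "\<And>n. \<bar>real (Suc n) * P $ Suc n - 1\<bar> \<le> C * \<rho> ^ Suc n"
    and Q: "\<And>n. \<bar>Q $ Suc n + L\<bar> \<le> C * \<rho> ^ Suc n"
  shows "summable (\<lambda>n. \<bar>B $ n\<bar>)" "summable (\<lambda>n. \<bar>real n * A $ n\<bar>)"
    and "(\<Sum>n. real n * A $ n) \<noteq> 0" "L = - (\<Sum>n. B $ n) / (\<Sum>n. real n * A $ n)"
proof -
  define r where "r = Abs_fps (\<lambda>n. if n = 0 then 0 else P $ n - 1 / real n)"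
  define s where "s = Abs_fps (\<lambda>n. if n = 0 then 0 else Q $ n + L)"
  define E where "E = fps_exp_neg r"
  define \<sigma> where "\<sigma> = (1 + \<rho>) / 2"
  have \<sigma>: "\<rho> < \<sigma>" "\<sigma> < 1" "0 < \<sigma>" using rho by (auto simp: \<sigma>_def)
  have r0: "r $ 0 = 0" by (simp add: r_def)
  have rb: "\<bar>real (Suc n) * r $ Suc n\<bar> \<le> C * \<rho> ^ Suc n" for n
    using P[of n] by (simp add: r_def algebra_simps del: of_nat_Suc)
  obtain K where K: "\<And>n. \<bar>E $ n\<bar> \<le> K * \<sigma> ^ n"
    using fps_exp_neg_nth_bound[OF r0 rho(1) \<sigma>(1) rb] unfolding E_def by blast
  obtain K' where K': "\<And>n. \<bar>fps_exp_neg (-r) $ n\<bar> \<le> K' * \<sigma> ^ n"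
    using fps_exp_neg_nth_bound[of "-r", OF _ rho(1) \<sigma>(1), of C] rb r0 by (simp del: of_nat_Suc) blast
  have sE: "summable (\<lambda>n. \<bar>E $ n\<bar>)" "summable (\<lambda>n. \<bar>fps_exp_neg (-r) $ n\<bar>)"
       "summable (\<lambda>n. \<bar>real n * E $ n\<bar>)"
    by (rule summable_geometric_bound[OF _ \<sigma>(2) K] summable_geometric_bound[OF _ \<sigma>(2) K']
         summable_nat_geometric_bound[OF _ \<sigma>(2) K]; use \<sigma> in simp)+
  have "(\<Sum>n. E $ n) * (\<Sum>n. fps_exp_neg (-r) $ n) = (\<Sum>n. (1 :: real fps) $ n)"
    using sums_fps_mult_at_1(2)[OF sE(1,2)] fps_exp_neg_mult_uminus[OF r0] by (simp add: E_def)
  also have "\<dots> = 1" by (subst suminf_finite[of "{0}"]) auto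
  finally have E1: "(\<Sum>n. E $ n) \<noteq> 0" by auto
  have dE: "fps_deriv E = - fps_deriv r * E"
    unfolding E_def by (rule fps_deriv_exp_neg[OF r0])
  have geo: "(1 - fps_X) * Abs_fps (\<lambda>_. 1 :: real) = 1"
    by (rule fps_ext) (auto simp: algebra_simps fps_X_mult_nth)
  have dP: "fps_deriv P = Abs_fps (\<lambda>_. 1) + fps_deriv r"
    by (rule fps_ext) (auto simp: r_def field_simps)
  have A_eq: "A = (1 - fps_X) * E"
    unfolding A
  proof (rule fps_exp_neg_unique[symmetric, OF P0])
    show "((1 - fps_X) * E) $ 0 = 1" by (simp add: E_def)
    have "- fps_deriv P * ((1 - fps_X) * E)
        = - ((1 - fps_X) * Abs_fps (\<lambda>_. 1)) * E + (1 - fps_X) * (- fps_deriv r * E)"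
      unfolding dP by (simp add: algebra_simps)
    thus "fps_deriv ((1 - fps_X) * E) = - fps_deriv P * ((1 - fps_X) * E)"
      unfolding geo dE[symmetric] by simp
  qed
  \<comment> \<open>The coefficients of \<open>Q\<close> tend to \<open>- L\<close>, so
    \<open>Q\<close> has no value at 1; the factor \<open>1 - X\<close> inherited from
    \<open>A\<close> cancels this simple pole.\<close>
  have Qs: "(1 - fps_X) * Q = (1 - fps_X) * s - fps_const L * fps_X"
  proof (rule fps_ext)
    fix n show "((1 - fps_X) * Q) $ n = ((1 - fps_X) * s - fps_const L * fps_X) $ n"
      by (cases n; cases "n - 1") (auto simp: s_def Q0 algebra_simps fps_X_mult_nth)
  qed
  have B_eq: "B = fps_const L * (fps_X * E) - (1 - fps_X) * (s * E)"
  proof -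
    have "B = - ((1 - fps_X) * Q) * E" by (simp add: B A_eq algebra_simps)
    thus ?thesis unfolding Qs by (simp add: algebra_simps)
  qed
  have C0: "C \<ge> 0" using P[of 0] rho by (smt (verit) abs_ge_zero mult_neg_pos power_one_right One_nat_def)
  have ss: "summable (\<lambda>n. \<bar>s $ n\<bar>)"
  proof (rule summable_geometric_bound[of \<rho>])
    fix n show "\<bar>s $ n\<bar> \<le> C * \<rho> ^ n"
      using Q[of "n - 1"] C0 by (cases n) (auto simp: s_def)
  qed (use rho in auto)
  note sF = sums_fps_mult_at_1[OF ss sE(1)]
  have sX: "summable (\<lambda>n. \<bar>(fps_X * F) $ n\<bar>)" "(\<Sum>n. (fps_X * F) $ n) = (\<Sum>n. F $ n)"
    if F: "summable (\<lambda>n. \<bar>F $ n\<bar>)" for F :: "real fps"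
  proof -
    have a: "summable (\<lambda>n. \<bar>(fps_X * F) $ Suc n\<bar>)" using F by simp
    thus b: "summable (\<lambda>n. \<bar>(fps_X * F) $ n\<bar>)" by (subst (asm) summable_Suc_iff)
    show "(\<Sum>n. (fps_X * F) $ n) = (\<Sum>n. F $ n)"
      using suminf_split_head[OF summable_rabs_cancel[OF b]] by simp
  qed
  have sd: "summable (\<lambda>n. \<bar>((1 - fps_X) * F) $ n\<bar>)" "(\<Sum>n. ((1 - fps_X) * F) $ n) = 0"
    if F: "summable (\<lambda>n. \<bar>F $ n\<bar>)" for F :: "real fps"
  proof -
    have eq: "((1 - fps_X) * F) $ n = F $ n - (fps_X * F) $ n" for n by (simp add: algebra_simps)
    show "summable (\<lambda>n. \<bar>((1 - fps_X) * F) $ n\<bar>)" unfolding eq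
      by (rule summable_comparison_test[OF _ summable_add[OF F sX(1)[OF F]]]) auto
    show "(\<Sum>n. ((1 - fps_X) * F) $ n) = 0" unfolding eq
      using suminf_diff[OF summable_rabs_cancel[OF F] summable_rabs_cancel[OF sX(1)[OF F]]] sX(2)[OF F] by simp
  qed
  have Bn: "B $ n = L * (fps_X * E) $ n - ((1 - fps_X) * (s * E)) $ n" for n
    unfolding B_eq by simp
  have l: "summable (\<lambda>n. \<bar>L * (fps_X * E) $ n\<bar>)"
    using summable_mult[OF sX(1)[OF sE(1)], of "\<bar>L\<bar>"] by (simp add: abs_mult)
  show "summable (\<lambda>n. \<bar>B $ n\<bar>)" unfolding Bn
    by (rule summable_comparison_test[OF _ summable_add[OF l sd(1)[OF sF(1)]]]) auto
  have sB: "(\<Sum>n. B $ n) = L * (\<Sum>n. E $ n)"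
    unfolding Bn
    using suminf_diff[OF summable_rabs_cancel[OF l] summable_rabs_cancel[OF sd(1)[OF sF(1)]]]
      sd(2)[OF sF(1)] suminf_mult[OF summable_rabs_cancel[OF sX(1)[OF sE(1)]]] sX(2)[OF sE(1)] by simp
  \<comment> \<open>The operator \<open>X * d/dX\<close> applied to \<open>(1 - X) * E\<close>,
    arranged so that \<open>n * E $ (n - 1)\<close> appears as a coefficient of a shifted
    derivative.\<close>
  have An: "real n * A $ n = real n * E $ n - (fps_X * (fps_deriv (fps_X * E))) $ n" for n
    by (cases n) (auto simp: A_eq algebra_simps fps_X_mult_nth)
  have d: "summable (\<lambda>n. \<bar>(fps_deriv (fps_X * E)) $ n\<bar>)"
    by (rule summable_comparison_test[OF _ summable_add[OF sE(3) sE(1)]]) (auto simp: algebra_simps)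
  show "summable (\<lambda>n. \<bar>real n * A $ n\<bar>)" unfolding An
    by (rule summable_comparison_test[OF _ summable_add[OF sE(3) sX(1)[OF d]]]) auto
  have "(fps_deriv (fps_X * E)) $ n = real n * E $ n + E $ n" for n
    unfolding fps_deriv_nth by (simp add: algebra_simps)
  hence "(\<Sum>n. (fps_deriv (fps_X * E)) $ n) = (\<Sum>n. real n * E $ n) + (\<Sum>n. E $ n)"
    using suminf_add[OF summable_rabs_cancel[OF sE(3)] summable_rabs_cancel[OF sE(1)]] by simp
  hence sA: "(\<Sum>n. real n * A $ n) = - (\<Sum>n. E $ n)" unfolding An
    using suminf_diff[OF summable_rabs_cancel[OF sE(3)] summable_rabs_cancel[OF sX(1)[OF d]]] sX(2)[OF d] by simp
  show "(\<Sum>n. real n * A $ n) \<noteq> 0" "L = - (\<Sum>n. B $ n) / (\<Sum>n. real n * A $ n)"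
    unfolding sA sB using E1 by auto
qed

section \<open>Taylor coefficients of the determinant\<close>

lemma has_fps_expansion_higher_deriv:
  fixes f :: "'a :: {banach, real_normed_field} \<Rightarrow> 'a"
  assumes "f has_fps_expansion F"
  shows "(deriv ^^ n) f has_fps_expansion (fps_deriv ^^ n) F"
  using assms by (induction n) (auto intro: has_fps_expansion_deriv)

lemma fps_nth_eq_higher_deriv:
  fixes f :: "'a :: {banach, real_normed_field} \<Rightarrow> 'a"
  assumes "f has_fps_expansion F"
  shows "F $ n = (deriv ^^ n) f 0 / fact n"
proof -
  have "eval_fps ((fps_deriv ^^ n) F) 0 = (deriv ^^ n) f 0"
    using has_fps_expansion_higher_deriv[OF assms, of n]
    by (auto simp: has_fps_expansion_def dest: eventually_nhds_x_imp_x)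
  thus ?thesis by (simp add: eval_fps_at_0 fps_0th_higher_deriv eq_divide_eq mult.commute)
qed

text \<open>On a small ball the product of the evaluated series with
  \<open>exp (eval_fps P z)\<close> has derivative 0, by the formal differential equation, and its
  value at 0 is 1.\<close>

lemma has_fps_expansion_exp_neg:
  fixes P :: "real fps"
  assumes P0: "P $ 0 = 0" and g: "0 < g"
    and bound: "\<And>n. \<bar>real (Suc n) * P $ Suc n\<bar> \<le> C * g ^ Suc n"
  shows "(\<lambda>z. exp (- eval_fps P z)) has_fps_expansion fps_exp_neg P"
proof -
  let ?E = "fps_exp_neg P"
  \<comment> \<open>Any base above \<open>g\<close> bounds the coefficients of the exponential;
    \<open>2 * g\<close> is chosen, and \<open>R\<close> is the matching radius.\<close>
  define R where "R = 1 / (2 * g)"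
  have R: "R > 0" using g by (simp add: R_def)
  obtain K where K: "\<And>n. \<bar>?E $ n\<bar> \<le> K * (2 * g) ^ n"
    using fps_exp_neg_nth_bound[OF P0 g _ bound, of "2 * g"] g by auto
  have radius: "fps_conv_radius F \<ge> R" if F: "\<And>n. \<bar>F $ n\<bar> \<le> c * (2 * g) ^ n" for F :: "real fps" and c
    unfolding fps_conv_radius_def
  proof (rule conv_radius_geI_ex)
    fix r :: real assume r: "0 < r" "ereal r < ereal R"
    have "summable (\<lambda>n. c * (2 * g * r) ^ n)"
      using r g by (intro summable_mult summable_geometric) (auto simp: R_def field_simps)
    hence "summable (\<lambda>n. F $ n * r ^ n)"
    proof (rule summable_comparison_test[rotated], intro exI allI impI)
      fix n show "norm (F $ n * r ^ n) \<le> c * (2 * g * r) ^ n"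
        using F[of n] r by (auto simp: abs_mult power_mult_distrib mult.assoc[symmetric] intro: mult_right_mono)
    qed
    thus "\<exists>z. norm z = r \<and> summable (\<lambda>n. F $ n * z ^ n)" using r by (intro exI[of _ r]) auto
  qed
  have rE: "fps_conv_radius ?E \<ge> R" by (rule radius[OF K])
  have C0: "C \<ge> 0"
    using bound[of 0] g by (smt (verit) abs_ge_zero mult_neg_pos power_one_right One_nat_def)
  have rP: "fps_conv_radius P \<ge> R"
  proof (rule radius)
    fix n show "\<bar>P $ n\<bar> \<le> C * (2 * g) ^ n"
    proof (cases n)
      case (Suc m)
      have "\<bar>P $ n\<bar> \<le> real (Suc m) * \<bar>P $ Suc m\<bar>" unfolding Suc
        by (simp add: algebra_simps)
      also have "\<dots> \<le> C * g ^ n" using bound[of m] by (simp add: Suc abs_mult)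
      also have "\<dots> \<le> C * (2 * g) ^ n" using g C0 by (intro mult_left_mono power_mono) auto
      finally show ?thesis .
    qed (use P0 C0 in simp)
  qed
  have "eval_fps ?E z = exp (- eval_fps P z)" if z: "z \<in> ball 0 R" for z :: real
  proof -
    have d: "((\<lambda>z. eval_fps ?E z * exp (eval_fps P z)) has_field_derivative 0) (at w)"
      if w: "w \<in> ball 0 R" for w
    proof -
      have wE: "ereal (norm w) < fps_conv_radius ?E" and wP: "ereal (norm w) < fps_conv_radius P"
        using w rE rP by (auto intro: less_le_trans[of _ "ereal R"])
      have wdP: "ereal (norm w) < fps_conv_radius (- fps_deriv P)"
        using wP fps_conv_radius_deriv[of P] by (auto intro: less_le_trans)
      have "eval_fps (fps_deriv ?E) w = - eval_fps (fps_deriv P) w * eval_fps ?E w"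
        unfolding fps_deriv_exp_neg[OF P0] eval_fps_mult[OF wdP wE]
        using wdP eval_fps_minus[of w "fps_deriv P"] by simp
      thus ?thesis
        by (auto intro!: derivative_eq_intros has_field_derivative_eval_fps wE wP)
    qed
    have "(\<lambda>z. eval_fps ?E z * exp (eval_fps P z)) constant_on ball 0 R"
      by (rule has_field_derivative_0_imp_constant_on[OF d]) auto
    hence "eval_fps ?E z * exp (eval_fps P z) = eval_fps ?E 0 * exp (eval_fps P 0)"
      using z R by (auto simp: constant_on_def)
    also have "\<dots> = 1" by (simp add: eval_fps_at_0 P0)
    finally show ?thesis by (simp add: exp_minus field_simps)
  qed
  hence "eventually (\<lambda>z. eval_fps ?E z = exp (- eval_fps P z)) (nhds 0)"
    using R by (intro eventually_nhds_in_open[of "ball 0 R", THEN eventually_mono]) auto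
  moreover have "fps_conv_radius ?E > 0" using rE R less_le_trans[of "ereal 0" "ereal R"] by (simp add: zero_ereal_def)
  ultimately show ?thesis by (simp add: has_fps_expansion_def)
qed

definition periodic_fps :: "nat \<Rightarrow> (nat \<Rightarrow> real set) \<Rightarrow> (nat \<Rightarrow> real \<Rightarrow> real) \<Rightarrow> real \<Rightarrow> real fps"
  where "periodic_fps k X F t = Abs_fps (\<lambda>n. if n = 0 then 0 else periodic_sum k X F n t / real n)"

lemma periodic_fps_nth_0 [simp]: "periodic_fps k X F t $ 0 = 0"
  by (simp add: periodic_fps_def)

text \<open>An arbitrary exponential bound on the periodic sums makes the numerical series converge
  near 0, which suffices to read the iterated derivatives as formal coefficients. From there on
  everything happens among formal power series.\<close>

lemma taylor_coeff_eq_fps_nth: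
  assumes "0 < g" and bound: "\<And>n. \<bar>periodic_sum k X F (Suc n) t\<bar> \<le> C * g ^ Suc n"
  shows "taylor_coeff k X F n t = fps_exp_neg (periodic_fps k X F t) $ n"
proof -
  let ?P = "periodic_fps k X F t"
  have b: "\<bar>real (Suc n) * ?P $ Suc n\<bar> \<le> C * g ^ Suc n" for n
    using bound[of n] by (simp add: periodic_fps_def del: of_nat_Suc)
  have *: "(\<lambda>z. exp (- eval_fps ?P z)) has_fps_expansion fps_exp_neg ?P"
    by (rule has_fps_expansion_exp_neg[OF _ assms(1) b]) simp
  have C0: "C \<ge> 0"
    using bound[of 0] assms(1) by (smt (verit) abs_ge_zero mult_neg_pos power_one_right One_nat_def)
  have "determinant k X F t z = exp (- eval_fps ?P z)" if z: "\<bar>z\<bar> < 1 / g" for z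
  proof -
    have "summable (\<lambda>n. ?P $ n * z ^ n)"
    proof (rule summable_comparison_test, intro exI allI impI)
      fix n show "norm (?P $ n * z ^ n) \<le> C * (g * \<bar>z\<bar>) ^ n"
      proof (cases n)
        case (Suc m)
        have "\<bar>?P $ n\<bar> \<le> real (Suc m) * \<bar>?P $ Suc m\<bar>" unfolding Suc
          by (simp add: algebra_simps)
        also have "\<dots> \<le> C * g ^ n" using b[of m] by (simp add: Suc abs_mult)
        finally show ?thesis
          by (auto simp: abs_mult power_abs power_mult_distrib mult.assoc[symmetric] intro: mult_right_mono)
      qed (use C0 in simp)
      show "summable (\<lambda>n. C * (g * \<bar>z\<bar>) ^ n)"
        using z assms(1) by (intro summable_mult summable_geometric) (auto simp: field_simps)
    qed
    from suminf_split_head[OF this]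
    have "eval_fps ?P z = (\<Sum>n. z ^ Suc n / real (Suc n) * periodic_sum k X F (Suc n) t)"
      by (simp add: eval_fps_def periodic_fps_def field_simps del: of_nat_Suc power_Suc)
    thus ?thesis by (simp add: determinant_def)
  qed
  hence "eventually (\<lambda>z. determinant k X F t z = exp (- eval_fps ?P z)) (nhds 0)"
    using assms(1) by (intro eventually_nhds_in_open[of "ball 0 (1/g)", THEN eventually_mono]) auto
  hence "determinant k X F t has_fps_expansion fps_exp_neg ?P"
    using * by (auto simp: has_fps_expansion_def elim: eventually_elim2)
  from fps_nth_eq_higher_deriv[OF this] show ?thesis by (simp add: taylor_coeff_def)
qed

text \<open>The recurrence makes each coefficient a polynomial in finitely many coefficients of
  \<open>P t\<close>, so differentiation in \<open>t\<close> involves no convergence in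
  \<open>z\<close>.\<close>

lemma fps_exp_neg_has_derivative:
  fixes P :: "real \<Rightarrow> real fps"
  assumes P0: "\<And>t. P t $ 0 = 0" and Q0: "Q $ 0 = 0"
    and Q: "\<And>n. ((\<lambda>t. P t $ n) has_real_derivative Q $ n) (at s)"
  shows "((\<lambda>t. fps_exp_neg (P t) $ n) has_real_derivative (- Q * fps_exp_neg (P s)) $ n) (at s)"
proof (induction n rule: less_induct)
  case (less n)
  define A where "A = fps_exp_neg (P s)"
  define B where "B = - Q * A"
  show ?case
  proof (cases n)
    case 0
    then show ?thesis using Q0 by simp
  next
    case (Suc m)
    have rec: "fps_exp_neg (P t) $ n
        = - (\<Sum>i\<le>m. real (Suc i) * P t $ Suc i * fps_exp_neg (P t) $ (m - i)) / real (Suc m)" for t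
      using fps_exp_neg_recurrence[of "P t" m] P0 unfolding Suc by (simp add: field_simps del: of_nat_Suc)
    \<comment> \<open>This is the differential equation of \<open>A\<close> linearised in
      \<open>t\<close>; its coefficient recurrence is the \<open>t\<close>-derivative of the
      recurrence for the exponential.\<close>
    have "fps_deriv B = - fps_deriv Q * A + (- fps_deriv (P s)) * B"
      using fps_deriv_exp_neg[of "P s"] P0 by (simp add: A_def B_def algebra_simps)
    from arg_cong[OF this, of "\<lambda>F. F $ m"]
    have "real (Suc m) * B $ Suc m
       = - (\<Sum>i\<le>m. real (Suc i) * Q $ Suc i * A $ (m - i) + real (Suc i) * P s $ Suc i * B $ (m - i))"
      by (simp add: fps_mult_nth atLeast0AtMost sum_negf sum.distrib del: fps_deriv_mult)
    hence Bn: "B $ n = - (\<Sum>i\<le>m. real (Suc i) * Q $ Suc i * A $ (m - i) + real (Suc i) * P s $ Suc i * B $ (m - i)) / real (Suc m)"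
      unfolding Suc by (simp add: field_simps del: of_nat_Suc)
    show ?thesis unfolding rec A_def[symmetric] B_def[symmetric] Bn
      by (rule derivative_eq_intros DERIV_sum Q less[folded A_def, folded B_def] refl | simp add: Suc A_def mult_ac del: of_nat_Suc)+
  qed
qed

section \<open>The transfer operator on log-Lipschitz functions\<close>

text \<open>The cone of positive functions on the unit interval whose logarithm is
  \<open>a\<close>-Lipschitz. The multiplicative form makes closure under sums immediate and lets
  the inequality pass to pointwise limits.\<close>

definition log_lipschitz :: "real \<Rightarrow> (real \<Rightarrow> real) \<Rightarrow> bool"
  where "log_lipschitz a f \<longleftrightarrow>
    (\<forall>x\<in>{0..1}. 0 < f x) \<and> (\<forall>x\<in>{0..1}. \<forall>y\<in>{0..1}. f x \<le> exp (a * \<bar>x - y\<bar>) * f y)"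

lemma log_lipschitzI:
  assumes "\<And>x. x \<in> {0..1} \<Longrightarrow> 0 < f x"
    and "\<And>x y. x \<in> {0..1} \<Longrightarrow> y \<in> {0..1} \<Longrightarrow> f x \<le> exp (a * \<bar>x - y\<bar>) * f y"
  shows "log_lipschitz a f"
  using assms by (auto simp: log_lipschitz_def)

lemma log_lipschitz_pos: "log_lipschitz a f \<Longrightarrow> x \<in> {0..1} \<Longrightarrow> 0 < f x"
  by (auto simp: log_lipschitz_def)

lemma log_lipschitzD:
  "log_lipschitz a f \<Longrightarrow> x \<in> {0..1} \<Longrightarrow> y \<in> {0..1} \<Longrightarrow> f x \<le> exp (a * \<bar>x - y\<bar>) * f y"
  by (auto simp: log_lipschitz_def)

lemma log_lipschitz_mono:
  assumes "log_lipschitz a f" "a \<le> b"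
  shows "log_lipschitz b f"
proof (rule log_lipschitzI)
  fix x y :: real assume xy: "x \<in> {0..1}" "y \<in> {0..1}"
  have "f x \<le> exp (a * \<bar>x - y\<bar>) * f y" by (rule log_lipschitzD[OF assms(1) xy])
  also have "\<dots> \<le> exp (b * \<bar>x - y\<bar>) * f y"
    using log_lipschitz_pos[OF assms(1) xy(2)] assms(2) by (intro mult_right_mono) (auto intro: mult_right_mono)
  finally show "f x \<le> exp (b * \<bar>x - y\<bar>) * f y" .
qed (use assms in \<open>auto simp: log_lipschitz_def\<close>)

lemma log_lipschitz_cmult:
  assumes "log_lipschitz a f" "c > 0"
  shows "log_lipschitz a (\<lambda>x. c * f x)"
  using assms by (auto simp: log_lipschitz_def mult.left_commute)

lemma log_lipschitz_mult:
  assumes "log_lipschitz a f" "log_lipschitz b g"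
  shows "log_lipschitz (a + b) (\<lambda>x. f x * g x)"
proof (rule log_lipschitzI)
  fix x y :: real assume xy: "x \<in> {0..1}" "y \<in> {0..1}"
  have "f x * g x \<le> (exp (a * \<bar>x - y\<bar>) * f y) * (exp (b * \<bar>x - y\<bar>) * g y)"
    using assms xy by (intro mult_mono log_lipschitzD) (auto simp: log_lipschitz_def less_imp_le)
  thus "f x * g x \<le> exp ((a + b) * \<bar>x - y\<bar>) * (f y * g y)"
    by (simp add: exp_add algebra_simps)
qed (use assms in \<open>auto simp: log_lipschitz_def\<close>)

lemma log_lipschitz_sum:
  assumes "finite I" "I \<noteq> {}" "\<And>i. i \<in> I \<Longrightarrow> log_lipschitz a (f i)"
  shows "log_lipschitz a (\<lambda>x. \<Sum>i\<in>I. f i x)"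
  using assms unfolding log_lipschitz_def sum_distrib_left
  by (auto intro!: sum_pos sum_mono)

lemma log_lipschitz_const: "c > 0 \<Longrightarrow> 0 \<le> a \<Longrightarrow> log_lipschitz a (\<lambda>_. c)"
  by (auto simp: log_lipschitz_def)

text \<open>A Harnack inequality: two points of the unit interval are at distance at most 1.\<close>

lemma log_lipschitz_sup_bound:
  assumes "log_lipschitz a f" "0 \<le> a" "x \<in> {0..1}" "y \<in> {0..1}"
  shows "f x \<le> exp a * f y"
proof -
  have "f x \<le> exp (a * \<bar>x - y\<bar>) * f y" by (rule log_lipschitzD[OF assms(1,3,4)])
  also have "\<dots> \<le> exp a * f y"
    using log_lipschitz_pos[OF assms(1,4)] assms by (intro mult_right_mono) (auto intro: mult_left_le)
  finally show ?thesis .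
qed

text \<open>From \<open>exp s - 1 \<le> s * exp s\<close> with \<open>s \<le> a\<close>. One factor
  \<open>exp a\<close> comes from there, the other from replacing \<open>f y\<close> by the value at
  the reference point \<open>z\<close>.\<close>

lemma log_lipschitz_imp_lipschitz:
  assumes f: "log_lipschitz a f" and a: "0 \<le> a" and xyz: "x \<in> {0..1}" "y \<in> {0..1}" "z \<in> {0..1}"
  shows "\<bar>f x - f y\<bar> \<le> a * exp (2 * a) * f z * \<bar>x - y\<bar>"
proof -
  have main: "f x - f y \<le> a * exp (2 * a) * f z * \<bar>x - y\<bar>"
    if xy: "x \<in> {0..1}" "y \<in> {0..1}" for x y
  proof -
    define s where "s = a * \<bar>x - y\<bar>"
    have s: "0 \<le> s" "s \<le> a" using a xy by (auto simp: s_def intro: mult_left_le)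
    have "exp s - 1 \<le> s * exp s"
      using exp_ge_add_one_self[of "- s"] by (simp add: exp_minus field_simps)
    also have "\<dots> \<le> s * exp a" using s by (intro mult_left_mono) auto
    finally have es: "exp s - 1 \<le> s * exp a" .
    have "f x - f y \<le> (exp s - 1) * f y"
      using log_lipschitzD[OF f xy] by (simp add: s_def algebra_simps)
    also have "\<dots> \<le> (s * exp a) * (exp a * f z)"
      using es s log_lipschitz_sup_bound[OF f a xy(2) xyz(3)] log_lipschitz_pos[OF f xy(2)]
      by (intro mult_mono) auto
    also have "\<dots> = a * exp (2 * a) * f z * \<bar>x - y\<bar>"
      using mult_exp_exp[of a a] by (simp add: s_def algebra_simps)
    finally show ?thesis .
  qed
  show ?thesis using main[OF xyz(1,2)] main[OF xyz(2,1)] by (simp add: abs_minus_commute abs_le_iff)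
qed

lemma continuous_on_real_lipschitz:
  fixes f :: "real \<Rightarrow> real"
  assumes "\<And>x y. x \<in> X \<Longrightarrow> y \<in> X \<Longrightarrow> \<bar>f x - f y\<bar> \<le> C * \<bar>x - y\<bar>"
  shows "continuous_on X f"
proof (rule lipschitz_on_continuous_on[of "\<bar>C\<bar>"], rule lipschitz_onI)
  fix x y assume "x \<in> X" "y \<in> X"
  from assms[OF this] show "dist (f x) (f y) \<le> \<bar>C\<bar> * dist x y"
    unfolding dist_real_def by (rule order_trans) (simp add: mult_right_mono)
qed auto

lemma log_lipschitz_continuous:
  assumes "log_lipschitz a f" "0 \<le> a"
  shows "continuous_on {0..1} f"
  by (rule continuous_on_real_lipschitz[where C = "a * exp (2 * a) * f 0"])
     (use log_lipschitz_imp_lipschitz[OF assms] in auto)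

lemma log_lipschitz_integrable:
  "log_lipschitz a f \<Longrightarrow> 0 \<le> a \<Longrightarrow> f integrable_on {0..1}"
  by (intro integrable_continuous_interval log_lipschitz_continuous)

lemma log_lipschitz_le_integral:
  assumes "log_lipschitz a f" "0 \<le> a" "x \<in> {0..1}"
  shows "f x \<le> exp a * integral {0..1} f" "integral {0..1} f \<le> exp a * f x"
proof -
  note int = log_lipschitz_integrable[OF assms(1,2)]
  have "integral {0..1::real} (\<lambda>_. f x) \<le> integral {0..1} (\<lambda>y. exp a * f y)"
  proof (rule integral_le)
    show "(\<lambda>y. exp a * f y) integrable_on {0..1}" using int by (rule integrable_on_mult_right)
  qed (use log_lipschitz_sup_bound[OF assms(1,2,3)] in auto)
  thus "f x \<le> exp a * integral {0..1} f" using int by simp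
  have "integral {0..1} f \<le> integral {0..1} (\<lambda>_::real. exp a * f x)"
    by (rule integral_le) (use int log_lipschitz_sup_bound[OF assms(1,2) _ assms(3)] in auto)
  thus "integral {0..1} f \<le> exp a * f x" by simp
qed

lemma log_lipschitz_integral_pos:
  assumes "log_lipschitz a f" "0 \<le> a"
  shows "0 < integral {0..1} f"
  using log_lipschitz_le_integral(1)[OF assms, of 0] log_lipschitz_pos[OF assms(1), of 0]
  by (smt (verit) atLeastAtMost_iff exp_gt_zero zero_less_mult_pos)

lemma log_lipschitz_imp_lipschitz_integral:
  assumes f: "log_lipschitz a f" and a: "0 \<le> a" and xy: "x \<in> {0..1}" "y \<in> {0..1}"
  shows "\<bar>f x - f y\<bar> \<le> a * exp (3 * a) * integral {0..1} f * \<bar>x - y\<bar>"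
proof -
  have "\<bar>f x - f y\<bar> \<le> a * exp (2 * a) * f 0 * \<bar>x - y\<bar>"
    by (rule log_lipschitz_imp_lipschitz[OF assms]) simp
  also have "\<dots> \<le> a * exp (2 * a) * (exp a * integral {0..1} f) * \<bar>x - y\<bar>"
    using a by (intro mult_right_mono mult_left_mono log_lipschitz_le_integral f) auto
  also have "\<dots> = a * exp (3 * a) * integral {0..1} f * \<bar>x - y\<bar>"
    using mult_exp_exp[of "2 * a" a] by (simp add: algebra_simps)
  finally show ?thesis .
qed

text \<open>A function in the smaller cone \<open>\<beta> * a\<close> has room to lose a constant.
  Convexity gives \<open>exp s - exp (\<beta> * s) \<ge> (1 - \<beta>) * (exp s - 1)\<close>, and
  this excess times \<open>g y\<close> pays for \<open>c * (exp s - 1)\<close>.\<close>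

lemma log_lipschitz_diff_const:
  assumes g: "log_lipschitz (\<beta> * a) g" and \<beta>: "0 \<le> \<beta>" "\<beta> < 1" and a: "0 \<le> a"
    and c: "0 \<le> c" "\<And>x. x \<in> {0..1} \<Longrightarrow> c \<le> (1 - \<beta>) * g x" "\<And>x. x \<in> {0..1} \<Longrightarrow> c < g x"
  shows "log_lipschitz a (\<lambda>x. g x - c)"
proof (rule log_lipschitzI)
  fix x y :: real assume xy: "x \<in> {0..1}" "y \<in> {0..1}"
  define s where "s = a * \<bar>x - y\<bar>"
  have s: "s \<ge> 0" using a by (simp add: s_def)
  have conv: "exp (\<beta> * s) \<le> \<beta> * exp s + (1 - \<beta>)"
    using convex_onD[OF exp_convex, of \<beta> 0 s] \<beta> by (simp add: algebra_simps)
  have "c * (exp s - 1) \<le> (1 - \<beta>) * g y * (exp s - 1)"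
    using c(2)[OF xy(2)] s by (intro mult_right_mono) auto
  also have "\<dots> = g y * ((1 - \<beta>) * (exp s - 1))" by simp
  also have "\<dots> \<le> g y * (exp s - exp (\<beta> * s))"
    using conv log_lipschitz_pos[OF g xy(2)] by (intro mult_left_mono) (auto simp: algebra_simps)
  finally have "exp (\<beta> * s) * g y - c \<le> exp s * (g y - c)" by (simp add: algebra_simps)
  moreover have "g x \<le> exp (\<beta> * s) * g y"
    using log_lipschitzD[OF g xy] by (simp add: s_def mult.assoc)
  ultimately show "g x - c \<le> exp (a * \<bar>x - y\<bar>) * (g y - c)" by (simp add: s_def)
qed (use c in auto)

section \<open>Words and weighted contractions\<close>

definition words_over :: "'a set \<Rightarrow> nat \<Rightarrow> 'a list set"
  where "words_over I n = {w. length w = n \<and> set w \<subseteq> I}"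

lemma words_over_0 [simp]: "words_over I 0 = {[]}"
  by (auto simp: words_over_def)

text \<open>The last letter is split off because it is the one applied first in
  \<open>foldr S\<close>: appending a letter refines the composed contraction from the inside, so
  the image shrinks within the previous image.\<close>

lemma sum_words_over_Suc:
  "(\<Sum>w\<in>words_over I (Suc n). f w) = (\<Sum>u\<in>words_over I n. \<Sum>j\<in>I. f (u @ [j]))"
proof -
  have "(\<Sum>w\<in>words_over I (Suc n). f w) = (\<Sum>(u, j)\<in>words_over I n \<times> I. f (u @ [j]))"
  proof (rule sum.reindex_bij_witness[of _ "\<lambda>(u, j). u @ [j]" "\<lambda>w. (butlast w, last w)"])
    fix w assume "w \<in> words_over I (Suc n)"
    hence w: "length w = Suc n" "set w \<subseteq> I" "w \<noteq> []" by (auto simp: words_over_def)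
    thus "(case (butlast w, last w) of (u, j) \<Rightarrow> u @ [j]) = w" by simp
    show "(butlast w, last w) \<in> words_over I n \<times> I"
      using w by (auto simp: words_over_def dest: in_set_butlastD)
    show "(case (butlast w, last w) of (u, j) \<Rightarrow> f (u @ [j])) = f w" using w by simp
  qed (auto simp: words_over_def)
  thus ?thesis by (simp add: sum.cartesian_product)
qed

lemma sum_words_over_1: "(\<Sum>w\<in>words_over I (Suc 0). f w) = (\<Sum>i\<in>I. f [i])"
  by (subst sum_words_over_Suc) simp

text \<open>An abstraction of the inverse branches \<open>S i\<close> with weights
  \<open>G i\<close>, later the absolute values of their derivatives. The assumption
  \<open>conservation\<close> is the change of variables summed over all branches: the transfer
  operator preserves the Lebesgue integral.\<close>

locale weighted_contractions =
  fixes I :: "nat set" and S G :: "nat \<Rightarrow> real \<Rightarrow> real" and \<theta> A :: real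
  assumes finite_I: "finite I" and I_nonempty: "I \<noteq> {}"
    and \<theta>: "0 < \<theta>" "\<theta> < 1" and A_nonneg: "0 \<le> A"
    and S_maps: "\<And>i x. i \<in> I \<Longrightarrow> x \<in> {0..1} \<Longrightarrow> S i x \<in> {0..1}"
    and S_contr: "\<And>i x y. i \<in> I \<Longrightarrow> x \<in> {0..1} \<Longrightarrow> y \<in> {0..1} \<Longrightarrow> \<bar>S i x - S i y\<bar> \<le> \<theta> * \<bar>x - y\<bar>"
    and G_log_lipschitz: "\<And>i. i \<in> I \<Longrightarrow> log_lipschitz A (G i)"
    and conservation: "\<And>f. continuous_on {0..1} f \<Longrightarrow>
          integral {0..1} (\<lambda>x. \<Sum>i\<in>I. G i x * f (S i x)) = integral {0..1} f"
begin

abbreviation "Sw \<equiv> foldr S"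

text \<open>The chain-rule product along a composition; for the inverse branches it is the absolute
  derivative of \<open>Sw w\<close>.\<close>

primrec Gw :: "nat list \<Rightarrow> real \<Rightarrow> real"
  where "Gw [] x = 1" | "Gw (i # w) x = G i (Sw w x) * Gw w x"

definition transfer :: "(real \<Rightarrow> real) \<Rightarrow> real \<Rightarrow> real"
  where "transfer f x = (\<Sum>i\<in>I. G i x * f (S i x))"

lemma Gw_append: "Gw (u @ v) x = Gw u (Sw v x) * Gw v x"
  by (induction u) auto

lemma Sw_maps: "set w \<subseteq> I \<Longrightarrow> x \<in> {0..1} \<Longrightarrow> Sw w x \<in> {0..1}"
proof (induction w)
  case (Cons i w)
  then show ?case using S_maps[of i "Sw w x"] by auto
qed simp

lemma Sw_contr:
  assumes "set w \<subseteq> I" "x \<in> {0..1}" "y \<in> {0..1}"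
  shows "\<bar>Sw w x - Sw w y\<bar> \<le> \<theta> ^ length w * \<bar>x - y\<bar>"
  using assms
proof (induction w)
  case (Cons i w)
  have "\<bar>Sw (i # w) x - Sw (i # w) y\<bar> \<le> \<theta> * \<bar>Sw w x - Sw w y\<bar>"
    using S_contr[of i "Sw w x" "Sw w y"] Sw_maps[of w] Cons.prems by auto
  also have "\<dots> \<le> \<theta> * (\<theta> ^ length w * \<bar>x - y\<bar>)"
    using Cons \<theta> by (intro mult_left_mono) auto
  finally show ?case by simp
qed simp

lemma Sw_continuous: "set w \<subseteq> I \<Longrightarrow> continuous_on {0..1} (Sw w)"
  by (rule continuous_on_real_lipschitz[where C = "\<theta> ^ length w"]) (use Sw_contr in auto)

lemma Gw_pos: "set w \<subseteq> I \<Longrightarrow> x \<in> {0..1} \<Longrightarrow> 0 < Gw w x"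
proof (induction w)
  case (Cons i w)
  then show ?case using log_lipschitz_pos[OF G_log_lipschitz[of i], of "Sw w x"] Sw_maps[of w x] by auto
qed simp

text \<open>Composition with a contraction scales the constant by \<open>\<theta>\<close>, and the
  weight contributes its own constant \<open>A\<close>.\<close>

lemma log_lipschitz_branch:
  assumes f: "log_lipschitz a f" and "0 \<le> a" and i: "i \<in> I"
  shows "log_lipschitz (A + \<theta> * a) (\<lambda>x. G i x * f (S i x))"
proof -
  have "log_lipschitz (\<theta> * a) (\<lambda>x. f (S i x))"
  proof (rule log_lipschitzI)
    fix x y :: real assume xy: "x \<in> {0..1}" "y \<in> {0..1}"
    have "f (S i x) \<le> exp (a * \<bar>S i x - S i y\<bar>) * f (S i y)"
      by (rule log_lipschitzD[OF f]) (use S_maps i xy in blast)+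
    also have "\<dots> \<le> exp (a * (\<theta> * \<bar>x - y\<bar>)) * f (S i y)"
      using log_lipschitz_pos[OF f S_maps[OF i xy(2)]] S_contr[OF i xy] \<open>0 \<le> a\<close>
      by (intro mult_right_mono) (auto intro: mult_left_mono)
    finally show "f (S i x) \<le> exp (\<theta> * a * \<bar>x - y\<bar>) * f (S i y)" by (simp add: algebra_simps)
  qed (use log_lipschitz_pos[OF f] S_maps[OF i] in blast)
  from log_lipschitz_mult[OF G_log_lipschitz[OF i] this] show ?thesis .
qed

lemma log_lipschitz_transfer:
  assumes "log_lipschitz a f" "0 \<le> a"
  shows "log_lipschitz (A + \<theta> * a) (transfer f)"
  unfolding transfer_def
  by (rule log_lipschitz_sum[OF finite_I I_nonempty log_lipschitz_branch[OF assms]])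

lemma integral_transfer: "continuous_on {0..1} f \<Longrightarrow> integral {0..1} (transfer f) = integral {0..1} f"
  unfolding transfer_def by (rule conservation)

lemma transfer_cong:
  "(\<And>x. x \<in> {0..1} \<Longrightarrow> f x = g x) \<Longrightarrow> x \<in> {0..1} \<Longrightarrow> transfer f x = transfer g x"
  unfolding transfer_def using S_maps by (intro sum.cong) auto

lemma transfer_sum: "transfer (\<lambda>x. \<Sum>j\<in>J. f j x) = (\<lambda>x. \<Sum>j\<in>J. transfer (f j) x)"
  unfolding transfer_def sum_distrib_left by (rule ext, rule sum.swap)

lemma transfer_cmult: "transfer (\<lambda>x. c * f x) = (\<lambda>x. c * transfer f x)"
  by (rule ext) (simp add: transfer_def sum_distrib_left mult.left_commute)

lemma transfer_diff: "transfer (\<lambda>x. f x - g x) = (\<lambda>x. transfer f x - transfer g x)"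
  by (rule ext) (simp add: transfer_def sum_subtractf right_diff_distrib)

lemma transfer_pow_sum: "(transfer ^^ n) (\<lambda>x. \<Sum>j\<in>J. f j x) = (\<lambda>x. \<Sum>j\<in>J. (transfer ^^ n) (f j) x)"
  by (induction n) (simp_all add: transfer_sum)

lemma transfer_pow_cmult: "(transfer ^^ n) (\<lambda>x. c * f x) = (\<lambda>x. c * (transfer ^^ n) f x)"
  by (induction n) (simp_all add: transfer_cmult)

end

section \<open>Spectral gap of the transfer operator\<close>

locale weighted_contractions_cone = weighted_contractions +
  fixes a \<beta> :: real
  assumes a_pos: "0 < a" and \<beta>: "0 < \<beta>" "\<beta> < 1" and cone_invariant: "A + \<theta> * a \<le> \<beta> * a"
begin

lemma a_nonneg: "0 \<le> a" using a_pos by simp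

lemma cone_invariant': "A + \<theta> * a \<le> a"
  using cone_invariant \<beta> a_pos mult_right_mono[of \<beta> 1 a] by linarith

text \<open>The share of the mass that one step turns into a constant: the image of \<open>f\<close>
  is at least \<open>exp (- a)\<close> times its integral, and the fraction
  \<open>1 - \<beta>\<close> of this may be subtracted without leaving the cone.\<close>

definition gap :: real where "gap = (1 - \<beta>) * exp (- a)"

lemma gap: "0 < gap" "gap < 1"
proof -
  show "0 < gap" using \<beta> by (simp add: gap_def)
  have "gap \<le> (1 - \<beta>) * 1" unfolding gap_def using \<beta> a_pos by (intro mult_left_mono) auto
  thus "gap < 1" using \<beta> by simp
qed

lemma log_lipschitz_transfer_cone: "log_lipschitz a f \<Longrightarrow> log_lipschitz a (transfer f)"
  by (rule log_lipschitz_mono[OF log_lipschitz_transfer cone_invariant']) (use a_nonneg in auto)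

lemma log_lipschitz_transfer_pow: "log_lipschitz a f \<Longrightarrow> log_lipschitz a ((transfer ^^ n) f)"
  by (induction n) (auto intro: log_lipschitz_transfer_cone)

lemma integral_transfer_pow:
  "log_lipschitz a f \<Longrightarrow> integral {0..1} ((transfer ^^ n) f) = integral {0..1} f"
  by (induction n) (simp_all add: integral_transfer log_lipschitz_continuous[OF log_lipschitz_transfer_pow a_nonneg])

text \<open>A Doeblin-type splitting: the transfer operator pushes a fixed fraction of the mass to a
  constant function, and the remainder stays in the cone.\<close>

lemma transfer_split:
  assumes f: "log_lipschitz a f"
  obtains f1 where "log_lipschitz a f1" "integral {0..1} f1 = integral {0..1} f"
    "\<And>x. transfer f x = gap * integral {0..1} f + (1 - gap) * f1 x"
proof -
  define J where "J = integral {0..1} f"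
  have J: "J > 0" unfolding J_def by (rule log_lipschitz_integral_pos[OF f a_nonneg])
  have Lf: "log_lipschitz (\<beta> * a) (transfer f)"
    by (rule log_lipschitz_mono[OF log_lipschitz_transfer[OF f a_nonneg] cone_invariant])
  have JL: "integral {0..1} (transfer f) = J"
    unfolding J_def by (rule integral_transfer[OF log_lipschitz_continuous[OF f a_nonneg]])
  have low: "gap * J \<le> (1 - \<beta>) * transfer f x" if "x \<in> {0..1}" for x
  proof -
    have "J \<le> exp a * transfer f x"
      using log_lipschitz_le_integral(2)[OF log_lipschitz_transfer_cone[OF f] a_nonneg that] JL by simp
    hence "exp (- a) * J \<le> transfer f x" by (simp add: exp_minus field_simps)
    thus ?thesis unfolding gap_def mult.assoc using \<beta> by (intro mult_left_mono) auto
  qed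
  have low': "gap * J < transfer f x" if x: "x \<in> {0..1}" for x
  proof -
    have "\<beta> * transfer f x > 0" using log_lipschitz_pos[OF Lf x] \<beta> by simp
    moreover have "gap * J \<le> transfer f x - \<beta> * transfer f x"
      using low[OF x] by (simp only: left_diff_distrib mult_1_left)
    ultimately show ?thesis by linarith
  qed
  have ll: "log_lipschitz a (\<lambda>x. transfer f x - gap * J)"
    by (rule log_lipschitz_diff_const[OF Lf]) (use \<beta> a_pos gap J low low' in auto)
  define f1 where "f1 = (\<lambda>x. (1 / (1 - gap)) * (transfer f x - gap * J))"
  show ?thesis
  proof
    show "log_lipschitz a f1" unfolding f1_def by (rule log_lipschitz_cmult[OF ll]) (use gap in auto)
    have "integral {0..1} (\<lambda>x. transfer f x - gap * J) = J - gap * J"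
      using log_lipschitz_integrable[OF log_lipschitz_transfer_cone[OF f] a_nonneg] JL
      by (subst integral_diff) auto
    thus "integral {0..1} f1 = integral {0..1} f"
      using gap unfolding f1_def J_def[symmetric] by (simp add: field_simps)
    show "transfer f x = gap * integral {0..1} f + (1 - gap) * f1 x" for x
      using gap unfolding f1_def J_def[symmetric] by simp
  qed
qed

text \<open>A coupling argument: the constants split off from two functions of equal integral
  coincide and cancel, so each step reduces the difference to \<open>1 - gap\<close> times a
  difference of cone functions with the same integral.\<close>

lemma transfer_pow_contracts:
  assumes "log_lipschitz a f" "log_lipschitz a g" "integral {0..1} f = integral {0..1} g"
  shows "\<exists>f' g'. log_lipschitz a f' \<and> log_lipschitz a g' \<and>
     integral {0..1} f' = integral {0..1} f \<and> integral {0..1} g' = integral {0..1} f \<and>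
     (\<forall>x. (transfer ^^ n) f x - (transfer ^^ n) g x = (1 - gap) ^ n * (f' x - g' x))"
proof (induction n)
  case 0
  then show ?case using assms by (intro exI[of _ f] exI[of _ g]) auto
next
  case (Suc n)
  then obtain f' g' where fg: "log_lipschitz a f'" "log_lipschitz a g'"
     "integral {0..1} f' = integral {0..1} f" "integral {0..1} g' = integral {0..1} f"
     and eq: "\<And>x. (transfer ^^ n) f x - (transfer ^^ n) g x = (1 - gap) ^ n * (f' x - g' x)" by blast
  obtain f1 where f1: "log_lipschitz a f1" "integral {0..1} f1 = integral {0..1} f'"
    "\<And>x. transfer f' x = gap * integral {0..1} f' + (1 - gap) * f1 x" by (rule transfer_split[OF fg(1)]) blast
  obtain g1 where g1: "log_lipschitz a g1" "integral {0..1} g1 = integral {0..1} g'"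
    "\<And>x. transfer g' x = gap * integral {0..1} g' + (1 - gap) * g1 x" by (rule transfer_split[OF fg(2)]) blast
  have "(transfer ^^ Suc n) f x - (transfer ^^ Suc n) g x = (1 - gap) ^ Suc n * (f1 x - g1 x)" for x
  proof -
    have "(transfer ^^ Suc n) f x - (transfer ^^ Suc n) g x
        = transfer (\<lambda>x. (transfer ^^ n) f x - (transfer ^^ n) g x) x" by (simp add: transfer_diff)
    also have "\<dots> = (1 - gap) ^ n * (transfer f' x - transfer g' x)"
      unfolding eq by (simp only: transfer_cmult transfer_diff)
    finally show ?thesis using f1(3) g1(3) fg by (simp add: algebra_simps)
  qed
  then show ?case using f1 g1 fg by auto
qed

text \<open>One constant for both estimates on a difference of two cone functions of unit integral:
  the first summand bounds its Lipschitz constant, the second its absolute value.\<close>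

definition lip_const :: real where "lip_const = 2 * a * exp (3 * a) + 2 * exp a"

lemma lip_const_pos: "lip_const > 0"
  using a_pos by (simp add: lip_const_def add_pos_pos)

lemma transfer_pow_diff_bounds:
  assumes f: "log_lipschitz a f" and g: "log_lipschitz a g" and J: "integral {0..1} f = J" "integral {0..1} g = J"
    and xy: "x \<in> {0..1}" "y \<in> {0..1}"
  shows "\<bar>(transfer ^^ n) f x - (transfer ^^ n) g x\<bar> \<le> lip_const * (1 - gap) ^ n * J"
    and "\<bar>((transfer ^^ n) f x - (transfer ^^ n) g x) - ((transfer ^^ n) f y - (transfer ^^ n) g y)\<bar>
         \<le> lip_const * (1 - gap) ^ n * J * \<bar>x - y\<bar>"
proof -
  obtain f' g' where fg: "log_lipschitz a f'" "log_lipschitz a g'"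
     "integral {0..1} f' = J" "integral {0..1} g' = J"
     and eq: "\<And>x. (transfer ^^ n) f x - (transfer ^^ n) g x = (1 - gap) ^ n * (f' x - g' x)"
    using transfer_pow_contracts[OF f g, of n] J by auto
  have J0: "J > 0" using log_lipschitz_integral_pos[OF f a_nonneg] J by simp
  have "\<bar>f' x - g' x\<bar> \<le> 2 * exp a * J"
    using log_lipschitz_le_integral(1)[OF fg(1) a_nonneg xy(1)] log_lipschitz_pos[OF fg(1) xy(1)]
      log_lipschitz_le_integral(1)[OF fg(2) a_nonneg xy(1)] log_lipschitz_pos[OF fg(2) xy(1)] fg by auto
  also have "\<dots> \<le> lip_const * J" unfolding lip_const_def
    using J0 a_pos by (intro mult_right_mono) auto
  finally have "(1 - gap) ^ n * \<bar>f' x - g' x\<bar> \<le> (1 - gap) ^ n * (lip_const * J)"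
    using gap by (intro mult_left_mono) auto
  thus "\<bar>(transfer ^^ n) f x - (transfer ^^ n) g x\<bar> \<le> lip_const * (1 - gap) ^ n * J"
    unfolding eq abs_mult using gap by (simp add: algebra_simps)
  have "\<bar>(f' x - g' x) - (f' y - g' y)\<bar> \<le> 2 * a * exp (3 * a) * (J * \<bar>x - y\<bar>)"
    using log_lipschitz_imp_lipschitz_integral[OF fg(1) a_nonneg xy]
      log_lipschitz_imp_lipschitz_integral[OF fg(2) a_nonneg xy] fg by (simp add: algebra_simps)
  also have "\<dots> \<le> lip_const * (J * \<bar>x - y\<bar>)" unfolding lip_const_def
    using J0 a_pos by (intro mult_right_mono) auto
  finally have "(1 - gap) ^ n * \<bar>(f' x - g' x) - (f' y - g' y)\<bar> \<le> (1 - gap) ^ n * (lip_const * (J * \<bar>x - y\<bar>))"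
    using gap by (intro mult_left_mono) auto
  thus "\<bar>((transfer ^^ n) f x - (transfer ^^ n) g x) - ((transfer ^^ n) f y - (transfer ^^ n) g y)\<bar>
         \<le> lip_const * (1 - gap) ^ n * J * \<bar>x - y\<bar>"
    unfolding eq right_diff_distrib[symmetric] abs_mult using gap by (simp add: algebra_simps)
qed

text \<open>The iterates of the constant 1 all have integral 1, so consecutive ones differ by a
  geometrically small amount and converge pointwise. The cone inequality survives the limit; strict
  positivity needs the uniform lower bound \<open>exp (- a)\<close>.\<close>

lemma invariant_density_exists:
  "\<exists>h. log_lipschitz a h \<and> integral {0..1} h = 1 \<and> (\<forall>x\<in>{0..1}. transfer h x = h x)"
proof -
  define e where "e n = (transfer ^^ n) (\<lambda>_. 1 :: real)" for n
  have one: "log_lipschitz a (\<lambda>_. 1)"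
    by (rule log_lipschitz_const) (use a_nonneg in auto)
  have e: "log_lipschitz a (e n)" "integral {0..1} (e n) = 1" for n
    unfolding e_def
    using log_lipschitz_transfer_pow[OF one] integral_transfer_pow[OF one] by simp_all
  have conv: "convergent (\<lambda>n. e n x)" if x: "x \<in> {0..1}" for x
  proof -
    have "norm (e (Suc n) x - e n x) \<le> lip_const * (1 - gap) ^ n" for n
    proof -
      have "e (Suc n) = (transfer ^^ n) (e 1)" by (simp only: e_def funpow_Suc_right o_apply funpow_0 One_nat_def)
      hence "norm (e (Suc n) x - e n x) = \<bar>(transfer ^^ n) (e 1) x - (transfer ^^ n) (e 0) x\<bar>"
        by (simp add: e_def)
      also have "\<dots> \<le> lip_const * (1 - gap) ^ n * 1"
        by (rule transfer_pow_diff_bounds(1)[OF e(1) e(1) e(2) e(2) x x])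
      finally show ?thesis by simp
    qed
    hence "\<exists>N. \<forall>n\<ge>N. norm (e (Suc n) x - e n x) \<le> lip_const * (1 - gap) ^ n" by blast
    moreover have "summable (\<lambda>n. lip_const * (1 - gap) ^ n)"
      using gap by (intro summable_mult summable_geometric) auto
    ultimately have "summable (\<lambda>n. e (Suc n) x - e n x)"
      by (rule summable_comparison_test)
    moreover have "(\<lambda>n. \<Sum>i<n. e (Suc i) x - e i x) = (\<lambda>n. e n x - e 0 x)"
      using sum_lessThan_telescope[of "\<lambda>n. e n x"] by auto
    ultimately show ?thesis by (simp add: summable_iff_convergent convergent_diff_const_right_iff)
  qed
  define h0 where "h0 x = lim (\<lambda>n. e n x)" for x
  have lim: "(\<lambda>n. e n x) \<longlonglongrightarrow> h0 x" if "x \<in> {0..1}" for x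
    using conv[OF that] by (simp add: h0_def convergent_LIMSEQ_iff)
  have pos: "h0 x \<ge> exp (- a)" if x: "x \<in> {0..1}" for x
  proof (rule LIMSEQ_le_const[OF lim[OF x]], intro exI allI impI)
    fix n show "exp (- a) \<le> e n x"
      using log_lipschitz_le_integral(2)[OF e(1)[of n] a_nonneg x] e(2)[of n]
      by (simp add: exp_minus field_simps)
  qed
  have h0: "log_lipschitz a h0"
  proof (rule log_lipschitzI)
    fix x y :: real assume xy: "x \<in> {0..1}" "y \<in> {0..1}"
    show "h0 x \<le> exp (a * \<bar>x - y\<bar>) * h0 y"
      by (rule LIMSEQ_le[OF lim[OF xy(1)] tendsto_mult_left[OF lim[OF xy(2)]]])
         (use log_lipschitzD[OF e(1) xy] in auto)
  next
    fix x :: real assume "x \<in> {0..1}"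
    from pos[OF this] show "0 < h0 x" by (smt (verit) exp_gt_zero)
  qed
  have fix_h0: "transfer h0 x = h0 x" if x: "x \<in> {0..1}" for x
  proof (rule LIMSEQ_unique)
    show "(\<lambda>n. e (Suc n) x) \<longlonglongrightarrow> h0 x" using lim[OF x] by (rule LIMSEQ_Suc)
    have "(\<lambda>n. transfer (e n) x) \<longlonglongrightarrow> transfer h0 x"
      unfolding transfer_def using S_maps x by (intro tendsto_intros lim) auto
    thus "(\<lambda>n. e (Suc n) x) \<longlonglongrightarrow> transfer h0 x" by (simp add: e_def)
  qed
  \<comment> \<open>Dividing by the integral of the limit avoids exchanging the limit with the
    integral.\<close>
  have J: "integral {0..1} h0 > 0" by (rule log_lipschitz_integral_pos[OF h0 a_nonneg])
  define h where "h = (\<lambda>x. (1 / integral {0..1} h0) * h0 x)"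
  have "log_lipschitz a h" unfolding h_def by (rule log_lipschitz_cmult[OF h0]) (use J in auto)
  moreover have "integral {0..1} h = 1" using J unfolding h_def by simp
  moreover have "transfer h x = h x" if "x \<in> {0..1}" for x
    unfolding h_def transfer_cmult fix_h0[OF that] ..
  ultimately show ?thesis by blast
qed

definition inv_density :: "real \<Rightarrow> real"
  where "inv_density = (SOME h. log_lipschitz a h \<and> integral {0..1} h = 1 \<and> (\<forall>x\<in>{0..1}. transfer h x = h x))"

lemma inv_density: "log_lipschitz a inv_density" "integral {0..1} inv_density = 1"
  "\<And>x. x \<in> {0..1} \<Longrightarrow> transfer inv_density x = inv_density x"
  using someI_ex[OF invariant_density_exists] unfolding inv_density_def[symmetric] by auto

lemma inv_density_fixed: "x \<in> {0..1} \<Longrightarrow> (transfer ^^ n) inv_density x = inv_density x"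
  proof (induction n arbitrary: x)
  case (Suc n)
  have "(transfer ^^ Suc n) inv_density x = transfer inv_density x"
    using transfer_cong[of "(transfer ^^ n) inv_density" inv_density x] Suc by simp
  thus ?case using inv_density(3)[OF Suc.prems] by simp
qed simp

text \<open>What is left of the \<open>n\<close>-th iterate after subtracting the rank-one
  projection onto the invariant density.\<close>

definition remainder :: "nat \<Rightarrow> (real \<Rightarrow> real) \<Rightarrow> real \<Rightarrow> real"
  where "remainder n f x = (transfer ^^ n) f x - integral {0..1} f * inv_density x"

text \<open>The projected part is itself an \<open>n\<close>-th iterate, namely of the multiple of
  the invariant density that has the same integral as \<open>f\<close>, so the coupling estimates
  apply.\<close>

lemma remainder_bounds:
  assumes f: "log_lipschitz a f" and xy: "x \<in> {0..1}" "y \<in> {0..1}"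
  shows "\<bar>remainder n f x\<bar> \<le> lip_const * (1 - gap) ^ n * integral {0..1} f"
    and "\<bar>remainder n f x - remainder n f y\<bar> \<le> lip_const * (1 - gap) ^ n * integral {0..1} f * \<bar>x - y\<bar>"
proof -
  let ?J = "integral {0..1} f" let ?g = "\<lambda>x. ?J * inv_density x"
  have J: "?J > 0" by (rule log_lipschitz_integral_pos[OF f a_nonneg])
  have g: "log_lipschitz a ?g" by (rule log_lipschitz_cmult[OF inv_density(1) J])
  have Jg: "integral {0..1} ?g = ?J" using inv_density(2) by simp
  have r: "remainder n f z = (transfer ^^ n) f z - (transfer ^^ n) ?g z" if "z \<in> {0..1}" for z
    unfolding transfer_pow_cmult remainder_def inv_density_fixed[OF that] ..
  show "\<bar>remainder n f x\<bar> \<le> lip_const * (1 - gap) ^ n * ?J"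
    unfolding r[OF xy(1)] by (rule transfer_pow_diff_bounds(1)[OF f g refl Jg xy])
  show "\<bar>remainder n f x - remainder n f y\<bar> \<le> lip_const * (1 - gap) ^ n * ?J * \<bar>x - y\<bar>"
    unfolding r[OF xy(1)] r[OF xy(2)] by (rule transfer_pow_diff_bounds(2)[OF f g refl Jg xy])
qed

end

section \<open>Traces over periodic words\<close>

context weighted_contractions_cone
begin

text \<open>The product \<open>Gw\<close> with its outermost factor \<open>G i\<close> replaced by
  \<open>p i\<close>. Taking \<open>p = G\<close> recovers \<open>Gw\<close>; other choices attach
  an observable to the first letter. The value at the empty word is a dummy.\<close>

primrec weighted_Gw :: "(nat \<Rightarrow> real \<Rightarrow> real) \<Rightarrow> nat list \<Rightarrow> real \<Rightarrow> real"
  where "weighted_Gw p [] x = 0" | "weighted_Gw p (i # u) x = p i (Sw u x) * Gw u x"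

lemma weighted_Gw_single: "weighted_Gw p [i] = p i"
  by (rule ext) simp

text \<open>The new letter acts innermost, so the marked first letter is untouched and the
  right-hand side is a summand of the transfer operator. Nonemptiness is essential, since otherwise
  the new letter would be the marked one.\<close>

lemma weighted_Gw_snoc: "u \<noteq> [] \<Longrightarrow> weighted_Gw p (u @ [j]) x = G j x * weighted_Gw p u (S j x)"
  by (cases u) (auto simp: Gw_append)

lemma sum_weighted_Gw_snoc:
  "u \<noteq> [] \<Longrightarrow> (\<lambda>x. \<Sum>j\<in>I. weighted_Gw p (u @ [j]) x) = transfer (weighted_Gw p u)"
  by (rule ext) (simp add: weighted_Gw_snoc transfer_def)

text \<open>The slower of two exponential rates: the shrinking of the images of words and the decay
  under the operator.\<close>

definition rate :: real where "rate = max \<theta> (1 - gap)"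

lemma rate: "0 < rate" "rate < 1" "\<theta> \<le> rate" "1 - gap \<le> rate"
  using \<theta> gap by (auto simp: rate_def)

lemma continuous_inv_density_Sw:
  assumes "set u \<subseteq> I"
  shows "continuous_on {0..1} (\<lambda>x. inv_density (Sw u x))"
proof (rule continuous_on_compose2[where g = inv_density and f = "Sw u"])
  show "continuous_on {0..1} inv_density" by (rule log_lipschitz_continuous[OF inv_density(1) a_nonneg])
  show "continuous_on {0..1} (Sw u)" by (rule Sw_continuous[OF assms])
  show "Sw u ` {0..1} \<subseteq> {0..1}" using Sw_maps[OF assms] by blast
qed

context
  fixes p :: "nat \<Rightarrow> real \<Rightarrow> real"
  assumes p: "\<And>i. i \<in> I \<Longrightarrow> log_lipschitz a (p i)"
begin

lemma log_lipschitz_weighted_Gw: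
  "u \<noteq> [] \<Longrightarrow> set u \<subseteq> I \<Longrightarrow> log_lipschitz a (weighted_Gw p u)"
proof (induction u rule: rev_induct)
  case (snoc j u)
  show ?case
  proof (cases "u = []")
    case True
    then show ?thesis using p[of j] snoc.prems by simp
  next
    case False
    have "log_lipschitz a (\<lambda>x. G j x * weighted_Gw p u (S j x))"
      using log_lipschitz_branch[of a "weighted_Gw p u" j] snoc False a_nonneg cone_invariant'
      by (auto intro: log_lipschitz_mono)
    thus ?thesis using weighted_Gw_snoc[OF False, of p j] by simp
  qed
qed simp

lemma sum_integral_weighted_Gw_snoc:
  assumes "u \<noteq> []" "set u \<subseteq> I"
  shows "(\<Sum>j\<in>I. integral {0..1} (weighted_Gw p (u @ [j]))) = integral {0..1} (weighted_Gw p u)"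
proof -
  have "(\<Sum>j\<in>I. integral {0..1} (weighted_Gw p (u @ [j])))
      = integral {0..1} (\<lambda>x. \<Sum>j\<in>I. weighted_Gw p (u @ [j]) x)"
    using assms by (intro integral_sum[symmetric] finite_I log_lipschitz_integrable[OF _ a_nonneg]
       log_lipschitz_weighted_Gw) auto
  also have "\<dots> = integral {0..1} (weighted_Gw p u)"
    unfolding sum_weighted_Gw_snoc[OF assms(1)]
    by (rule integral_transfer[OF log_lipschitz_continuous[OF log_lipschitz_weighted_Gw[OF assms] a_nonneg]])
  finally show ?thesis .
qed

text \<open>Total mass does not depend on the word length. This is what keeps errors proportional to
  the mass of a word under control although the number of words grows exponentially.\<close>

lemma sum_integral_weighted_Gw:
  "(\<Sum>u\<in>words_over I (Suc n). integral {0..1} (weighted_Gw p u)) = (\<Sum>i\<in>I. integral {0..1} (p i))"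
proof (induction n)
  case 0
  show ?case by (simp add: sum_words_over_1 weighted_Gw_single del: weighted_Gw.simps)
next
  case (Suc n)
  have "(\<Sum>u\<in>words_over I (Suc (Suc n)). integral {0..1} (weighted_Gw p u))
      = (\<Sum>u\<in>words_over I (Suc n). integral {0..1} (weighted_Gw p u))"
    unfolding sum_words_over_Suc[of _ _ "Suc n"]
    by (rule sum.cong[OF refl], rule sum_integral_weighted_Gw_snoc) (auto simp: words_over_def)
  thus ?case using Suc by simp
qed

lemma mass_nonneg: "(\<Sum>i\<in>I. integral {0..1} (p i)) \<ge> 0"
  by (rule sum_nonneg, rule less_imp_le, rule log_lipschitz_integral_pos[OF p a_nonneg])

lemma sum_remainder_weighted_Gw_snoc:
  assumes "u \<noteq> []" "set u \<subseteq> I"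
  shows "(\<Sum>j\<in>I. remainder m (weighted_Gw p (u @ [j])) x) = remainder (Suc m) (weighted_Gw p u) x"
proof -
  have "(\<Sum>j\<in>I. (transfer ^^ m) (weighted_Gw p (u @ [j])) x) = (transfer ^^ Suc m) (weighted_Gw p u) x"
    using fun_cong[OF transfer_pow_sum[of m "\<lambda>j. weighted_Gw p (u @ [j])" I], of x]
    unfolding sum_weighted_Gw_snoc[OF assms(1)] by (simp only: funpow_Suc_right o_apply)
  thus ?thesis unfolding remainder_def sum_subtractf sum_distrib_right[symmetric]
    by (simp only: sum_integral_weighted_Gw_snoc[OF assms])
qed

context
  fixes y :: "nat list \<Rightarrow> real"
  assumes y: "\<And>u. u \<noteq> [] \<Longrightarrow> set u \<subseteq> I \<Longrightarrow> y u \<in> Sw u ` {0..1}"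
begin

lemma y_unit: "u \<noteq> [] \<Longrightarrow> set u \<subseteq> I \<Longrightarrow> y u \<in> {0..1}"
  using y[of u] Sw_maps[of u] by auto

text \<open>Both points lie in the image of the unit interval under \<open>Sw u\<close>, whose
  length is at most \<open>\<theta> ^ length u\<close>.\<close>

lemma y_snoc:
  assumes "u \<noteq> []" "set u \<subseteq> I" "j \<in> I"
  shows "\<bar>y (u @ [j]) - y u\<bar> \<le> \<theta> ^ length u"
proof -
  obtain z z' where z: "z \<in> {0..1}" "z' \<in> {0..1}" "y u = Sw u z" "y (u @ [j]) = Sw u (S j z')"
    using y[of u] y[of "u @ [j]"] assms by auto
  have "\<bar>y (u @ [j]) - y u\<bar> \<le> \<theta> ^ length u * \<bar>S j z' - z\<bar>"
    unfolding z by (rule Sw_contr[OF assms(2) S_maps[OF assms(3) z(2)] z(1)])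
  also have "\<dots> \<le> \<theta> ^ length u * 1"
    using S_maps[OF assms(3) z(2)] z(1) \<theta> by (intro mult_left_mono) auto
  finally show ?thesis by simp
qed

text \<open>Ruelle's telescoping: refining the words letter by letter moves the evaluation points by a
  geometrically small amount, while one iterate of the transfer operator is traded for one letter.\<close>

lemma telescope_step:
  "\<bar>(\<Sum>u\<in>words_over I (Suc (Suc k)). remainder m (weighted_Gw p u) (y u))
    - (\<Sum>u\<in>words_over I (Suc k). remainder (Suc m) (weighted_Gw p u) (y u))\<bar>
   \<le> lip_const * (1 - gap) ^ m * \<theta> ^ Suc k * (\<Sum>i\<in>I. integral {0..1} (p i))"
proof -
  let ?W = "words_over I (Suc k)"
  have W: "u \<noteq> []" "set u \<subseteq> I" "length u = Suc k" if "u \<in> ?W" for u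
    using that by (auto simp: words_over_def)
  have e1: "(\<Sum>u\<in>words_over I (Suc (Suc k)). remainder m (weighted_Gw p u) (y u))
    - (\<Sum>u\<in>?W. remainder (Suc m) (weighted_Gw p u) (y u))
    = (\<Sum>u\<in>?W. \<Sum>j\<in>I. remainder m (weighted_Gw p (u @ [j])) (y (u @ [j]))
         - remainder m (weighted_Gw p (u @ [j])) (y u))"
    unfolding sum_words_over_Suc[of _ _ "Suc k"] sum_subtractf
    by (simp add: W sum_remainder_weighted_Gw_snoc cong: sum.cong)
  have b: "\<bar>\<Sum>u\<in>?W. \<Sum>j\<in>I. remainder m (weighted_Gw p (u @ [j])) (y (u @ [j]))
         - remainder m (weighted_Gw p (u @ [j])) (y u)\<bar> \<le> (\<Sum>u\<in>?W. \<Sum>j\<in>I. lip_const * (1 - gap) ^ m * \<theta> ^ Suc k * integral {0..1} (weighted_Gw p (u @ [j])))"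
  proof (rule order_trans[OF sum_abs], rule sum_mono, rule order_trans[OF sum_abs], rule sum_mono)
    fix u j assume u: "u \<in> ?W" and j: "j \<in> I"
    have uj: "set (u @ [j]) \<subseteq> I" using W[OF u] j by auto
    have c: "log_lipschitz a (weighted_Gw p (u @ [j]))"
      by (rule log_lipschitz_weighted_Gw) (use uj in auto)
    have "\<bar>remainder m (weighted_Gw p (u @ [j])) (y (u @ [j])) - remainder m (weighted_Gw p (u @ [j])) (y u)\<bar>
        \<le> lip_const * (1 - gap) ^ m * integral {0..1} (weighted_Gw p (u @ [j])) * \<bar>y (u @ [j]) - y u\<bar>"
      by (rule remainder_bounds(2)[OF c y_unit[OF _ uj] y_unit[OF W(1,2)[OF u]]]) simp
    also have "\<dots> \<le> lip_const * (1 - gap) ^ m * integral {0..1} (weighted_Gw p (u @ [j])) * \<theta> ^ Suc k"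
      using y_snoc[OF W(1,2)[OF u] j] W(3)[OF u] lip_const_pos gap log_lipschitz_integral_pos[OF c a_nonneg]
      by (intro mult_left_mono mult_nonneg_nonneg) auto
    finally show "\<bar>remainder m (weighted_Gw p (u @ [j])) (y (u @ [j])) - remainder m (weighted_Gw p (u @ [j])) (y u)\<bar>
        \<le> lip_const * (1 - gap) ^ m * \<theta> ^ Suc k * integral {0..1} (weighted_Gw p (u @ [j]))"
      by (simp only: mult_ac)
  qed
  have "(\<Sum>i\<in>I. integral {0..1} (p i)) = (\<Sum>u\<in>?W. \<Sum>j\<in>I. integral {0..1} (weighted_Gw p (u @ [j])))"
    using sum_integral_weighted_Gw[of "Suc k"] by (simp only: sum_words_over_Suc[of _ _ "Suc k"])
  hence e2: "(\<Sum>u\<in>?W. \<Sum>j\<in>I. lip_const * (1 - gap) ^ m * \<theta> ^ Suc k * integral {0..1} (weighted_Gw p (u @ [j])))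
     = lip_const * (1 - gap) ^ m * \<theta> ^ Suc k * (\<Sum>i\<in>I. integral {0..1} (p i))"
    by (simp only: sum_distrib_left)
  show ?thesis unfolding e1 using b unfolding e2 .
qed

text \<open>Trading a letter for an iterate preserves \<open>m + k\<close>, so all trades cost the
  same order \<open>rate ^ (m + k)\<close>; their number is the source of the linear factor. Words
  of one letter are estimated directly.\<close>

lemma sum_remainder_bound:
  "\<bar>\<Sum>u\<in>words_over I (Suc k). remainder m (weighted_Gw p u) (y u)\<bar>
   \<le> lip_const * (\<Sum>i\<in>I. integral {0..1} (p i)) * real (Suc k) * rate ^ (m + k)"
proof (induction k arbitrary: m)
  case 0
  let ?J = "\<Sum>i\<in>I. integral {0..1} (p i)"
  have "\<bar>\<Sum>u\<in>words_over I (Suc 0). remainder m (weighted_Gw p u) (y u)\<bar>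
      \<le> (\<Sum>i\<in>I. lip_const * rate ^ m * integral {0..1} (p i))"
    unfolding sum_words_over_1
  proof (rule order_trans[OF sum_abs], rule sum_mono)
    fix i assume i: "i \<in> I"
    have yi: "y [i] \<in> {0..1}" by (rule y_unit) (use i in auto)
    have "\<bar>remainder m (p i) (y [i])\<bar> \<le> lip_const * (1 - gap) ^ m * integral {0..1} (p i)"
      by (rule remainder_bounds(1)[OF p[OF i] yi yi])
    also have "\<dots> \<le> lip_const * rate ^ m * integral {0..1} (p i)"
      using gap rate lip_const_pos log_lipschitz_integral_pos[OF p[OF i] a_nonneg]
      by (intro mult_right_mono mult_left_mono power_mono) auto
    finally show "\<bar>remainder m (weighted_Gw p [i]) (y [i])\<bar> \<le> lip_const * rate ^ m * integral {0..1} (p i)"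
      unfolding weighted_Gw_single .
  qed
  also have "\<dots> = lip_const * ?J * real (Suc 0) * rate ^ (m + 0)"
    by (simp add: sum_distrib_left mult_ac)
  finally show ?case .
next
  case (Suc k)
  let ?J = "\<Sum>i\<in>I. integral {0..1} (p i)"
  note J = mass_nonneg
  have "(1 - gap) ^ m * \<theta> ^ Suc k \<le> rate ^ m * rate ^ Suc k"
    using gap rate \<theta> by (intro mult_mono power_mono) auto
  hence "lip_const * ?J * ((1 - gap) ^ m * \<theta> ^ Suc k) \<le> lip_const * ?J * rate ^ (m + Suc k)"
    unfolding power_add using J lip_const_pos by (intro mult_left_mono mult_nonneg_nonneg) simp_all
  with telescope_step[where k = k and m = m] Suc[where m = "Suc m"] show ?case
    by (simp add: algebra_simps)
qed

text \<open>Summing over the appended letter gives the transfer operator applied to the integrand of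
  the shorter word, and its integral is conserved.\<close>

lemma sum_integral_density_weighted_Gw:
  "(\<Sum>u\<in>words_over I (Suc n). integral {0..1} (\<lambda>x. inv_density (Sw u x) * weighted_Gw p u x))
   = (\<Sum>i\<in>I. integral {0..1} (\<lambda>x. inv_density (S i x) * p i x))"
proof (induction n)
  case 0
  show ?case by (simp add: sum_words_over_1)
next
  case (Suc n)
  have cont: "continuous_on {0..1} (\<lambda>x. inv_density (Sw u x) * weighted_Gw p u x)" if "u \<noteq> []" "set u \<subseteq> I" for u
    by (intro continuous_on_mult continuous_inv_density_Sw log_lipschitz_continuous[OF log_lipschitz_weighted_Gw a_nonneg] that)
  have "(\<Sum>u\<in>words_over I (Suc (Suc n)). integral {0..1} (\<lambda>x. inv_density (Sw u x) * weighted_Gw p u x))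
     = (\<Sum>u\<in>words_over I (Suc n). integral {0..1} (\<lambda>x. inv_density (Sw u x) * weighted_Gw p u x))"
    unfolding sum_words_over_Suc[of _ _ "Suc n"]
  proof (rule sum.cong[OF refl])
    fix u assume "u \<in> words_over I (Suc n)"
    hence u: "u \<noteq> []" "set u \<subseteq> I" by (auto simp: words_over_def)
    have "(\<Sum>j\<in>I. integral {0..1} (\<lambda>x. inv_density (Sw (u @ [j]) x) * weighted_Gw p (u @ [j]) x))
       = integral {0..1} (\<lambda>x. \<Sum>j\<in>I. inv_density (Sw (u @ [j]) x) * weighted_Gw p (u @ [j]) x)"
      using u by (intro integral_sum[symmetric] finite_I integrable_continuous_interval cont) auto
    also have "\<dots> = integral {0..1} (transfer (\<lambda>x. inv_density (Sw u x) * weighted_Gw p u x))"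
      by (rule arg_cong[of _ _ "integral {0..1}"], rule ext)
         (simp add: transfer_def weighted_Gw_snoc[OF u(1)] mult_ac)
    also have "\<dots> = integral {0..1} (\<lambda>x. inv_density (Sw u x) * weighted_Gw p u x)"
      by (rule integral_transfer[OF cont[OF u]])
    finally show "(\<Sum>j\<in>I. integral {0..1} (\<lambda>x. inv_density (Sw (u @ [j]) x) * weighted_Gw p (u @ [j]) x))
       = integral {0..1} (\<lambda>x. inv_density (Sw u x) * weighted_Gw p u x)" .
  qed
  thus ?case using Suc by simp
qed

lemma inv_density_diff:
  assumes u: "length u = Suc n" "set u \<subseteq> I" and x: "x \<in> {0..1}"
  shows "\<bar>inv_density (y u) - inv_density (Sw u x)\<bar> \<le> lip_const * rate ^ n"
proof -
  have ne: "u \<noteq> []" using u(1) by auto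
  obtain z where z: "z \<in> {0..1}" "y u = Sw u z" using y[OF ne u(2)] by blast
  have "\<bar>inv_density (y u) - inv_density (Sw u x)\<bar> \<le> a * exp (3 * a) * 1 * \<bar>y u - Sw u x\<bar>"
    using log_lipschitz_imp_lipschitz_integral[OF inv_density(1) a_nonneg y_unit[OF ne u(2)] Sw_maps[OF u(2) x]]
    unfolding inv_density(2) .
  also have "\<dots> \<le> lip_const * rate ^ n"
  proof (rule mult_mono)
    show "a * exp (3 * a) * 1 \<le> lip_const"
      unfolding lip_const_def using a_pos mult_pos_pos[OF a_pos exp_gt_zero[of "3 * a"]] exp_gt_zero[of a] by linarith
    have "\<bar>y u - Sw u x\<bar> \<le> \<theta> ^ Suc n * \<bar>z - x\<bar>"
      using Sw_contr[OF u(2) z(1) x] unfolding z(2) u(1) .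
    also have "\<dots> \<le> rate ^ Suc n * 1"
    proof (rule mult_mono)
      show "\<theta> ^ Suc n \<le> rate ^ Suc n" using rate \<theta> by (intro power_mono) auto
      show "\<bar>z - x\<bar> \<le> 1" using z(1) x by auto
    qed (use rate in auto)
    also have "\<dots> \<le> rate ^ n" using rate by (simp add: mult_left_le_one_le)
    finally show "\<bar>y u - Sw u x\<bar> \<le> rate ^ n" .
  qed (use lip_const_pos in auto)
  finally show ?thesis .
qed

text \<open>Each term is its remainder plus its mass times the invariant density at
  \<open>y u\<close>. The remainders cost \<open>n + 1\<close> units by telescoping. One more unit
  pays for replacing the density at \<open>y u\<close> by its values on the whole image of
  \<open>Sw u\<close>, after which the sum is exactly independent of the word length.\<close>

lemma trace_formula:
  "\<bar>(\<Sum>u\<in>words_over I (Suc n). weighted_Gw p u (y u)) - (\<Sum>i\<in>I. integral {0..1} (\<lambda>x. inv_density (S i x) * p i x))\<bar>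
   \<le> lip_const * (\<Sum>i\<in>I. integral {0..1} (p i)) * real (n + 2) * rate ^ n"
proof -
  let ?W = "words_over I (Suc n)" and ?J = "\<Sum>i\<in>I. integral {0..1} (p i)"
  let ?H = "weighted_Gw p"
  note J = mass_nonneg
  have W: "u \<noteq> []" "set u \<subseteq> I" "length u = Suc n" if "u \<in> ?W" for u
    using that by (auto simp: words_over_def)
  have c: "log_lipschitz a (?H u)" if "u \<in> ?W" for u
    by (rule log_lipschitz_weighted_Gw) (use W[OF that] in auto)
  have 1: "\<bar>(\<Sum>u\<in>?W. ?H u (y u)) - (\<Sum>u\<in>?W. integral {0..1} (?H u) * inv_density (y u))\<bar>
      \<le> lip_const * ?J * real (Suc n) * rate ^ n"
    \<comment> \<open>With no iterate applied, \<open>remainder 0 f\<close> is \<open>f\<close>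
      minus its mass times the invariant density.\<close>
    using sum_remainder_bound[where k = n and m = 0] unfolding remainder_def by (simp add: sum_subtractf)
  have word: "\<bar>integral {0..1} (?H u) * inv_density (y u) - integral {0..1} (\<lambda>x. inv_density (Sw u x) * ?H u x)\<bar>
       \<le> lip_const * rate ^ n * integral {0..1} (?H u)" if u: "u \<in> ?W" for u
  proof -
    note uI = W(2)[OF u]
    note cd = continuous_inv_density_Sw[OF uI]
    note cH = log_lipschitz_continuous[OF c[OF u] a_nonneg]
    note diff = inv_density_diff[OF W(3)[OF u] uI]
    have e1: "integral {0..1} (\<lambda>x. ?H u x * inv_density (y u) - inv_density (Sw u x) * ?H u x)
       = integral {0..1} (\<lambda>x. ?H u x * inv_density (y u)) - integral {0..1} (\<lambda>x. inv_density (Sw u x) * ?H u x)"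
      by (rule integral_diff; intro integrable_continuous_interval continuous_intros cd cH)
    have b: "norm (integral {0..1} (\<lambda>x. ?H u x * inv_density (y u) - inv_density (Sw u x) * ?H u x))
       \<le> integral {0..1} (\<lambda>x. lip_const * rate ^ n * ?H u x)"
    proof (rule integral_norm_bound_integral)
      fix x :: real assume x: "x \<in> {0..1}"
      have "norm ((inv_density (y u) - inv_density (Sw u x)) * ?H u x) \<le> lip_const * rate ^ n * ?H u x"
        unfolding norm_mult using diff[OF x] log_lipschitz_pos[OF c[OF u] x] by (auto intro: mult_right_mono)
      thus "norm (?H u x * inv_density (y u) - inv_density (Sw u x) * ?H u x) \<le> lip_const * rate ^ n * ?H u x"
        by (simp add: algebra_simps)
    qed (intro integrable_continuous_interval continuous_intros cd cH)+
    have e2: "integral {0..1} (\<lambda>x. lip_const * rate ^ n * ?H u x) = lip_const * rate ^ n * integral {0..1} (?H u)"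
      by (rule integral_mult_right)
    have e3: "integral {0..1} (\<lambda>x. ?H u x * inv_density (y u)) = integral {0..1} (?H u) * inv_density (y u)"
      by (rule integral_mult_left)
    show ?thesis using b unfolding e1 e2 e3 real_norm_def .
  qed
  have "\<bar>(\<Sum>u\<in>?W. integral {0..1} (?H u) * inv_density (y u) - integral {0..1} (\<lambda>x. inv_density (Sw u x) * ?H u x))\<bar>
     \<le> (\<Sum>u\<in>?W. lip_const * rate ^ n * integral {0..1} (?H u))"
    by (rule order_trans[OF sum_abs sum_mono[OF word]])
  hence 2: "\<bar>(\<Sum>u\<in>?W. integral {0..1} (?H u) * inv_density (y u)) - (\<Sum>i\<in>I. integral {0..1} (\<lambda>x. inv_density (S i x) * p i x))\<bar>
     \<le> lip_const * rate ^ n * ?J"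
    unfolding sum_subtractf sum_integral_density_weighted_Gw sum_distrib_left[symmetric] sum_integral_weighted_Gw .
  from 1 2 show ?thesis by (simp add: algebra_simps)
qed

end

end

end

section \<open>Periodic points and rotation of words\<close>

lemma sum_words_over_rotate1:
  "(\<Sum>w\<in>words_over I (Suc n). f (rotate1 w)) = (\<Sum>w\<in>words_over I (Suc n). f w)"
proof (rule sum.reindex_bij_witness[of _ "\<lambda>w. last w # butlast w" rotate1])
  fix w assume "w \<in> words_over I (Suc n)"
  hence w: "length w = Suc n" "set w \<subseteq> I" "w \<noteq> []" by (auto simp: words_over_def)
  show "last (rotate1 w) # butlast (rotate1 w) = w" using w by (cases w) auto
  show "rotate1 (last w # butlast w) = w" using w by simp
  show "rotate1 w \<in> words_over I (Suc n)" using w by (simp add: words_over_def)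
  have "last w \<in> set w" using w by simp
  thus "last w # butlast w \<in> words_over I (Suc n)"
    using w by (auto simp: words_over_def dest: in_set_butlastD)
qed simp

lemma sum_words_over_rotate:
  "(\<Sum>w\<in>words_over I (Suc n). f (rotate j w)) = (\<Sum>w\<in>words_over I (Suc n). f w)"
proof (induction j arbitrary: f)
  case (Suc j)
  have "(\<Sum>w\<in>words_over I (Suc n). f (rotate (Suc j) w)) = (\<Sum>w\<in>words_over I (Suc n). (f \<circ> rotate1) (rotate j w))"
    by (simp add: rotate_def)
  also have "\<dots> = (\<Sum>w\<in>words_over I (Suc n). (f \<circ> rotate1) w)" by (rule Suc)
  finally show ?case by (simp add: sum_words_over_rotate1)
qed simp

context weighted_contractions
begin

lemma Sw_fixpoint_ex1:
  assumes "w \<noteq> []" "set w \<subseteq> I"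
  shows "\<exists>!x. x \<in> {0..1} \<and> Sw w x = x"
proof -
  have "\<exists>!x\<in>{0..1}. Sw w x = x"
  proof (rule Banach_fix[OF compact_imp_complete])
    show "compact {0..1::real}" by simp
    show "\<theta> ^ length w < 1" using assms(1) \<theta> by (simp add: power_less_one_iff)
    show "Sw w ` {0..1} \<subseteq> {0..1}" using Sw_maps[OF assms(2)] by blast
    show "dist (Sw w x) (Sw w y) \<le> \<theta> ^ length w * dist x y" if "x \<in> {0..1}" "y \<in> {0..1}" for x y
      unfolding dist_real_def using that by (intro Sw_contr assms) auto
  qed (use \<theta> in auto)
  thus ?thesis by blast
qed

definition fixpt :: "nat list \<Rightarrow> real"
  where "fixpt w = (THE x. x \<in> {0..1} \<and> Sw w x = x)"

lemma fixpt:
  assumes "w \<noteq> []" "set w \<subseteq> I"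
  shows "fixpt w \<in> {0..1}" "Sw w (fixpt w) = fixpt w"
  using theI'[OF Sw_fixpoint_ex1[OF assms]] by (auto simp: fixpt_def)

lemma fixpt_unique:
  assumes "w \<noteq> []" "set w \<subseteq> I" "x \<in> {0..1}" "Sw w x = x"
  shows "fixpt w = x"
  using Sw_fixpoint_ex1[OF assms(1,2)] fixpt[OF assms(1,2)] assms(3,4) by blast

text \<open>Cyclically permuted words have fixed points on the same periodic orbit: applying
  \<open>Sw v\<close> to the equation \<open>Sw u (Sw v x) = x\<close> makes \<open>Sw v x\<close>
  fixed by \<open>Sw v\<close> after \<open>Sw u\<close>.\<close>

lemma fixpt_append_swap:
  assumes "u @ v \<noteq> []" "set (u @ v) \<subseteq> I"
  shows "fixpt (v @ u) = Sw v (fixpt (u @ v))"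
proof (rule fixpt_unique)
  show "Sw v (fixpt (u @ v)) \<in> {0..1}" using Sw_maps[of v] fixpt[OF assms] assms(2) by auto
  show "Sw (v @ u) (Sw v (fixpt (u @ v))) = Sw v (fixpt (u @ v))"
    using fixpt(2)[OF assms] by simp
qed (use assms in auto)

definition Dw :: "nat list \<Rightarrow> real" where "Dw w = Gw w (fixpt w)"

lemma Dw_pos: "w \<noteq> [] \<Longrightarrow> set w \<subseteq> I \<Longrightarrow> 0 < Dw w"
  unfolding Dw_def using fixpt by (intro Gw_pos) auto

lemma Dw_append_swap:
  assumes "u @ v \<noteq> []" "set (u @ v) \<subseteq> I"
  shows "Dw (v @ u) = Dw (u @ v)"
proof -
  have "Sw u (Sw v (fixpt (u @ v))) = fixpt (u @ v)" using fixpt(2)[OF assms] by simp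
  thus ?thesis unfolding Dw_def fixpt_append_swap[OF assms] Gw_append by simp
qed

lemma Dw_rotate: "w \<noteq> [] \<Longrightarrow> set w \<subseteq> I \<Longrightarrow> Dw (rotate j w) = Dw w"
  unfolding rotate_drop_take
  using Dw_append_swap[of "take (j mod length w) w" "drop (j mod length w) w"] by simp

text \<open>The contribution of the outermost branch to \<open>ln (Dw w)\<close>; the other
  contributions are the values at the rotated words.\<close>

definition first_log :: "nat list \<Rightarrow> real"
  where "first_log w = ln (G (hd w) (Sw (tl w) (fixpt w)))"

lemma ln_Gw:
  assumes "set w \<subseteq> I" "x \<in> {0..1}"
  shows "ln (Gw w x) = (\<Sum>j<length w. ln (G (w ! j) (Sw (drop (Suc j) w) x)))"
  using assms(1)
proof (induction w)
  case (Cons i w)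
  have "0 < G i (Sw w x)"
    using log_lipschitz_pos[OF G_log_lipschitz[of i]] Sw_maps[of w x] Cons.prems assms(2) by simp
  moreover have "0 < Gw w x" using Gw_pos[of w x] Cons.prems assms(2) by simp
  ultimately have "ln (Gw (i # w) x) = ln (G i (Sw w x)) + ln (Gw w x)" by (simp add: ln_mult)
  also have "\<dots> = (\<Sum>j<length (i # w). ln (G ((i # w) ! j) (Sw (drop (Suc j) (i # w)) x)))"
    using Cons by (simp add: sum.lessThan_Suc_shift del: sum.lessThan_Suc)
  finally show ?case .
qed simp

text \<open>Rotation by \<open>j\<close> makes letter \<open>j\<close> the outermost one and moves
  the fixed point to \<open>Sw (drop j w) (fixpt w)\<close>; the letters moved to the back then
  return it to \<open>fixpt w\<close>.\<close>

lemma first_log_rotate: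
  assumes "w \<noteq> []" "set w \<subseteq> I" "j < length w"
  shows "first_log (rotate j w) = ln (G (w ! j) (Sw (drop (Suc j) w) (fixpt w)))"
proof -
  have rot: "rotate j w = drop j w @ take j w" using assms(3) by (simp add: rotate_drop_take)
  have d: "drop j w = w ! j # drop (Suc j) w" using Cons_nth_drop_Suc[OF assms(3)] by simp
  have f: "fixpt (drop j w @ take j w) = Sw (drop j w) (fixpt w)"
    using fixpt_append_swap[of "take j w" "drop j w"] assms(1,2) by simp
  have "Sw (take j w) (Sw (drop j w) (fixpt w)) = Sw (take j w @ drop j w) (fixpt w)"
    by (simp only: foldr_append o_apply)
  also have "\<dots> = fixpt w" using fixpt(2)[OF assms(1,2)] by (simp only: append_take_drop_id)
  finally have s: "Sw (take j w) (Sw (drop j w) (fixpt w)) = fixpt w" .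
  have h: "hd (drop j w @ take j w) = w ! j" and t: "tl (drop j w @ take j w) = drop (Suc j) w @ take j w"
    unfolding d by simp_all
  show ?thesis unfolding first_log_def rot f h t foldr_append o_apply s ..
qed

text \<open>\<open>ln (Dw w)\<close> is the sum of \<open>first_log\<close> over all rotations and
  \<open>Dw\<close> is invariant under rotation, so after exchanging the sums every rotation
  contributes equally.\<close>

lemma sum_Dw_ln_Dw:
  "(\<Sum>w\<in>words_over I (Suc n). Dw w * ln (Dw w)) = real (Suc n) * (\<Sum>w\<in>words_over I (Suc n). Dw w * first_log w)"
proof -
  let ?W = "words_over I (Suc n)"
  have W: "w \<noteq> []" "set w \<subseteq> I" "length w = Suc n" if "w \<in> ?W" for w
    using that by (auto simp: words_over_def)
  have "(\<Sum>w\<in>?W. Dw w * ln (Dw w)) = (\<Sum>w\<in>?W. \<Sum>j<Suc n. Dw (rotate j w) * first_log (rotate j w))"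
  proof (rule sum.cong[OF refl])
    fix w assume w: "w \<in> ?W"
    have "ln (Dw w) = (\<Sum>j<Suc n. first_log (rotate j w))"
      unfolding Dw_def ln_Gw[OF W(2)[OF w] fixpt(1)[OF W(1,2)[OF w]]] W(3)[OF w]
      by (rule sum.cong[OF refl]) (use first_log_rotate[OF W(1,2)[OF w]] W(3)[OF w] in simp)
    thus "Dw w * ln (Dw w) = (\<Sum>j<Suc n. Dw (rotate j w) * first_log (rotate j w))"
      by (simp only: sum_distrib_left Dw_rotate[OF W(1,2)[OF w]])
  qed
  also have "\<dots> = (\<Sum>j<Suc n. \<Sum>w\<in>?W. Dw (rotate j w) * first_log (rotate j w))"
    by (rule sum.swap)
  also have "\<dots> = (\<Sum>j<Suc n. \<Sum>w\<in>?W. Dw w * first_log w)"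
    by (rule sum.cong[OF refl], rule sum_words_over_rotate)
  finally show ?thesis by simp
qed

lemma ln_G_lipschitz:
  assumes "i \<in> I" "x \<in> {0..1}" "y \<in> {0..1}"
  shows "ln (G i x) \<le> A * \<bar>x - y\<bar> + ln (G i y)"
proof -
  have "0 < G i x" "0 < G i y" using log_lipschitz_pos[OF G_log_lipschitz] assms by auto
  moreover have "G i x \<le> exp (A * \<bar>x - y\<bar>) * G i y"
    by (rule log_lipschitzD[OF G_log_lipschitz[OF assms(1)] assms(2,3)])
  ultimately have "ln (G i x) \<le> ln (exp (A * \<bar>x - y\<bar>) * G i y)" by (subst ln_le_cancel_iff) auto
  also have "\<dots> = A * \<bar>x - y\<bar> + ln (G i y)" using \<open>0 < G i y\<close> by (simp add: ln_mult)
  finally show ?thesis .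
qed

text \<open>Once the shifted logarithm is at least 1, an additive error \<open>d\<close> is at most
  a relative one: \<open>u + d \<le> (1 + d) * u \<le> exp d * u\<close>.\<close>

lemma log_lipschitz_ln_G:
  assumes "\<And>i x. i \<in> I \<Longrightarrow> x \<in> {0..1} \<Longrightarrow> 1 \<le> ln (G i x) + M" and i: "i \<in> I"
  shows "log_lipschitz (2 * A) (\<lambda>x. (ln (G i x) + M) * G i x)"
proof -
  have "log_lipschitz A (\<lambda>x. ln (G i x) + M)"
  proof (rule log_lipschitzI)
    fix x y :: real assume xy: "x \<in> {0..1}" "y \<in> {0..1}"
    let ?d = "A * \<bar>x - y\<bar>"
    have d: "0 \<le> ?d" using A_nonneg by simp
    have "ln (G i x) + M \<le> ?d + (ln (G i y) + M)" using ln_G_lipschitz[OF i xy] by simp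
    also have "\<dots> \<le> ?d * (ln (G i y) + M) + (ln (G i y) + M)"
      using mult_left_mono[OF assms(1)[OF i xy(2)] d] by simp
    also have "\<dots> = (1 + ?d) * (ln (G i y) + M)" by (simp add: algebra_simps)
    also have "\<dots> \<le> exp ?d * (ln (G i y) + M)"
      using assms(1)[OF i xy(2)] by (intro mult_right_mono exp_ge_add_one_self) auto
    finally show "ln (G i x) + M \<le> exp ?d * (ln (G i y) + M)" .
  qed (use assms(1)[OF i] in force)
  from log_lipschitz_mult[OF this G_log_lipschitz[OF i]] show ?thesis by simp
qed

lemma ln_G_bounded_below: "\<exists>M. \<forall>i\<in>I. \<forall>x\<in>{0..1}. 1 \<le> ln (G i x) + M"
proof -
  define M where "M = 1 + A + (\<Sum>i\<in>I. \<bar>ln (G i 0)\<bar>)"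
  have "1 \<le> ln (G i x) + M" if i: "i \<in> I" and x: "x \<in> {0..1}" for i x
  proof -
    have "ln (G i 0) \<le> A * \<bar>0 - x\<bar> + ln (G i x)" by (rule ln_G_lipschitz[OF i _ x]) simp
    also have "A * \<bar>0 - x\<bar> \<le> A" using x A_nonneg by (simp add: mult_left_le)
    finally have "ln (G i 0) \<le> A + ln (G i x)" by simp
    moreover have "\<bar>ln (G i 0)\<bar> \<le> (\<Sum>i\<in>I. \<bar>ln (G i 0)\<bar>)"
      using member_le_sum[of i I "\<lambda>i. \<bar>ln (G i 0)\<bar>"] i finite_I by simp
    ultimately show ?thesis unfolding M_def by linarith
  qed
  thus ?thesis by blast
qed

end

context weighted_contractions_cone
begin

text \<open>The integral of \<open>ln G\<close> against the invariant density, carried to the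
  branches. Its sign is opposite to the customary one: \<open>lyapunov_exponent_eq\<close>
  identifies it with minus the Lyapunov exponent.\<close>

definition entropy :: real
  where "entropy = (\<Sum>i\<in>I. integral {0..1} (\<lambda>x. inv_density (S i x) * (ln (G i x) * G i x)))"

text \<open>The trace formula for \<open>p = G\<close> has limit 1, the mass of the invariant
  density. For the shifted weight the limit is \<open>entropy + M\<close>, and \<open>M\<close>
  times the first estimate is removed.\<close>

lemma periodic_asymptotics:
  assumes large: "2 * A \<le> a"
  shows "\<exists>C. \<forall>n. \<bar>(\<Sum>w\<in>words_over I (Suc n). Dw w) - 1\<bar> \<le> C * real (n + 2) * rate ^ n
           \<and> \<bar>(\<Sum>w\<in>words_over I (Suc n). Dw w * first_log w) - entropy\<bar> \<le> C * real (n + 2) * rate ^ n"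
proof -
  have y: "fixpt w \<in> Sw w ` {0..1}" if "w \<noteq> []" "set w \<subseteq> I" for w
    using fixpt[OF that] by (metis imageI)
  obtain M where M: "\<And>i x. i \<in> I \<Longrightarrow> x \<in> {0..1} \<Longrightarrow> 1 \<le> ln (G i x) + M"
    using ln_G_bounded_below by blast
  define p where "p i x = (ln (G i x) + M) * G i x" for i x
  have G: "log_lipschitz a (G i)" if "i \<in> I" for i
    by (rule log_lipschitz_mono[OF G_log_lipschitz[OF that]]) (use large A_nonneg in simp)
  have p: "log_lipschitz a (p i)" if "i \<in> I" for i
    unfolding p_def by (rule log_lipschitz_mono[OF log_lipschitz_ln_G[OF M that] large])
  define C1 where "C1 = lip_const * (\<Sum>i\<in>I. integral {0..1} (G i))"
  define C2 where "C2 = lip_const * (\<Sum>i\<in>I. integral {0..1} (p i))"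
  have C: "0 \<le> C1" "0 \<le> C2" unfolding C1_def C2_def
    using mass_nonneg[of G, OF G] mass_nonneg[of p, OF p] lip_const_pos by simp_all
  have cG: "continuous_on {0..1} (G i)" if "i \<in> I" for i
    by (rule log_lipschitz_continuous[OF G[OF that] a_nonneg])
  have cln: "continuous_on {0..1} (\<lambda>x. ln (G i x))" if "i \<in> I" for i
    using cG[OF that] log_lipschitz_pos[OF G[OF that]] by (intro continuous_on_ln) force+
  have cd: "continuous_on {0..1} (\<lambda>x. inv_density (S i x))" if "i \<in> I" for i
    using continuous_inv_density_Sw[of "[i]"] that by simp
  have mass1: "(\<Sum>i\<in>I. integral {0..1} (\<lambda>x. inv_density (S i x) * G i x)) = 1"
  proof -
    have "(\<Sum>i\<in>I. integral {0..1} (\<lambda>x. inv_density (S i x) * G i x))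
       = integral {0..1} (\<lambda>x. \<Sum>i\<in>I. inv_density (S i x) * G i x)"
      by (intro integral_sum[symmetric] finite_I integrable_continuous_interval continuous_on_mult cd cG)
    also have "(\<lambda>x. \<Sum>i\<in>I. inv_density (S i x) * G i x) = transfer inv_density"
      by (rule ext) (simp add: transfer_def mult.commute)
    also have "integral {0..1} (transfer inv_density) = 1"
      using integral_transfer[OF log_lipschitz_continuous[OF inv_density(1) a_nonneg]] inv_density(2) by simp
    finally show ?thesis .
  qed
  have massp: "(\<Sum>i\<in>I. integral {0..1} (\<lambda>x. inv_density (S i x) * p i x)) = entropy + M"
  proof -
    have "integral {0..1} (\<lambda>x. inv_density (S i x) * p i x)
        = integral {0..1} (\<lambda>x. inv_density (S i x) * (ln (G i x) * G i x))
          + M * integral {0..1} (\<lambda>x. inv_density (S i x) * G i x)" if i: "i \<in> I" for i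
    proof -
      have "integral {0..1} (\<lambda>x. inv_density (S i x) * p i x)
        = integral {0..1} (\<lambda>x. inv_density (S i x) * (ln (G i x) * G i x) + M * (inv_density (S i x) * G i x))"
        by (rule arg_cong[of _ _ "integral {0..1}"], rule ext) (simp add: p_def algebra_simps)
      also have "\<dots> = integral {0..1} (\<lambda>x. inv_density (S i x) * (ln (G i x) * G i x))
          + integral {0..1} (\<lambda>x. M * (inv_density (S i x) * G i x))"
        by (rule integral_add) (intro integrable_continuous_interval continuous_on_mult continuous_on_const cd cG cln i)+
      finally show ?thesis by (simp only: integral_mult_right)
    qed
    hence "(\<Sum>i\<in>I. integral {0..1} (\<lambda>x. inv_density (S i x) * p i x))
      = entropy + M * (\<Sum>i\<in>I. integral {0..1} (\<lambda>x. inv_density (S i x) * G i x))"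
      unfolding entropy_def by (simp add: sum.distrib sum_distrib_left)
    thus ?thesis by (simp only: mass1 mult_1_right)
  qed
  have wG: "weighted_Gw G w (fixpt w) = Dw w" if "w \<noteq> []" for w
    unfolding Dw_def using that by (cases w) auto
  have wp: "weighted_Gw p w (fixpt w) = Dw w * first_log w + M * Dw w" if "w \<noteq> []" for w
    unfolding Dw_def first_log_def p_def using that by (cases w) (auto simp: algebra_simps)
  have ne: "w \<noteq> []" if "w \<in> words_over I (Suc n)" for w n using that by (auto simp: words_over_def)
  have 1: "\<bar>(\<Sum>w\<in>words_over I (Suc n). Dw w) - 1\<bar> \<le> C1 * real (n + 2) * rate ^ n" for n
  proof -
    have "(\<Sum>w\<in>words_over I (Suc n). weighted_Gw G w (fixpt w)) = (\<Sum>w\<in>words_over I (Suc n). Dw w)"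
      by (rule sum.cong[OF refl], rule wG, rule ne)
    with trace_formula[of G fixpt n, OF G y] show ?thesis unfolding mass1 C1_def by simp
  qed
  have 2: "\<bar>(\<Sum>w\<in>words_over I (Suc n). Dw w * first_log w) + M * (\<Sum>w\<in>words_over I (Suc n). Dw w) - (entropy + M)\<bar>
       \<le> C2 * real (n + 2) * rate ^ n" for n
  proof -
    have "(\<Sum>w\<in>words_over I (Suc n). weighted_Gw p w (fixpt w))
       = (\<Sum>w\<in>words_over I (Suc n). Dw w * first_log w + M * Dw w)"
      by (rule sum.cong[OF refl], rule wp, rule ne)
    also have "\<dots> = (\<Sum>w\<in>words_over I (Suc n). Dw w * first_log w) + M * (\<Sum>w\<in>words_over I (Suc n). Dw w)"
      by (simp only: sum.distrib sum_distrib_left)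
    finally show ?thesis
      using trace_formula[of p fixpt n, OF p y] unfolding massp C2_def by simp
  qed
  define C where "C = C1 + (C2 + \<bar>M\<bar> * C1)"
  have *: "0 \<le> real (n + 2) * rate ^ n" for n using rate by simp
  have "\<bar>(\<Sum>w\<in>words_over I (Suc n). Dw w) - 1\<bar> \<le> C * real (n + 2) * rate ^ n
           \<and> \<bar>(\<Sum>w\<in>words_over I (Suc n). Dw w * first_log w) - entropy\<bar> \<le> C * real (n + 2) * rate ^ n" for n
  proof
    let ?D = "\<Sum>w\<in>words_over I (Suc n). Dw w" and ?E = "\<Sum>w\<in>words_over I (Suc n). Dw w * first_log w"
    let ?r = "real (n + 2) * rate ^ n"
    have D1: "\<bar>?D - 1\<bar> \<le> C1 * ?r" using 1[of n] by (simp only: mult.assoc)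
    have "C1 * ?r \<le> C * ?r" unfolding C_def using C * by (intro mult_right_mono) auto
    with D1 show "\<bar>?D - 1\<bar> \<le> C * real (n + 2) * rate ^ n" by (simp only: mult.assoc)
    have "\<bar>M * (?D - 1)\<bar> \<le> \<bar>M\<bar> * (C1 * ?r)" unfolding abs_mult by (rule mult_left_mono[OF D1]) simp
    moreover have "\<bar>?E + M * ?D - (entropy + M)\<bar> \<le> C2 * ?r" using 2[of n] by (simp only: mult.assoc)
    moreover have "?E + M * ?D - (entropy + M) = (?E - entropy) + M * (?D - 1)" by (simp add: algebra_simps)
    ultimately have "\<bar>?E - entropy\<bar> \<le> C2 * ?r + \<bar>M\<bar> * (C1 * ?r)" by linarith
    also have "\<dots> = (C2 + \<bar>M\<bar> * C1) * ?r" by (simp add: algebra_simps)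
    also have "\<dots> \<le> C * ?r" unfolding C_def using C * by (intro mult_right_mono) auto
    finally show "\<bar>?E - entropy\<bar> \<le> C * real (n + 2) * rate ^ n" by (simp only: mult.assoc)
  qed
  thus ?thesis by blast
qed

end

section \<open>Inverse branches of an expanding map\<close>

text \<open>Along the real axis the derivatives are real parts of complex derivatives of the
  extension. The second one is continuous on the compact interval, which bounds it and makes the
  first Lipschitz, endpoints included.\<close>

lemma real_analytic_on_has_derivative:
  assumes "f real_analytic_on {a..b}"
  obtains f' B where "\<And>x. x \<in> {a..b} \<Longrightarrow> (f has_real_derivative f' x) (at x within {a..b})"
    and "0 \<le> B" "\<And>x y. x \<in> {a..b} \<Longrightarrow> y \<in> {a..b} \<Longrightarrow> \<bar>f' x - f' y\<bar> \<le> B * \<bar>x - y\<bar>"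
proof -
  have real_part: "((\<lambda>x. Re (g (of_real x))) has_real_derivative Re (deriv g (of_real x))) (at x within S)"
    if "g analytic_on (complex_of_real ` S)" "x \<in> S" for g S x
  proof -
    have "(g has_field_derivative deriv g (of_real x)) (at (of_real x))"
      by (rule analytic_derivI, rule analytic_on_subset[OF that(1)]) (use that(2) in blast)
    hence "((\<lambda>x. g (of_real x)) has_vector_derivative deriv g (of_real x)) (at x within S)"
      by (rule has_vector_derivative_real_field)
    thus ?thesis
      unfolding has_real_derivative_iff_has_vector_derivative
      by (rule bounded_linear.has_vector_derivative[OF bounded_linear_Re])
  qed
  from assms obtain g where g: "g analytic_on (complex_of_real ` {a..b})"
    and gf: "\<And>x. x \<in> {a..b} \<Longrightarrow> g (of_real x) = of_real (f x)"
    unfolding real_analytic_on_def by blast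
  define f' where "f' = (\<lambda>x. Re (deriv g (complex_of_real x)))"
  define f'' where "f'' = (\<lambda>x. Re (deriv (deriv g) (complex_of_real x)))"
  note g' = analytic_deriv[OF g] and g'' = analytic_deriv[OF analytic_deriv[OF g]]
  have d1: "(f has_real_derivative f' x) (at x within {a..b})" if x: "x \<in> {a..b}" for x
    using has_field_derivative_transform_within[OF real_part[OF g x] zero_less_one x, of f] gf
    by (simp add: f'_def)
  have d2: "(f' has_real_derivative f'' x) (at x within {a..b})" if x: "x \<in> {a..b}" for x
    using real_part[OF g' x] by (simp add: f'_def f''_def)
  have "continuous_on {a..b} f''"
    unfolding f''_def
    by (intro continuous_intros continuous_on_compose2[OF analytic_imp_holomorphic[OF g'', THEN holomorphic_on_imp_continuous_on]]) auto
  hence "bounded (f'' ` {a..b})" by (intro compact_imp_bounded compact_continuous_image) auto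
  then obtain B where B: "B > 0" "\<And>x. x \<in> {a..b} \<Longrightarrow> norm (f'' x) \<le> B"
    unfolding bounded_pos by blast
  have "\<bar>f' x - f' y\<bar> \<le> B * \<bar>x - y\<bar>" if "x \<in> {a..b}" "y \<in> {a..b}" for x y
    using field_differentiable_bound[of "{a..b}" f' f'' B x y] d2 B(2) that by simp
  with d1 B(1) show ?thesis by (intro that[of f' B]) auto
qed

lemma log_lipschitz_of_lipschitz:
  assumes m: "0 < m" "\<And>x. x \<in> {0..1} \<Longrightarrow> m \<le> f x" and B: "0 \<le> B"
    and lip: "\<And>x y. x \<in> {0..1} \<Longrightarrow> y \<in> {0..1} \<Longrightarrow> \<bar>f x - f y\<bar> \<le> B * \<bar>x - y\<bar>"
  shows "log_lipschitz (B / m) f"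
proof (rule log_lipschitzI)
  fix x y :: real assume xy: "x \<in> {0..1}" "y \<in> {0..1}"
  let ?d = "B / m * \<bar>x - y\<bar>"
  have d: "0 \<le> ?d" using m(1) B by simp
  have "f x \<le> f y + ?d * m" using lip[OF xy] m(1) by (simp add: field_simps)
  also have "\<dots> \<le> f y + ?d * f y" using mult_left_mono[OF m(2)[OF xy(2)] d] by simp
  also have "\<dots> = (1 + ?d) * f y" by (simp add: algebra_simps)
  also have "\<dots> \<le> exp ?d * f y"
    using m(1) m(2)[OF xy(2)] by (intro mult_right_mono exp_ge_add_one_self) auto
  finally show "f x \<le> exp ?d * f y" .
qed (use m in force)

context bernoulli_expanding_map
begin

abbreviation "S i \<equiv> the_inv_into (X i) (F i)"

definition dS :: "nat \<Rightarrow> real \<Rightarrow> real"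
  where "dS i x = vector_derivative (S i) (at x within {0..1})"

definition dF :: "nat \<Rightarrow> real \<Rightarrow> real"
  where "dF i x = vector_derivative (F i) (at x within X i)"

lemma interval_cases:
  assumes "i \<in> {1..k}"
  obtains a b where "X i = {a..b}" "a < b" "0 \<le> a" "b \<le> 1"
proof -
  obtain a b where X: "X i = {a..b}" using intervals[OF assms] by blast
  have "\<not> finite (X i)"
    using bij_betw_finite[OF branch_bij[OF assms]] infinite_Icc[of 0 "1::real"] by simp
  hence "a < b" unfolding X by (metis atLeastAtMost_singleton finite.emptyI finite_insert atLeastatMost_empty linorder_cases)
  moreover have "X i \<subseteq> {0..1}" using cover assms by blast
  ultimately show ?thesis using that X by auto
qed

lemma S_mem: "i \<in> {1..k} \<Longrightarrow> y \<in> {0..1} \<Longrightarrow> S i y \<in> X i"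
  using bij_betw_the_inv_into[OF branch_bij] by (meson bij_betwE)

lemma S_unit: "i \<in> {1..k} \<Longrightarrow> y \<in> {0..1} \<Longrightarrow> S i y \<in> {0..1}"
  using S_mem cover by blast

lemma F_S: "i \<in> {1..k} \<Longrightarrow> y \<in> {0..1} \<Longrightarrow> F i (S i y) = y"
  using f_the_inv_into_f_bij_betw[OF branch_bij] by blast

lemma S_inj: "i \<in> {1..k} \<Longrightarrow> inj_on (S i) {0..1}"
  using bij_betw_the_inv_into[OF branch_bij] by (auto simp: bij_betw_def)

lemma S_image: "i \<in> {1..k} \<Longrightarrow> S i ` {0..1} = X i"
  using bij_betw_the_inv_into[OF branch_bij] by (auto simp: bij_betw_def)

lemma dS_props:
  assumes i: "i \<in> {1..k}"
  shows "x \<in> {0..1} \<Longrightarrow> (S i has_real_derivative dS i x) (at x within {0..1})"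
    and "\<exists>B\<ge>0. \<forall>x\<in>{0..1}. \<forall>y\<in>{0..1}. \<bar>dS i x - dS i y\<bar> \<le> B * \<bar>x - y\<bar>"
proof -
  obtain f' B where f: "\<And>x. x \<in> {0..1} \<Longrightarrow> (S i has_real_derivative f' x) (at x within {0..1})"
    and B: "0 \<le> B" "\<And>x y. x \<in> {0..1} \<Longrightarrow> y \<in> {0..1} \<Longrightarrow> \<bar>f' x - f' y\<bar> \<le> B * \<bar>x - y\<bar>"
    using real_analytic_on_has_derivative[OF inverse_analytic[OF i]] by blast
  have eq: "dS i x = f' x" if "x \<in> {0..1}" for x
    unfolding dS_def
    by (rule vector_derivative_within_closed_interval)
       (use f that in \<open>auto simp: has_real_derivative_iff_has_vector_derivative\<close>)
  show "x \<in> {0..1} \<Longrightarrow> (S i has_real_derivative dS i x) (at x within {0..1})"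
    using f[of x] eq[of x] by simp
  show "\<exists>B\<ge>0. \<forall>x\<in>{0..1}. \<forall>y\<in>{0..1}. \<bar>dS i x - dS i y\<bar> \<le> B * \<bar>x - y\<bar>"
    using B eq by (intro exI[of _ B]) auto
qed

lemma dF_props:
  assumes i: "i \<in> {1..k}"
  shows "x \<in> X i \<Longrightarrow> (F i has_real_derivative dF i x) (at x within X i)"
    and "continuous_on (X i) (dF i)"
proof -
  obtain a b where X: "X i = {a..b}" "a < b" by (rule interval_cases[OF i]) blast
  obtain f' B where f: "\<And>x. x \<in> {a..b} \<Longrightarrow> (F i has_real_derivative f' x) (at x within {a..b})"
    and B: "0 \<le> B" "\<And>x y. x \<in> {a..b} \<Longrightarrow> y \<in> {a..b} \<Longrightarrow> \<bar>f' x - f' y\<bar> \<le> B * \<bar>x - y\<bar>"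
    using real_analytic_on_has_derivative[of "F i" a b] branch_analytic[OF i] X(1) by metis
  have eq: "dF i x = f' x" if "x \<in> {a..b}" for x
    unfolding dF_def X(1)
    by (rule vector_derivative_within_closed_interval)
       (use f that X(2) in \<open>auto simp: has_real_derivative_iff_has_vector_derivative\<close>)
  show "x \<in> X i \<Longrightarrow> (F i has_real_derivative dF i x) (at x within X i)"
    using f[of x] eq[of x] by (simp add: X(1))
  show "continuous_on (X i) (dF i)" unfolding X(1)
    by (rule continuous_on_real_lipschitz[where C = B]) (use B eq in auto)
qed

text \<open>The chain rule for \<open>F i (S i y) = y\<close>; derivatives within a nondegenerate
  interval are unique even at its endpoints.\<close>

lemma dF_S_mult_dS:
  assumes i: "i \<in> {1..k}" and y: "y \<in> {0..1}"
  shows "dF i (S i y) * dS i y = 1"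
proof -
  have "(F i has_real_derivative dF i (S i y)) (at (S i y) within S i ` {0..1})"
    unfolding S_image[OF i] by (rule dF_props(1)[OF i S_mem[OF i y]])
  from DERIV_image_chain[OF this dS_props(1)[OF i y]]
  have "((F i \<circ> S i) has_real_derivative dF i (S i y) * dS i y) (at y within {0..1})" .
  hence "((\<lambda>x. x) has_real_derivative dF i (S i y) * dS i y) (at y within {0..1})"
    by (rule has_field_derivative_transform_within[OF _ zero_less_one y]) (use F_S[OF i] in auto)
  hence 1: "((\<lambda>x. x) has_vector_derivative dF i (S i y) * dS i y) (at y within cbox 0 1)"
    by (simp add: has_real_derivative_iff_has_vector_derivative)
  have 2: "((\<lambda>x::real. x) has_vector_derivative 1) (at y within cbox 0 1)"
    by (auto intro: derivative_eq_intros)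
  show ?thesis by (rule vector_derivative_unique_within_closed_interval[OF _ _ 1 2]) (use y in auto)
qed

definition contraction :: real where
  "contraction = (SOME \<theta>. 0 < \<theta> \<and> \<theta> < 1 \<and> (\<forall>i\<in>{1..k}. \<forall>y\<in>{0..1}. \<bar>dS i y\<bar> \<le> \<theta>))"

lemma contraction: "0 < contraction" "contraction < 1"
  "i \<in> {1..k} \<Longrightarrow> y \<in> {0..1} \<Longrightarrow> \<bar>dS i y\<bar> \<le> contraction"
proof -
  obtain c where c: "c > 1" "\<And>i x. i \<in> {1..k} \<Longrightarrow> x \<in> X i \<Longrightarrow> \<bar>dF i x\<bar> \<ge> c"
    using expanding unfolding dF_def by blast
  have "\<bar>dS i y\<bar> \<le> 1 / c" if i: "i \<in> {1..k}" and y: "y \<in> {0..1}" for i y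
  proof -
    have "c * \<bar>dS i y\<bar> \<le> \<bar>dF i (S i y)\<bar> * \<bar>dS i y\<bar>"
      using c(2)[OF i S_mem[OF i y]] by (rule mult_right_mono) simp
    also have "\<dots> = 1" using dF_S_mult_dS[OF i y] by (simp flip: abs_mult)
    finally show ?thesis using c(1) by (simp add: field_simps)
  qed
  hence "\<exists>\<theta>. 0 < \<theta> \<and> \<theta> < 1 \<and> (\<forall>i\<in>{1..k}. \<forall>y\<in>{0..1}. \<bar>dS i y\<bar> \<le> \<theta>)"
    using c(1) by (intro exI[of _ "1 / c"]) auto
  from someI_ex[OF this] show "0 < contraction" "contraction < 1"
    "i \<in> {1..k} \<Longrightarrow> y \<in> {0..1} \<Longrightarrow> \<bar>dS i y\<bar> \<le> contraction"
    unfolding contraction_def[symmetric] by auto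
qed

lemma S_contraction:
  assumes "i \<in> {1..k}" "x \<in> {0..1}" "y \<in> {0..1}"
  shows "\<bar>S i x - S i y\<bar> \<le> contraction * \<bar>x - y\<bar>"
  using field_differentiable_bound[of "{0..1}" "S i" "dS i" contraction x y] dS_props(1)[OF assms(1)]
    contraction(3)[OF assms(1)] assms by simp

definition G :: "nat \<Rightarrow> real \<Rightarrow> real" where "G i x = \<bar>dS i x\<bar>"

text \<open>Each \<open>dS i\<close> is Lipschitz and nonvanishing on a compact interval, hence its
  absolute value is bounded below; the sum of the resulting constants serves all branches at
  once.\<close>

lemma G_log_lipschitz_ex: "\<exists>A\<ge>0. \<forall>i\<in>{1..k}. log_lipschitz A (G i)"
proof -
  have "\<forall>i\<in>{1..k}. \<exists>A\<ge>0. log_lipschitz A (G i)"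
  proof
    fix i assume i: "i \<in> {1..k}"
    obtain B where B: "B \<ge> 0" "\<And>x y. x \<in> {0..1} \<Longrightarrow> y \<in> {0..1} \<Longrightarrow> \<bar>dS i x - dS i y\<bar> \<le> B * \<bar>x - y\<bar>"
      using dS_props(2)[OF i] by blast
    have lip: "\<bar>G i x - G i y\<bar> \<le> B * \<bar>x - y\<bar>" if "x \<in> {0..1}" "y \<in> {0..1}" for x y
      using B(2)[OF that] unfolding G_def by linarith
    have "continuous_on {0..1} (G i)" by (rule continuous_on_real_lipschitz[OF lip])
    from continuous_attains_inf[OF _ _ this] obtain z where z: "z \<in> {0..1}" "\<And>x. x \<in> {0..1} \<Longrightarrow> G i z \<le> G i x"
      by auto
    have "G i z > 0" using dF_S_mult_dS[OF i z(1)] unfolding G_def by auto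
    from log_lipschitz_of_lipschitz[OF this z(2) B(1) lip] show "\<exists>A\<ge>0. log_lipschitz A (G i)"
      using \<open>G i z > 0\<close> B(1) by (intro exI[of _ "B / G i z"]) auto
  qed
  then obtain A where A: "\<And>i. i \<in> {1..k} \<Longrightarrow> A i \<ge> 0" "\<And>i. i \<in> {1..k} \<Longrightarrow> log_lipschitz (A i) (G i)"
    by metis
  have "log_lipschitz (sum A {1..k}) (G i)" if "i \<in> {1..k}" for i
    by (rule log_lipschitz_mono[OF A(2)[OF that]]) (use A(1) that in \<open>auto intro!: member_le_sum\<close>)
  thus ?thesis using A(1) by (intro exI[of _ "sum A {1..k}"]) (auto intro: sum_nonneg)
qed

lemma negligible_overlap:
  assumes "i \<in> {1..k}" "j \<in> {1..k}" "i \<noteq> j"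
  shows "negligible (X i \<inter> X j)"
proof -
  obtain a b where ab: "X i = {a..b}" "a < b" by (rule interval_cases[OF assms(1)]) blast
  obtain c d where cd: "X j = {c..d}" "c < d" by (rule interval_cases[OF assms(2)]) blast
  have "X i \<inter> X j \<subseteq> {a, b, c, d}"
  proof
    fix x assume x: "x \<in> X i \<inter> X j"
    show "x \<in> {a, b, c, d}"
    proof (rule ccontr)
      assume "x \<notin> {a, b, c, d}"
      hence "x \<in> interior (X i) \<inter> interior (X j)"
        using x unfolding ab cd interior_atLeastAtMost_real by auto
      thus False using disjoint_interiors[OF assms] by blast
    qed
  qed
  thus ?thesis by (rule negligible_subset[OF negligible_finite, rotated]) simp
qed

text \<open>Change of variables on each image \<open>X i\<close>; the images cover the unit interval
  and overlap in finite sets. Absolute integrability is the right generality because discontinuous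
  functions such as \<open>\<phi> (T x) * p x\<close> are inserted later.\<close>

lemma integral_branches:
  assumes f: "f absolutely_integrable_on {0..1}"
  shows "i \<in> {1..k} \<Longrightarrow> (\<lambda>x. G i x * f (S i x)) integrable_on {0..1}"
    and "integral {0..1} f = (\<Sum>i\<in>{1..k}. integral {0..1} (\<lambda>x. G i x * f (S i x)))"
proof -
  have cov: "(\<lambda>x. G i x * f (S i x)) integrable_on {0..1} \<and> f integrable_on X i
     \<and> integral {0..1} (\<lambda>x. G i x * f (S i x)) = integral (X i) f" if i: "i \<in> {1..k}" for i
  proof -
    have sub: "f absolutely_integrable_on X i"
      using set_integrable_subset[OF f, of "X i"] cover interval_cases[OF i] i by (metis UN_upper atLeastAtMost_borel sets_completionI_sets sets_lborel)
    have "(\<lambda>x. \<bar>dS i x\<bar> * f (S i x)) absolutely_integrable_on {0..1} \<and>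
        integral {0..1} (\<lambda>x. \<bar>dS i x\<bar> * f (S i x)) = integral (X i) f"
      using has_absolute_integral_change_of_variables_1'[of "{0..1}" "S i" "dS i" f "integral (X i) f"]
        dS_props(1)[OF i] S_inj[OF i] sub unfolding S_image[OF i] by simp
    thus ?thesis using sub unfolding G_def by (auto intro: set_lebesgue_integral_eq_integral(1))
  qed
  show "i \<in> {1..k} \<Longrightarrow> (\<lambda>x. G i x * f (S i x)) integrable_on {0..1}" using cov by blast
  have "(f has_integral (\<Sum>i\<in>{1..k}. integral (X i) f)) (\<Union>i\<in>{1..k}. X i)"
    by (rule has_integral_UN) (use cov negligible_overlap in \<open>auto simp: pairwise_def\<close>)
  hence "integral {0..1} f = (\<Sum>i\<in>{1..k}. integral (X i) f)" unfolding cover by (rule integral_unique)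
  also have "\<dots> = (\<Sum>i\<in>{1..k}. integral {0..1} (\<lambda>x. G i x * f (S i x)))"
    by (rule sum.cong[OF refl]) (use cov in metis)
  finally show "integral {0..1} f = (\<Sum>i\<in>{1..k}. integral {0..1} (\<lambda>x. G i x * f (S i x)))" .
qed

lemma mass_conservation:
  assumes "continuous_on {0..1} f"
  shows "integral {0..1} (\<lambda>x. \<Sum>i\<in>{1..k}. G i x * f (S i x)) = integral {0..1} f"
proof -
  have f: "f absolutely_integrable_on {0..1}" by (rule absolutely_integrable_continuous_real[OF assms])
  show ?thesis unfolding integral_branches(2)[OF f]
    by (rule integral_sum) (use integral_branches(1)[OF f] in auto)
qed

text \<open>These are the points at which \<open>T (S i x) = x\<close> may fail, since
  \<open>agrees\<close> speaks of interiors only.\<close>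

lemma finite_S_not_interior: "i \<in> {1..k} \<Longrightarrow> finite {x \<in> {0..1}. S i x \<notin> interior (X i)}"
proof -
  assume i: "i \<in> {1..k}"
  obtain a b where ab: "X i = {a..b}" "a < b" by (rule interval_cases[OF i]) blast
  have "S i ` {x \<in> {0..1}. S i x \<notin> interior (X i)} \<subseteq> {a, b}"
    using S_mem[OF i] unfolding ab(1) interior_atLeastAtMost_real by force
  hence "finite (S i ` {x \<in> {0..1}. S i x \<notin> interior (X i)})" by (rule finite_subset) simp
  thus "finite {x \<in> {0..1}. S i x \<notin> interior (X i)}"
    by (rule finite_imageD) (rule inj_on_subset[OF S_inj[OF i]], auto)
qed

end

section \<open>The invariant measure\<close>

abbreviation unit_lborel :: "real measure"
  where "unit_lborel \<equiv> restrict_space lborel {0..1}"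

interpretation unit_lborel: finite_measure unit_lborel
  by standard (simp add: emeasure_restrict_space space_restrict_space)

lemma measure_unit_lborel: "measure unit_lborel {0..1} = 1"
  by (simp add: measure_restrict_space)

lemma borel_measurable_unit_lborel:
  "borel_measurable unit_lborel = borel_measurable (restrict_space borel {0..1::real})"
  by (rule measurable_cong_sets[OF sets_restrict_space_cong[OF sets_lborel] refl])

lemma continuous_measurable_unit_lborel:
  fixes f :: "real \<Rightarrow> real"
  shows "continuous_on {0..1} f \<Longrightarrow> f \<in> borel_measurable unit_lborel"
  unfolding borel_measurable_unit_lborel by (rule borel_measurable_continuous_on_restrict)

lemma integrable_unit_lborel_bounded:
  fixes f :: "real \<Rightarrow> real"
  assumes "f \<in> borel_measurable unit_lborel" "\<And>x. x \<in> {0..1} \<Longrightarrow> \<bar>f x\<bar> \<le> K"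
  shows "integrable unit_lborel f"
  by (rule unit_lborel.integrable_const_bound[where B = K]) (use assms in \<open>auto simp: space_restrict_space\<close>)

lemma abs_integral_unit_lborel_le:
  fixes f :: "real \<Rightarrow> real"
  assumes f: "f \<in> borel_measurable unit_lborel" "\<And>x. x \<in> {0..1} \<Longrightarrow> \<bar>f x\<bar> \<le> K"
  shows "\<bar>\<integral>x. f x \<partial>unit_lborel\<bar> \<le> K"
proof -
  have "\<bar>\<integral>x. f x \<partial>unit_lborel\<bar> \<le> (\<integral>x. \<bar>f x\<bar> \<partial>unit_lborel)"
    by (rule integral_abs_bound)
  also have "\<dots> \<le> (\<integral>x. K \<partial>unit_lborel)"
    using integrable_unit_lborel_bounded[OF f] f(2)
    by (intro integral_mono integrable_abs unit_lborel.integrable_const) (auto simp: space_restrict_space)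
  also have "\<dots> = K" by (simp add: measure_unit_lborel space_restrict_space)
  finally show ?thesis .
qed

lemma integral_unit_lborel:
  fixes f :: "real \<Rightarrow> real"
  assumes "integrable unit_lborel f"
  shows "f absolutely_integrable_on {0..1}" "(\<integral>x. f x \<partial>unit_lborel) = integral {0..1} f"
proof -
  have s: "set_integrable lborel {0..1} f"
    unfolding set_integrable_def using assms integrable_restrict_space[of "{0..1}" lborel f] by simp
  have "integrable lebesgue (\<lambda>x. indicator {0..1} x *\<^sub>R f x)"
    using s unfolding set_integrable_def by (subst integrable_completion) auto
  thus "f absolutely_integrable_on {0..1}" by (simp add: set_integrable_def)
  have "(\<integral>x. f x \<partial>unit_lborel) = (LINT x : {0..1} | lborel. f x)"
    unfolding set_lebesgue_integral_def by (rule integral_restrict_space) simp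
  also have "\<dots> = integral {0..1} f" by (rule set_borel_integral_eq_integral(2)[OF s])
  finally show "(\<integral>x. f x \<partial>unit_lborel) = integral {0..1} f" .
qed

text \<open>Truncation makes the function bounded at a small L1 cost. A bounded measurable function
  is an almost everywhere limit of continuous ones, and truncating these at the same level supplies
  a dominating constant.\<close>

lemma L1_approx_continuous:
  fixes D :: "real \<Rightarrow> real"
  assumes D: "integrable unit_lborel D" and e: "0 < e"
  shows "\<exists>g. continuous_on UNIV g \<and> (\<integral>x. \<bar>D x - g x\<bar> \<partial>unit_lborel) < e"
proof -
  define clamp :: "nat \<Rightarrow> real \<Rightarrow> real" where "clamp m y = max (- real m) (min (real m) y)" for m y
  have clamp_cont: "continuous_on UNIV (clamp m)" for m
    unfolding clamp_def by (intro continuous_intros)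
  have clamp_le: "\<bar>clamp m y\<bar> \<le> real m" for m y unfolding clamp_def by linarith
  have clamp_meas: "clamp m \<in> borel_measurable borel" for m
    using clamp_cont by (rule borel_measurable_continuous_onI)
  have [measurable]: "D \<in> borel_measurable unit_lborel" using D by simp
  have meas[measurable]: "(\<lambda>x. clamp m (D x)) \<in> borel_measurable unit_lborel" for m
    using measurable_compose[OF _ clamp_meas] by measurable
  have "(\<lambda>m. \<integral>x. \<bar>D x - clamp m (D x)\<bar> \<partial>unit_lborel) \<longlonglongrightarrow> (\<integral>x. 0 \<partial>unit_lborel)"
  proof (rule integral_dominated_convergence[where w = "\<lambda>x. \<bar>D x\<bar>"])
    show "integrable unit_lborel (\<lambda>x. \<bar>D x\<bar>)" using D by simp
    show "AE x in unit_lborel. norm \<bar>D x - clamp m (D x)\<bar> \<le> \<bar>D x\<bar>" for m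
      by (rule AE_I2) (auto simp: clamp_def)
    have "(\<lambda>m. \<bar>D x - clamp m (D x)\<bar>) \<longlonglongrightarrow> 0" for x
    proof (rule tendsto_eventually, rule eventually_sequentiallyI)
      fix m assume "nat \<lceil>\<bar>D x\<bar>\<rceil> \<le> m"
      hence "\<bar>D x\<bar> \<le> real m" by linarith
      thus "\<bar>D x - clamp m (D x)\<bar> = 0" unfolding clamp_def by linarith
    qed
    thus "AE x in unit_lborel. (\<lambda>m. \<bar>D x - clamp m (D x)\<bar>) \<longlonglongrightarrow> 0" by simp
  qed measurable
  hence "(\<lambda>m. \<integral>x. \<bar>D x - clamp m (D x)\<bar> \<partial>unit_lborel) \<longlonglongrightarrow> 0" by simp
  hence "\<forall>\<^sub>F m in sequentially. (\<integral>x. \<bar>D x - clamp m (D x)\<bar> \<partial>unit_lborel) < e / 2"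
    by (rule order_tendstoD) (use e in simp)
  then obtain m where m: "(\<integral>x. \<bar>D x - clamp m (D x)\<bar> \<partial>unit_lborel) < e / 2"
    by (meson eventually_sequentially order_refl)
  define u where "u x = indicator {0..1} x *\<^sub>R clamp m (D x)" for x :: real
  have "u \<in> borel_measurable lborel"
    unfolding u_def using meas[of m] by (subst (asm) borel_measurable_restrict_space_iff) auto
  hence "u \<in> borel_measurable lebesgue" by (rule measurable_completion)
  hence "u measurable_on UNIV" by (rule lebesgue_measurable_imp_measurable_on_real) simp
  \<comment> \<open>By definition \<open>measurable_on\<close> provides continuous functions
    converging off a negligible set.\<close>
  then obtain N g where N: "negligible N" and g: "\<And>n. continuous_on UNIV (g n)"
    and lim: "\<And>x. x \<notin> N \<Longrightarrow> (\<lambda>n. g n x) \<longlonglongrightarrow> u x"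
    unfolding measurable_on_def by auto
  have gc: "continuous_on UNIV (\<lambda>x. clamp m (g n x))" for n
    by (rule continuous_on_compose2[OF clamp_cont g]) auto
  have gm[measurable]: "(\<lambda>x. clamp m (g n x)) \<in> borel_measurable unit_lborel" for n
    by (rule continuous_measurable_unit_lborel) (rule continuous_on_subset[OF gc], simp)
  have "N \<in> null_sets lebesgue" using N by (simp add: negligible_iff_null_sets)
  hence "AE x in lebesgue. x \<notin> N" by (rule AE_not_in)
  hence aeN: "AE x in lborel. x \<notin> N" by (simp add: AE_completion_iff)
  have "(\<lambda>n. \<integral>x. \<bar>clamp m (D x) - clamp m (g n x)\<bar> \<partial>unit_lborel) \<longlonglongrightarrow> (\<integral>x. 0 \<partial>unit_lborel)"
  proof (rule integral_dominated_convergence[where w = "\<lambda>x. 2 * real m"])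
    show "AE x in unit_lborel. norm \<bar>clamp m (D x) - clamp m (g n x)\<bar> \<le> 2 * real m" for n
    proof (rule AE_I2)
      fix x show "norm \<bar>clamp m (D x) - clamp m (g n x)\<bar> \<le> 2 * real m"
        using clamp_le[of m "D x"] clamp_le[of m "g n x"] by simp
    qed
    have "(\<lambda>n. \<bar>clamp m (D x) - clamp m (g n x)\<bar>) \<longlonglongrightarrow> 0" if x: "x \<notin> N" "x \<in> {0..1}" for x
    proof -
      have "(\<lambda>n. clamp m (g n x)) \<longlonglongrightarrow> clamp m (u x)"
        by (rule isCont_tendsto_compose[OF _ lim[OF x(1)]])
           (use clamp_cont in \<open>simp add: continuous_on_eq_continuous_at\<close>)
      also have "clamp m (u x) = clamp m (D x)" using x(2) by (simp add: u_def clamp_def)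
      finally have "(\<lambda>n. clamp m (D x) - clamp m (g n x)) \<longlonglongrightarrow> clamp m (D x) - clamp m (D x)"
        by (intro tendsto_diff tendsto_const)
      thus ?thesis by (simp add: tendsto_rabs_zero)
    qed
    thus "AE x in unit_lborel. (\<lambda>n. \<bar>clamp m (D x) - clamp m (g n x)\<bar>) \<longlonglongrightarrow> 0"
      using aeN by (subst AE_restrict_space_iff) auto
  qed (use unit_lborel.integrable_const in measurable)
  hence "(\<lambda>n. \<integral>x. \<bar>clamp m (D x) - clamp m (g n x)\<bar> \<partial>unit_lborel) \<longlonglongrightarrow> 0" by simp
  hence "\<forall>\<^sub>F n in sequentially. (\<integral>x. \<bar>clamp m (D x) - clamp m (g n x)\<bar> \<partial>unit_lborel) < e / 2"
    by (rule order_tendstoD) (use e in simp)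
  then obtain n where n: "(\<integral>x. \<bar>clamp m (D x) - clamp m (g n x)\<bar> \<partial>unit_lborel) < e / 2"
    by (meson eventually_sequentially order_refl)
  have iD: "integrable unit_lborel (\<lambda>x. clamp m (D x))"
    by (rule integrable_unit_lborel_bounded[OF meas clamp_le])
  have ig: "integrable unit_lborel (\<lambda>x. clamp m (g n x))"
    by (rule integrable_unit_lborel_bounded[OF gm clamp_le])
  have "(\<integral>x. \<bar>D x - clamp m (g n x)\<bar> \<partial>unit_lborel)
     \<le> (\<integral>x. \<bar>D x - clamp m (D x)\<bar> + \<bar>clamp m (D x) - clamp m (g n x)\<bar> \<partial>unit_lborel)"
    by (rule integral_mono) (use D iD ig in \<open>auto intro!: Bochner_Integration.integrable_add integrable_abs Bochner_Integration.integrable_diff\<close>)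
  also have "\<dots> = (\<integral>x. \<bar>D x - clamp m (D x)\<bar> \<partial>unit_lborel) + (\<integral>x. \<bar>clamp m (D x) - clamp m (g n x)\<bar> \<partial>unit_lborel)"
    by (rule Bochner_Integration.integral_add) (use D iD ig in \<open>auto intro!: integrable_abs Bochner_Integration.integrable_diff\<close>)
  also have "\<dots> < e" using m n by simp
  finally show ?thesis using gc by blast
qed

text \<open>A continuous approximant is replaced uniformly by a polynomial, which is Lipschitz
  because its derivative is bounded on the unit interval.\<close>

lemma L1_approx_lipschitz:
  fixes D :: "real \<Rightarrow> real"
  assumes D: "integrable unit_lborel D" and e: "0 < e"
  obtains p B where "0 \<le> B" "\<And>x y. x \<in> {0..1} \<Longrightarrow> y \<in> {0..1} \<Longrightarrow> \<bar>p x - p y\<bar> \<le> B * \<bar>x - y\<bar>"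
    and "(\<integral>x. \<bar>D x - p x\<bar> \<partial>unit_lborel) < e"
proof -
  obtain g where g: "continuous_on UNIV g" "(\<integral>x. \<bar>D x - g x\<bar> \<partial>unit_lborel) < e / 2"
    using L1_approx_continuous[OF D, of "e / 2"] e by auto
  have gc: "continuous_on {0..1} g" by (rule continuous_on_subset[OF g(1)]) simp
  obtain p where p: "real_polynomial_function p" "\<And>x. x \<in> {0..1} \<Longrightarrow> \<bar>g x - p x\<bar> < e / 2"
    using Stone_Weierstrass_real_polynomial_function[OF compact_Icc gc, of "e / 2"] e by auto
  obtain p' where p': "real_polynomial_function p'" "\<And>x. (p has_real_derivative p' x) (at x)"
    using has_real_derivative_polynomial_function[OF p(1)] by blast
  have pc: "continuous_on {0..1} p" "continuous_on {0..1} p'"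
    using p(1) p'(1) by (auto intro: continuous_on_polymonial_function simp: real_polynomial_function_eq)
  have "bounded (p' ` {0..1})" by (intro compact_imp_bounded compact_continuous_image pc) simp
  then obtain B where B: "B > 0" "\<And>x. x \<in> {0..1} \<Longrightarrow> norm (p' x) \<le> B" unfolding bounded_pos by blast
  have lip: "\<bar>p x - p y\<bar> \<le> B * \<bar>x - y\<bar>" if "x \<in> {0..1}" "y \<in> {0..1}" for x y
    using field_differentiable_bound[of "{0..1}" p p' B x y] has_field_derivative_at_within[OF p'(2)] B(2) that by simp
  have int: "integrable unit_lborel f" if "continuous_on {0..1} f" for f :: "real \<Rightarrow> real"
  proof -
    have "bounded (f ` {0..1})" by (intro compact_imp_bounded compact_continuous_image that) simp
    then obtain K where "\<And>x. x \<in> {0..1} \<Longrightarrow> norm (f x) \<le> K" unfolding bounded_iff by blast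
    thus ?thesis by (intro integrable_unit_lborel_bounded continuous_measurable_unit_lborel that) auto
  qed
  have gp: "(\<integral>x. \<bar>g x - p x\<bar> \<partial>unit_lborel) \<le> e / 2"
  proof -
    have "\<bar>\<integral>x. \<bar>g x - p x\<bar> \<partial>unit_lborel\<bar> \<le> e / 2"
      by (rule abs_integral_unit_lborel_le)
         (use p(2) in \<open>auto intro!: continuous_measurable_unit_lborel continuous_intros gc pc less_imp_le\<close>)
    thus ?thesis by linarith
  qed
  have "(\<integral>x. \<bar>D x - p x\<bar> \<partial>unit_lborel) \<le> (\<integral>x. \<bar>D x - g x\<bar> + \<bar>g x - p x\<bar> \<partial>unit_lborel)"
    by (rule integral_mono) (use D int[OF gc] int[OF pc(1)] in \<open>auto intro!: Bochner_Integration.integrable_add integrable_abs Bochner_Integration.integrable_diff\<close>)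
  also have "\<dots> = (\<integral>x. \<bar>D x - g x\<bar> \<partial>unit_lborel) + (\<integral>x. \<bar>g x - p x\<bar> \<partial>unit_lborel)"
    by (rule Bochner_Integration.integral_add) (use D int[OF gc] int[OF pc(1)] in \<open>auto intro!: integrable_abs Bochner_Integration.integrable_diff\<close>)
  also have "\<dots> < e" using g(2) gp by linarith
  finally show ?thesis using that[of B p] B(1) lip by auto
qed

context bernoulli_expanding_map
begin

definition distortion :: real
  where "distortion = (SOME A. 0 \<le> A \<and> (\<forall>i\<in>{1..k}. log_lipschitz A (G i)))"

lemma distortion: "0 \<le> distortion" "i \<in> {1..k} \<Longrightarrow> log_lipschitz distortion (G i)"
  using someI_ex[OF G_log_lipschitz_ex[unfolded Bex_def]] unfolding distortion_def by auto

text \<open>With \<open>\<beta>\<close> halfway between \<open>contraction\<close> and 1, cone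
  invariance asks for \<open>distortion \<le> (1 - contraction) / 2 * cone_const\<close>. The added
  1 keeps the constant positive even if \<open>distortion\<close> is 0.\<close>

definition cone_const :: real where "cone_const = 2 * distortion / (1 - contraction) + 1"

sublocale weighted_contractions_cone "{1..k}" S G contraction distortion cone_const "(1 + contraction) / 2"
proof
  show "{1..k} \<noteq> {}" using at_least_two by auto
  show "0 < cone_const" using contraction distortion(1) by (simp add: cone_const_def add_nonneg_pos)
  have "distortion \<le> (1 - contraction) / 2 * cone_const"
  proof -
    have "(1 - contraction) / 2 * cone_const = distortion + (1 - contraction) / 2"
      using contraction(2) by (simp add: cone_const_def distrib_left)
    thus ?thesis using contraction(2) by simp
  qed
  thus "distortion + contraction * cone_const \<le> (1 + contraction) / 2 * cone_const"
    by (simp add: field_simps)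
qed (use contraction distortion S_unit S_contraction mass_conservation in \<open>auto simp: field_simps\<close>)

lemma cone_const_large: "2 * distortion \<le> cone_const"
proof -
  have "2 * distortion * (1 - contraction) \<le> 2 * distortion * 1"
    using contraction distortion(1) by (intro mult_left_mono) auto
  hence "2 * distortion \<le> 2 * distortion / (1 - contraction)"
    using contraction(2) by (subst pos_le_divide_eq) auto
  thus ?thesis by (simp add: cone_const_def)
qed

end

section \<open>Decay of correlations and identification of the invariant measure\<close>

context bernoulli_expanding_map
begin

lemma cone_measurable: "log_lipschitz cone_const f \<Longrightarrow> f \<in> borel_measurable unit_lborel"
  by (intro continuous_measurable_unit_lborel log_lipschitz_continuous[OF _ a_nonneg])

lemma cone_bound:
  assumes "log_lipschitz cone_const f" "x \<in> {0..1}"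
  shows "\<bar>f x\<bar> \<le> exp cone_const * integral {0..1} f"
  using log_lipschitz_le_integral(1)[OF assms(1) a_nonneg assms(2)] log_lipschitz_pos[OF assms] by linarith

lemma product_integrable:
  assumes \<phi>: "\<phi> \<in> borel_measurable unit_lborel" "\<And>x. x \<in> {0..1} \<Longrightarrow> \<bar>\<phi> x\<bar> \<le> K"
    and p: "p \<in> borel_measurable unit_lborel" "\<And>x. x \<in> {0..1} \<Longrightarrow> \<bar>p x\<bar> \<le> (K' :: real)"
  shows "integrable unit_lborel (\<lambda>x. \<phi> x * p x)"
proof (rule integrable_unit_lborel_bounded[where K = "K * K'"])
  show "(\<lambda>x. \<phi> x * p x) \<in> borel_measurable unit_lborel" using \<phi>(1) p(1) by measurable
  fix x :: real assume x: "x \<in> {0..1}"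
  have "\<bar>\<phi> x\<bar> * \<bar>p x\<bar> \<le> K * K'"
    by (rule mult_mono[OF \<phi>(2)[OF x] p(2)[OF x]]) (use \<phi>(2)[OF x] in linarith, simp)
  thus "\<bar>\<phi> x * p x\<bar> \<le> K * K'" by (simp add: abs_mult)
qed

text \<open>Composition with \<open>T\<close> is dual to the transfer operator: the integral is cut
  into branches, and on each of them \<open>T (S i x) = x\<close> off a finite set.\<close>

lemma integral_compose_T:
  assumes T: "T \<in> measurable unit_lborel unit_lborel"
    and \<phi>: "\<phi> \<in> borel_measurable unit_lborel" "\<And>x. x \<in> {0..1} \<Longrightarrow> \<bar>\<phi> x\<bar> \<le> K"
    and p: "log_lipschitz cone_const p"
  shows "(\<integral>x. \<phi> (T x) * p x \<partial>unit_lborel) = (\<integral>x. \<phi> x * transfer p x \<partial>unit_lborel)"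
proof -
  have T01: "T x \<in> {0..1}" if "x \<in> {0..1}" for x using maps_to that by auto
  have \<phi>T: "(\<lambda>x. \<phi> (T x)) \<in> borel_measurable unit_lborel" by (rule measurable_compose[OF T \<phi>(1)])
  note int1 = product_integrable[OF \<phi>T \<phi>(2)[OF T01] cone_measurable[OF p] cone_bound[OF p]]
  note tp = log_lipschitz_transfer_cone[OF p]
  note int2 = product_integrable[OF \<phi> cone_measurable[OF tp] cone_bound[OF tp]]
  have br: "log_lipschitz cone_const (\<lambda>x. G i x * p (S i x))" if "i \<in> {1..k}" for i
    by (rule log_lipschitz_mono[OF log_lipschitz_branch[OF p a_nonneg that] cone_invariant'])
  have int3: "(\<lambda>x. \<phi> x * (G i x * p (S i x))) integrable_on {0..1}" if i: "i \<in> {1..k}" for i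
    using integral_unit_lborel(1)[OF product_integrable[OF \<phi> cone_measurable[OF br[OF i]] cone_bound[OF br[OF i]]]]
    by (rule set_lebesgue_integral_eq_integral(1))
  have "(\<integral>x. \<phi> (T x) * p x \<partial>unit_lborel) = integral {0..1} (\<lambda>x. \<phi> (T x) * p x)"
    by (rule integral_unit_lborel(2)[OF int1])
  also have "\<dots> = (\<Sum>i\<in>{1..k}. integral {0..1} (\<lambda>x. G i x * (\<phi> (T (S i x)) * p (S i x))))"
    by (rule integral_branches(2)[OF integral_unit_lborel(1)[OF int1]])
  also have "\<dots> = (\<Sum>i\<in>{1..k}. integral {0..1} (\<lambda>x. \<phi> x * (G i x * p (S i x))))"
  proof (rule sum.cong[OF refl])
    fix i assume i: "i \<in> {1..k}"
    show "integral {0..1} (\<lambda>x. G i x * (\<phi> (T (S i x)) * p (S i x))) = integral {0..1} (\<lambda>x. \<phi> x * (G i x * p (S i x)))"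
    proof (rule integral_spike[OF negligible_finite[OF finite_S_not_interior[OF i]]])
      fix x assume x: "x \<in> {0..1} - {x \<in> {0..1}. S i x \<notin> interior (X i)}"
      hence "T (S i x) = x" using agrees[OF i, of "S i x"] F_S[OF i, of x] by simp
      thus "\<phi> x * (G i x * p (S i x)) = G i x * (\<phi> (T (S i x)) * p (S i x))" by simp
    qed
  qed
  also have "\<dots> = integral {0..1} (\<lambda>x. \<Sum>i\<in>{1..k}. \<phi> x * (G i x * p (S i x)))"
    by (rule integral_sum[symmetric]) (use int3 in auto)
  also have "\<dots> = integral {0..1} (\<lambda>x. \<phi> x * transfer p x)"
    by (simp only: transfer_def sum_distrib_left)
  also have "\<dots> = (\<integral>x. \<phi> x * transfer p x \<partial>unit_lborel)"
    by (rule integral_unit_lborel(2)[OF int2, symmetric])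
  finally show ?thesis .
qed

lemma T_pow_unit: "x \<in> {0..1} \<Longrightarrow> (T ^^ n) x \<in> {0..1}"
  using maps_to by (induction n) auto

lemma T_pow_measurable: "T \<in> measurable M M \<Longrightarrow> T ^^ n \<in> measurable M M"
  by (induction n) (auto simp: id_def comp_def intro: measurable_compose)

lemma integral_compose_T_pow:
  assumes T: "T \<in> measurable unit_lborel unit_lborel"
    and \<phi>: "\<phi> \<in> borel_measurable unit_lborel" "\<And>x. x \<in> {0..1} \<Longrightarrow> \<bar>\<phi> x\<bar> \<le> K"
    and p: "log_lipschitz cone_const p"
  shows "(\<integral>x. \<phi> ((T ^^ n) x) * p x \<partial>unit_lborel) = (\<integral>x. \<phi> x * (transfer ^^ n) p x \<partial>unit_lborel)"
  using p
proof (induction n arbitrary: p)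
  case (Suc n)
  have m: "(\<lambda>x. \<phi> ((T ^^ n) x)) \<in> borel_measurable unit_lborel"
    by (rule measurable_compose[OF T_pow_measurable[OF T] \<phi>(1)])
  have "(\<integral>x. \<phi> ((T ^^ Suc n) x) * p x \<partial>unit_lborel) = (\<integral>x. \<phi> ((T ^^ n) (T x)) * p x \<partial>unit_lborel)"
    by (simp only: funpow_Suc_right o_apply)
  also have "\<dots> = (\<integral>x. \<phi> ((T ^^ n) x) * transfer p x \<partial>unit_lborel)"
    by (rule integral_compose_T[OF T m _ Suc.prems]) (rule \<phi>(2)[OF T_pow_unit])
  also have "\<dots> = (\<integral>x. \<phi> x * (transfer ^^ n) (transfer p) x \<partial>unit_lborel)"
    by (rule Suc.IH[OF log_lipschitz_transfer_cone[OF Suc.prems]])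
  finally show ?case by (simp only: funpow_Suc_right o_apply)
qed simp

text \<open>By duality the iterate moves onto \<open>p\<close>, where it equals its integral times
  the invariant density up to the exponentially small remainder. The observable only has to be
  bounded and measurable.\<close>

lemma decorrelation_cone:
  assumes T: "T \<in> measurable unit_lborel unit_lborel"
    and \<phi>: "\<phi> \<in> borel_measurable unit_lborel" "\<And>x. x \<in> {0..1} \<Longrightarrow> \<bar>\<phi> x\<bar> \<le> K"
    and p: "log_lipschitz cone_const p"
  shows "(\<lambda>n. \<integral>x. \<phi> ((T ^^ n) x) * p x \<partial>unit_lborel)
     \<longlonglongrightarrow> integral {0..1} p * (\<integral>x. \<phi> x * inv_density x \<partial>unit_lborel)"
proof -
  let ?J = "integral {0..1} p" let ?\<Lambda> = "\<integral>x. \<phi> x * inv_density x \<partial>unit_lborel"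
  note h = product_integrable[OF \<phi> cone_measurable[OF inv_density(1)] cone_bound[OF inv_density(1)]]
  have bound: "norm ((\<integral>x. \<phi> ((T ^^ n) x) * p x \<partial>unit_lborel) - ?J * ?\<Lambda>) \<le> K * lip_const * ?J * (1 - gap) ^ n" for n
  proof -
    note tp = log_lipschitz_transfer_pow[OF p, of n]
    note int = product_integrable[OF \<phi> cone_measurable[OF tp] cone_bound[OF tp]]
    have rm: "(\<lambda>x. remainder n p x) \<in> borel_measurable unit_lborel"
      unfolding remainder_def using cone_measurable[OF tp] cone_measurable[OF inv_density(1)] by measurable
    have "(\<integral>x. \<phi> ((T ^^ n) x) * p x \<partial>unit_lborel) - ?J * ?\<Lambda>
       = (\<integral>x. \<phi> x * (transfer ^^ n) p x \<partial>unit_lborel) - (\<integral>x. ?J * (\<phi> x * inv_density x) \<partial>unit_lborel)"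
      by (simp only: integral_compose_T_pow[OF T \<phi> p, of n] Bochner_Integration.integral_mult_right_zero)
    also have "\<dots> = (\<integral>x. \<phi> x * (transfer ^^ n) p x - ?J * (\<phi> x * inv_density x) \<partial>unit_lborel)"
      by (rule Bochner_Integration.integral_diff[symmetric]) (use int h in auto)
    also have "\<dots> = (\<integral>x. \<phi> x * remainder n p x \<partial>unit_lborel)"
      unfolding remainder_def by (rule Bochner_Integration.integral_cong) (simp_all add: algebra_simps)
    finally have eq: "(\<integral>x. \<phi> ((T ^^ n) x) * p x \<partial>unit_lborel) - ?J * ?\<Lambda> = (\<integral>x. \<phi> x * remainder n p x \<partial>unit_lborel)" .
    have "\<bar>\<integral>x. \<phi> x * remainder n p x \<partial>unit_lborel\<bar> \<le> K * (lip_const * (1 - gap) ^ n * ?J)"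
    proof (rule abs_integral_unit_lborel_le)
      show "(\<lambda>x. \<phi> x * remainder n p x) \<in> borel_measurable unit_lborel" using \<phi>(1) rm by measurable
      fix x :: real assume x: "x \<in> {0..1}"
      have "\<bar>\<phi> x\<bar> * \<bar>remainder n p x\<bar> \<le> K * (lip_const * (1 - gap) ^ n * ?J)"
        by (rule mult_mono[OF \<phi>(2)[OF x] remainder_bounds(1)[OF p x x]]) (use \<phi>(2)[OF x] in linarith, simp)
      thus "\<bar>\<phi> x * remainder n p x\<bar> \<le> K * (lip_const * (1 - gap) ^ n * ?J)" by (simp add: abs_mult)
    qed
    thus ?thesis unfolding eq by (simp add: mult_ac)
  qed
  have "(\<lambda>n. K * lip_const * ?J * (1 - gap) ^ n) \<longlonglongrightarrow> 0"
    using gap by (intro tendsto_mult_right_zero LIMSEQ_power_zero) auto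
  hence "(\<lambda>n. (\<integral>x. \<phi> ((T ^^ n) x) * p x \<partial>unit_lborel) - ?J * ?\<Lambda>) \<longlonglongrightarrow> 0"
    by (rule Lim_null_comparison[OF always_eventually[OF allI[OF bound]]])
  thus ?thesis by (rule LIM_zero_cancel)
qed

text \<open>A Lipschitz function of any sign is the difference of two cone functions,
  \<open>p + M\<close> and the constant \<open>M\<close>.\<close>

lemma decorrelation_lipschitz:
  assumes T: "T \<in> measurable unit_lborel unit_lborel"
    and \<phi>: "\<phi> \<in> borel_measurable unit_lborel" "\<And>x. x \<in> {0..1} \<Longrightarrow> \<bar>\<phi> x\<bar> \<le> K"
    and p: "0 \<le> B" "\<And>x y. x \<in> {0..1} \<Longrightarrow> y \<in> {0..1} \<Longrightarrow> \<bar>p x - p y\<bar> \<le> B * \<bar>x - y\<bar>"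
  shows "(\<lambda>n. \<integral>x. \<phi> ((T ^^ n) x) * p x \<partial>unit_lborel)
     \<longlonglongrightarrow> integral {0..1} p * (\<integral>x. \<phi> x * inv_density x \<partial>unit_lborel)"
proof -
  let ?\<Lambda> = "\<integral>x. \<phi> x * inv_density x \<partial>unit_lborel"
  \<comment> \<open>A function that is \<open>B\<close>-Lipschitz and at least \<open>m\<close> has
    log-Lipschitz constant \<open>B / m\<close>, which this choice puts below
    \<open>cone_const\<close>; \<open>M\<close> shifts \<open>p\<close> above
    \<open>m\<close>.\<close>
  define m where "m = B / cone_const + 1"
  define M where "M = \<bar>p 0\<bar> + B + m"
  have m: "m > 0" using p(1) a_pos unfolding m_def by (simp add: add_nonneg_pos)
  have M: "M > 0" using m p(1) unfolding M_def by linarith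
  have pc: "continuous_on {0..1} p" by (rule continuous_on_real_lipschitz[OF p(2)])
  have low: "m \<le> p x + M" if x: "x \<in> {0..1}" for x
  proof -
    have "\<bar>p x - p 0\<bar> \<le> B * \<bar>x - 0\<bar>" by (rule p(2)[OF x]) simp
    also have "\<dots> \<le> B * 1" using x p(1) by (intro mult_left_mono) auto
    finally show ?thesis unfolding M_def by linarith
  qed
  have "log_lipschitz (B / m) (\<lambda>x. p x + M)"
    by (rule log_lipschitz_of_lipschitz[OF m low p(1)]) (use p(2) in auto)
  moreover have "B / m \<le> cone_const"
    using m a_pos p(1) by (simp add: m_def field_simps)
  ultimately have q: "log_lipschitz cone_const (\<lambda>x. p x + M)" by (rule log_lipschitz_mono)
  have c: "log_lipschitz cone_const (\<lambda>_. M)" by (rule log_lipschitz_const[OF M a_nonneg])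
  have "bounded (p ` {0..1})" by (intro compact_imp_bounded compact_continuous_image pc) simp
  then obtain Kp where Kp: "\<And>x. x \<in> {0..1} \<Longrightarrow> \<bar>p x\<bar> \<le> Kp" unfolding bounded_iff real_norm_def by blast
  have "(\<lambda>n. (\<integral>x. \<phi> ((T ^^ n) x) * (p x + M) \<partial>unit_lborel) - (\<integral>x. \<phi> ((T ^^ n) x) * M \<partial>unit_lborel))
     \<longlonglongrightarrow> integral {0..1} (\<lambda>x. p x + M) * ?\<Lambda> - integral {0..1} (\<lambda>x::real. M) * ?\<Lambda>"
    by (rule tendsto_diff[OF decorrelation_cone[OF T \<phi> q] decorrelation_cone[OF T \<phi> c]])
  moreover have "(\<integral>x. \<phi> ((T ^^ n) x) * (p x + M) \<partial>unit_lborel) - (\<integral>x. \<phi> ((T ^^ n) x) * M \<partial>unit_lborel)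
     = (\<integral>x. \<phi> ((T ^^ n) x) * p x \<partial>unit_lborel)" for n
  proof -
    have mn: "(\<lambda>x. \<phi> ((T ^^ n) x)) \<in> borel_measurable unit_lborel"
      by (rule measurable_compose[OF T_pow_measurable[OF T] \<phi>(1)])
    note bn = \<phi>(2)[OF T_pow_unit]
    have i1: "integrable unit_lborel (\<lambda>x. \<phi> ((T ^^ n) x) * p x)"
      by (rule product_integrable[OF mn bn continuous_measurable_unit_lborel[OF pc] Kp])
    have i2: "integrable unit_lborel (\<lambda>x. \<phi> ((T ^^ n) x) * M)"
      by (rule product_integrable[OF mn bn, of "\<lambda>_. M" "\<bar>M\<bar>"]) auto
    show ?thesis using Bochner_Integration.integral_add[OF i1 i2] by (simp add: distrib_left)
  qed
  moreover have "integral {0..1} (\<lambda>x. p x + M) = integral {0..1} p + M"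
    using integral_add[OF integrable_continuous_interval[OF pc] integrable_continuous_interval[OF continuous_on_const[of _ M]]]
    by simp
  ultimately show ?thesis by (simp add: algebra_simps)
qed

text \<open>Invariance permits replacing \<open>\<phi>\<close> by its composition with any power of
  \<open>T\<close>. Exchanging the density for a Lipschitz function within \<open>e\<close> in L1
  costs at most \<open>K * e\<close> uniformly in the power, so correlation decay applies in the
  limit; finally \<open>e\<close> tends to 0.\<close>

lemma invariant_measure_integral:
  assumes \<mu>: "abs_cont_invariant_prob T \<mu>"
    and \<phi>: "\<phi> \<in> borel_measurable unit_lborel" "\<And>x. x \<in> {0..1} \<Longrightarrow> \<bar>\<phi> x\<bar> \<le> K"
  shows "(\<integral>x. \<phi> x \<partial>\<mu>) = (\<integral>x. \<phi> x * inv_density x \<partial>unit_lborel)"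
proof -
  let ?\<Lambda> = "\<integral>x. \<phi> x * inv_density x \<partial>unit_lborel"
  have K: "0 \<le> K" using \<phi>(2)[of 0] by simp
  interpret \<mu>: prob_space \<mu> using \<mu> by (simp add: abs_cont_invariant_prob_def)
  have sets: "sets \<mu> = sets unit_lborel"
    using \<mu> sets_restrict_space_cong[OF sets_lborel, of "{0..1::real}"] by (simp add: abs_cont_invariant_prob_def)
  have ac: "absolutely_continuous unit_lborel \<mu>" and T\<mu>: "T \<in> measurable \<mu> \<mu>" and inv: "distr \<mu> \<mu> T = \<mu>"
    using \<mu> by (auto simp: abs_cont_invariant_prob_def)
  have T: "T \<in> measurable unit_lborel unit_lborel"
    using T\<mu> measurable_cong_sets[OF sets sets] by simp
  obtain D where D: "D \<in> borel_measurable unit_lborel" "AE x in unit_lborel. RN_deriv unit_lborel \<mu> x = ennreal (D x)"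
    "\<And>x. 0 \<le> D x"
    using unit_lborel.real_RN_deriv[OF \<mu>.finite_measure_axioms ac sets] by blast
  have "\<mu> = density unit_lborel (RN_deriv unit_lborel \<mu>)"
    using unit_lborel.density_RN_deriv[OF ac sets] by simp
  also have "\<dots> = density unit_lborel (\<lambda>x. ennreal (D x))"
    by (rule density_cong) (use D in auto)
  finally have dens: "\<mu> = density unit_lborel (\<lambda>x. ennreal (D x))" .
  have int_D: "(\<integral>x. f x \<partial>\<mu>) = (\<integral>x. f x * D x \<partial>unit_lborel)" if "f \<in> borel_measurable unit_lborel" for f :: "real \<Rightarrow> real"
    unfolding dens by (subst integral_density) (use that D in \<open>auto simp: mult.commute\<close>)
  have iD: "integrable unit_lborel D"
  proof -
    have "integrable (density unit_lborel (\<lambda>x. ennreal (D x))) (\<lambda>_. 1 :: real)"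
      unfolding dens[symmetric] by simp
    thus ?thesis by (subst (asm) integrable_density) (use D in auto)
  qed
  have D1: "(\<integral>x. D x \<partial>unit_lborel) = 1"
    using int_D[of "\<lambda>_. 1"] \<mu>.prob_space by simp
  have inv_n: "(\<integral>x. \<phi> ((T ^^ n) x) \<partial>\<mu>) = (\<integral>x. \<phi> x \<partial>\<mu>)" for n
  proof (induction n)
    case (Suc n)
    have m: "(\<lambda>x. \<phi> ((T ^^ n) x)) \<in> borel_measurable \<mu>"
      unfolding measurable_cong_sets[OF sets refl]
      by (rule measurable_compose[OF T_pow_measurable[OF T] \<phi>(1)])
    have "(\<integral>x. \<phi> ((T ^^ Suc n) x) \<partial>\<mu>) = (\<integral>x. \<phi> ((T ^^ n) (T x)) \<partial>\<mu>)"
      by (simp only: funpow_Suc_right o_apply)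
    also have "\<dots> = (\<integral>x. \<phi> ((T ^^ n) x) \<partial>distr \<mu> \<mu> T)"
      by (rule integral_distr[symmetric, OF T\<mu> m])
    finally show ?case unfolding inv Suc .
  qed simp
  have bound: "\<bar>(\<integral>x. \<phi> x \<partial>\<mu>) - ?\<Lambda>\<bar> \<le> (K + \<bar>?\<Lambda>\<bar>) * e" if e: "e > 0" for e
  proof -
    obtain p B where p: "0 \<le> B" "\<And>x y. x \<in> {0..1} \<Longrightarrow> y \<in> {0..1} \<Longrightarrow> \<bar>p x - p y\<bar> \<le> B * \<bar>x - y\<bar>"
      and Dp: "(\<integral>x. \<bar>D x - p x\<bar> \<partial>unit_lborel) < e"
      by (rule L1_approx_lipschitz[OF iD e]) blast
    have pc: "continuous_on {0..1} p" by (rule continuous_on_real_lipschitz[OF p(2)])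
    have "bounded (p ` {0..1})" by (intro compact_imp_bounded compact_continuous_image pc) simp
    then obtain Kp where Kp: "\<And>x. x \<in> {0..1} \<Longrightarrow> \<bar>p x\<bar> \<le> Kp" unfolding bounded_iff real_norm_def by blast
    have ip: "integrable unit_lborel p"
      by (rule integrable_unit_lborel_bounded[OF continuous_measurable_unit_lborel[OF pc] Kp])
    have "\<bar>(\<integral>x. D x \<partial>unit_lborel) - (\<integral>x. p x \<partial>unit_lborel)\<bar> \<le> (\<integral>x. \<bar>D x - p x\<bar> \<partial>unit_lborel)"
      using Bochner_Integration.integral_diff[OF iD ip] integral_abs_bound[of unit_lborel "\<lambda>x. D x - p x"] by simp
    hence Jp: "\<bar>integral {0..1} p - 1\<bar> \<le> e"
      using Dp unfolding D1 integral_unit_lborel(2)[OF ip] by linarith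
    have near: "\<bar>(\<integral>x. \<phi> x \<partial>\<mu>) - (\<integral>x. \<phi> ((T ^^ n) x) * p x \<partial>unit_lborel)\<bar> \<le> K * e" for n
    proof -
      have m: "(\<lambda>x. \<phi> ((T ^^ n) x)) \<in> borel_measurable unit_lborel"
        by (rule measurable_compose[OF T_pow_measurable[OF T] \<phi>(1)])
      note bn = \<phi>(2)[OF T_pow_unit]
      have i1: "integrable unit_lborel (\<lambda>x. \<phi> ((T ^^ n) x) * p x)"
        by (rule product_integrable[OF m bn continuous_measurable_unit_lborel[OF pc] Kp])
      have i2: "integrable unit_lborel (\<lambda>x. \<phi> ((T ^^ n) x) * D x)"
      proof (rule Bochner_Integration.integrable_bound[OF integrable_mult_right[OF iD, of K]])
        show "(\<lambda>x. \<phi> ((T ^^ n) x) * D x) \<in> borel_measurable unit_lborel" using m D(1) by measurable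
        show "AE x in unit_lborel. norm (\<phi> ((T ^^ n) x) * D x) \<le> norm (K * D x)"
        proof (rule AE_I2)
          fix x assume "x \<in> space unit_lborel"
          hence "\<bar>\<phi> ((T ^^ n) x)\<bar> \<le> K" by (intro bn) (simp add: space_restrict_space)
          thus "norm (\<phi> ((T ^^ n) x) * D x) \<le> norm (K * D x)"
            using K by (simp add: abs_mult mult_right_mono)
        qed
      qed
      have i3: "integrable unit_lborel (\<lambda>x. \<bar>D x - p x\<bar>)"
        using iD ip by (intro integrable_abs Bochner_Integration.integrable_diff)
      have "(\<integral>x. \<phi> x \<partial>\<mu>) = (\<integral>x. \<phi> ((T ^^ n) x) * D x \<partial>unit_lborel)"
        using inv_n[of n] int_D[OF m] by simp
      hence "(\<integral>x. \<phi> x \<partial>\<mu>) - (\<integral>x. \<phi> ((T ^^ n) x) * p x \<partial>unit_lborel)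
         = (\<integral>x. \<phi> ((T ^^ n) x) * D x - \<phi> ((T ^^ n) x) * p x \<partial>unit_lborel)"
        using Bochner_Integration.integral_diff[OF i2 i1] by simp
      hence "\<bar>(\<integral>x. \<phi> x \<partial>\<mu>) - (\<integral>x. \<phi> ((T ^^ n) x) * p x \<partial>unit_lborel)\<bar>
         \<le> (\<integral>x. \<bar>\<phi> ((T ^^ n) x) * D x - \<phi> ((T ^^ n) x) * p x\<bar> \<partial>unit_lborel)"
        by (simp only: integral_abs_bound)
      also have "\<dots> \<le> (\<integral>x. K * \<bar>D x - p x\<bar> \<partial>unit_lborel)"
      proof (rule integral_mono)
        show "integrable unit_lborel (\<lambda>x. \<bar>\<phi> ((T ^^ n) x) * D x - \<phi> ((T ^^ n) x) * p x\<bar>)"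
          using i1 i2 by (intro integrable_abs Bochner_Integration.integrable_diff)
        show "integrable unit_lborel (\<lambda>x. K * \<bar>D x - p x\<bar>)" by (rule integrable_mult_right[OF i3])
        fix x assume "x \<in> space unit_lborel"
        hence "\<bar>\<phi> ((T ^^ n) x)\<bar> \<le> K" by (intro bn) (simp add: space_restrict_space)
        thus "\<bar>\<phi> ((T ^^ n) x) * D x - \<phi> ((T ^^ n) x) * p x\<bar> \<le> K * \<bar>D x - p x\<bar>"
          by (simp add: right_diff_distrib[symmetric] abs_mult mult_right_mono)
      qed
      also have "\<dots> = K * (\<integral>x. \<bar>D x - p x\<bar> \<partial>unit_lborel)" by simp
      also have "\<dots> \<le> K * e" using Dp K by (intro mult_left_mono) auto
      finally show ?thesis .
    qed
    have "(\<lambda>n. \<bar>(\<integral>x. \<phi> x \<partial>\<mu>) - (\<integral>x. \<phi> ((T ^^ n) x) * p x \<partial>unit_lborel)\<bar>)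
       \<longlonglongrightarrow> \<bar>(\<integral>x. \<phi> x \<partial>\<mu>) - integral {0..1} p * ?\<Lambda>\<bar>"
      by (intro tendsto_intros decorrelation_lipschitz[OF T \<phi> p])
    hence "\<bar>(\<integral>x. \<phi> x \<partial>\<mu>) - integral {0..1} p * ?\<Lambda>\<bar> \<le> K * e"
      by (rule LIMSEQ_le_const2) (use near in blast)
    moreover have "\<bar>integral {0..1} p * ?\<Lambda> - ?\<Lambda>\<bar> \<le> e * \<bar>?\<Lambda>\<bar>"
    proof -
      have "\<bar>integral {0..1} p * ?\<Lambda> - ?\<Lambda>\<bar> = \<bar>integral {0..1} p - 1\<bar> * \<bar>?\<Lambda>\<bar>"
        by (simp add: abs_mult[symmetric] algebra_simps)
      also have "\<dots> \<le> e * \<bar>?\<Lambda>\<bar>" using Jp by (rule mult_right_mono) simp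
      finally show ?thesis .
    qed
    ultimately show ?thesis unfolding distrib_right by (simp add: mult.commute)
  qed
  have "\<bar>(\<integral>x. \<phi> x \<partial>\<mu>) - ?\<Lambda>\<bar> \<le> 0"
  proof (rule field_le_epsilon)
    fix e :: real assume e: "e > 0"
    \<comment> \<open>The summand 1 keeps the divisor positive when the other two vanish.\<close>
    let ?c = "K + \<bar>?\<Lambda>\<bar> + 1"
    have c: "?c > 0" using K by linarith
    have "\<bar>(\<integral>x. \<phi> x \<partial>\<mu>) - ?\<Lambda>\<bar> \<le> (K + \<bar>?\<Lambda>\<bar>) * (e / ?c)" by (rule bound) (use e c in simp)
    also have "\<dots> \<le> ?c * (e / ?c)" using e c by (intro mult_right_mono) auto
    also have "\<dots> = e" using c by simp
    finally show "\<bar>(\<integral>x. \<phi> x \<partial>\<mu>) - ?\<Lambda>\<bar> \<le> 0 + e" by simp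
  qed
  thus ?thesis by simp
qed

end

section \<open>The Lyapunov exponent and the periodic sums\<close>

lemma words_eq_words_over: "words k n = words_over {1..k} n"
  by (simp add: words_def words_over_def)

lemma card_words_over: "finite I \<Longrightarrow> card (words_over I n) = card I ^ n"
  using card_lists_length_eq[of I n] by (simp add: words_over_def conj_commute)

lemma abs_inverse_powr_minus:
  fixes d :: real
  assumes "d \<noteq> 0"
  shows "\<bar>1 / d\<bar> powr (- s) = \<bar>d\<bar> powr s"
  using assms by (simp add: powr_def ln_div)

text \<open>From \<open>v / (1 - e) - v = v * (e / (1 - e))\<close>: for nonnegative weights the
  denominators cause a small relative error.\<close>

lemma sum_divide_one_minus_bound:
  fixes v e :: "'a \<Rightarrow> real"
  assumes v: "\<And>w. w \<in> W \<Longrightarrow> 0 \<le> v w" and e: "\<And>w. w \<in> W \<Longrightarrow> \<bar>e w\<bar> \<le> \<epsilon>"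
    and \<epsilon>: "\<epsilon> \<le> \<theta>" "\<theta> < 1"
  shows "\<bar>(\<Sum>w\<in>W. v w / (1 - e w)) - (\<Sum>w\<in>W. v w)\<bar> \<le> (\<Sum>w\<in>W. v w) * (\<epsilon> / (1 - \<theta>))"
proof -
  have "\<bar>(\<Sum>w\<in>W. v w / (1 - e w)) - (\<Sum>w\<in>W. v w)\<bar> = \<bar>\<Sum>w\<in>W. v w / (1 - e w) - v w\<bar>"
    by (simp only: sum_subtractf)
  also have "\<dots> \<le> (\<Sum>w\<in>W. v w * (\<epsilon> / (1 - \<theta>)))"
  proof (rule order_trans[OF sum_abs], rule sum_mono)
    fix w assume w: "w \<in> W"
    have pos: "1 - \<theta> \<le> 1 - e w" "0 < 1 - \<theta>" using e[OF w] \<epsilon> by linarith+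
    have "v w / (1 - e w) - v w = v w * (e w / (1 - e w))"
      using pos by (simp add: field_simps)
    hence "\<bar>v w / (1 - e w) - v w\<bar> = v w * (\<bar>e w\<bar> / (1 - e w))"
      using v[OF w] pos by (simp add: abs_mult abs_divide)
    also have "\<dots> \<le> v w * (\<epsilon> / (1 - \<theta>))"
      using v[OF w] e[OF w] pos by (intro mult_left_mono frac_le) auto
    finally show "\<bar>v w / (1 - e w) - v w\<bar> \<le> v w * (\<epsilon> / (1 - \<theta>))" .
  qed
  finally show ?thesis by (simp only: sum_distrib_right)
qed

lemma linear_times_geometric_bound:
  fixes r s :: real
  assumes "0 < r" "r < s"
  obtains C where "0 \<le> C" "\<And>n. real (n + 2) * r ^ n \<le> C * s ^ Suc n"
proof -
  have "summable (\<lambda>n. of_nat (Suc n) * (r / s) ^ n)"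
    using geometric_deriv_sums[of "r / s"] assms by (auto simp: sums_iff)
  hence "Bseq (\<lambda>n. real (Suc n) * (r / s) ^ n)"
    by (intro convergent_imp_Bseq) (auto dest: summable_LIMSEQ_zero simp: convergent_def)
  then obtain K where K: "K > 0" "\<And>n. norm (real (Suc n) * (r / s) ^ n) \<le> K" unfolding Bseq_def by blast
  show ?thesis
  proof
    show "0 \<le> 2 * K / s" using K assms by simp
    fix n
    have "real (n + 2) * r ^ n \<le> 2 * (real (Suc n) * r ^ n)"
      using assms by (simp add: algebra_simps)
    also have "\<dots> = 2 * (real (Suc n) * (r / s) ^ n) * s ^ n"
      using assms by (simp add: power_divide)
    also have "\<dots> \<le> 2 * K * s ^ n"
      using K(2)[of n] assms by (intro mult_right_mono) auto
    also have "\<dots> = 2 * K / s * s ^ Suc n" using assms by simp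
    finally show "real (n + 2) * r ^ n \<le> 2 * K / s * s ^ Suc n" .
  qed
qed

section \<open>The Lyapunov exponent as an integral over branches\<close>

context bernoulli_expanding_map
begin

lemma dF_nonzero: "i \<in> {1..k} \<Longrightarrow> x \<in> X i \<Longrightarrow> dF i x \<noteq> 0"
  using expanding unfolding dF_def by force

text \<open>A bounded Borel version of \<open>ln |deriv T x|\<close>. It is 0 outside the interiors,
  where \<open>deriv T\<close> is uncontrolled.\<close>

definition log_expansion :: "real \<Rightarrow> real"
  where "log_expansion x = (\<Sum>i\<in>{1..k}. indicator (interior (X i)) x *\<^sub>R ln \<bar>dF i x\<bar>)"

lemma log_expansion_eq:
  assumes i: "i \<in> {1..k}" and x: "x \<in> interior (X i)"
  shows "log_expansion x = ln \<bar>dF i x\<bar>"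
proof -
  have "log_expansion x = (\<Sum>j\<in>{1..k}. if j = i then ln \<bar>dF i x\<bar> else 0)"
    unfolding log_expansion_def
  proof (rule sum.cong[OF refl])
    fix j assume j: "j \<in> {1..k}"
    show "indicator (interior (X j)) x *\<^sub>R ln \<bar>dF j x\<bar> = (if j = i then ln \<bar>dF i x\<bar> else 0)"
      using disjoint_interiors[OF j i] x by (auto simp: indicator_def)
  qed
  also have "\<dots> = ln \<bar>dF i x\<bar>" using i by simp
  finally show ?thesis .
qed

lemma log_expansion_continuous: "i \<in> {1..k} \<Longrightarrow> continuous_on (X i) (\<lambda>x. ln \<bar>dF i x\<bar>)"
  by (intro continuous_on_ln continuous_on_rabs dF_props(2)) (use dF_nonzero in auto)

lemma log_expansion_measurable: "log_expansion \<in> borel_measurable unit_lborel"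
proof -
  have "(\<lambda>x. indicator (interior (X i)) x *\<^sub>R ln \<bar>dF i x\<bar>) \<in> borel_measurable borel" if i: "i \<in> {1..k}" for i
    by (rule borel_measurable_continuous_on_indicator)
       (use continuous_on_subset[OF log_expansion_continuous[OF i] interior_subset] in auto)
  hence "log_expansion \<in> borel_measurable borel"
    unfolding log_expansion_def by (rule borel_measurable_sum)
  thus ?thesis unfolding borel_measurable_unit_lborel by (rule measurable_restrict_space1)
qed

lemma log_expansion_bounded: "\<exists>K. \<forall>x. \<bar>log_expansion x\<bar> \<le> K"
proof -
  have "\<forall>i\<in>{1..k}. \<exists>K\<ge>0. \<forall>x\<in>X i. \<bar>ln \<bar>dF i x\<bar>\<bar> \<le> K"
  proof
    fix i assume i: "i \<in> {1..k}"
    obtain a b where X: "X i = {a..b}" by (rule interval_cases[OF i])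
    have "compact (X i)" unfolding X by simp
    hence "bounded ((\<lambda>x. ln \<bar>dF i x\<bar>) ` X i)"
      by (intro compact_imp_bounded compact_continuous_image log_expansion_continuous[OF i])
    then obtain K where "K > 0" "\<And>x. x \<in> X i \<Longrightarrow> norm (ln \<bar>dF i x\<bar>) \<le> K" unfolding bounded_pos by blast
    thus "\<exists>K\<ge>0. \<forall>x\<in>X i. \<bar>ln \<bar>dF i x\<bar>\<bar> \<le> K" by (intro exI[of _ K]) auto
  qed
  then obtain K where K: "\<And>i. i \<in> {1..k} \<Longrightarrow> K i \<ge> 0"
    "\<And>i x. i \<in> {1..k} \<Longrightarrow> x \<in> X i \<Longrightarrow> \<bar>ln \<bar>dF i x\<bar>\<bar> \<le> K i" by metis
  have "\<bar>log_expansion x\<bar> \<le> sum K {1..k}" for x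
    unfolding log_expansion_def
  proof (rule order_trans[OF sum_abs], rule sum_mono)
    fix i assume i: "i \<in> {1..k}"
    show "\<bar>indicator (interior (X i)) x *\<^sub>R ln \<bar>dF i x\<bar>\<bar> \<le> K i"
      using K(1)[OF i] K(2)[OF i, of x] interior_subset[of "X i"] by (auto simp: indicator_def)
  qed
  thus ?thesis by blast
qed

lemma log_expansion_S:
  assumes i: "i \<in> {1..k}" and x: "x \<in> {0..1}" "S i x \<in> interior (X i)"
  shows "log_expansion (S i x) = - ln (G i x)"
proof -
  have "\<bar>dF i (S i x)\<bar> * G i x = 1"
    using dF_S_mult_dS[OF i x(1)] unfolding G_def by (simp flip: abs_mult)
  moreover have "0 < G i x" using log_lipschitz_pos[OF distortion(2)[OF i] x(1)] .
  ultimately have "\<bar>dF i (S i x)\<bar> = inverse (G i x)" by (simp add: field_simps)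
  thus ?thesis unfolding log_expansion_eq[OF i x(2)] using \<open>0 < G i x\<close> by (simp add: ln_inverse)
qed

lemma deriv_T:
  assumes i: "i \<in> {1..k}" and x: "x \<in> interior (X i)"
  shows "deriv T x = dF i x"
proof -
  have "(F i has_real_derivative dF i x) (at x within X i)"
    by (rule dF_props(1)[OF i]) (use x interior_subset in blast)
  hence "(F i has_real_derivative dF i x) (at x)" unfolding at_within_interior[OF x] .
  hence "(T has_real_derivative dF i x) (at x)"
    by (rule has_field_derivative_transform_within_open[OF _ open_interior x]) (use agrees[OF i] in auto)
  thus ?thesis by (rule DERIV_imp_deriv)
qed

lemma finite_endpoints: "finite ({0..1} - (\<Union>i\<in>{1..k}. interior (X i)))"
proof -
  have "finite (X i - interior (X i))" if i: "i \<in> {1..k}" for i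
  proof -
    obtain a b where X: "X i = {a..b}" by (rule interval_cases[OF i])
    have "X i - interior (X i) \<subseteq> {a, b}" unfolding X interior_atLeastAtMost_real by auto
    thus ?thesis by (rule finite_subset) simp
  qed
  hence "finite (\<Union>i\<in>{1..k}. X i - interior (X i))" by blast
  moreover have "{0..1} - (\<Union>i\<in>{1..k}. interior (X i)) \<subseteq> (\<Union>i\<in>{1..k}. X i - interior (X i))"
    unfolding cover[symmetric] by blast
  ultimately show ?thesis by (rule rev_finite_subset)
qed

text \<open>Absolute continuity makes the finitely many endpoints null sets, so the logarithm may be
  replaced by \<open>log_expansion\<close>. Integrating against the invariant density and pulling
  back to the branches turns it into \<open>- ln (G i)\<close>.\<close>

lemma lyapunov_exponent_eq:
  assumes \<mu>: "abs_cont_invariant_prob T \<mu>"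
  shows "lyapunov_exponent T \<mu> = - entropy"
proof -
  have sets: "sets \<mu> = sets unit_lborel"
    using \<mu> sets_restrict_space_cong[OF sets_lborel, of "{0..1::real}"] by (simp add: abs_cont_invariant_prob_def)
  have space: "space \<mu> = {0..1}" using sets_eq_imp_space_eq[OF sets] by (simp add: space_restrict_space)
  have ac: "absolutely_continuous unit_lborel \<mu>" using \<mu> by (simp add: abs_cont_invariant_prob_def)
  have null: "{x} \<in> null_sets \<mu>" if "x \<in> {0..1}" for x
  proof -
    have "{x} \<in> null_sets unit_lborel"
      using that by (subst null_sets_restrict_space) auto
    thus ?thesis using ac unfolding absolutely_continuous_def by blast
  qed
  have "lyapunov_exponent T \<mu> = (\<integral>x. log_expansion x \<partial>\<mu>)"
    unfolding lyapunov_exponent_def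
  proof (rule integral_discrete_difference[OF countable_finite[OF finite_endpoints]])
    fix x assume "x \<in> {0..1} - (\<Union>i\<in>{1..k}. interior (X i))"
    hence "{x} \<in> null_sets \<mu>" using null by blast
    thus "emeasure \<mu> {x} = 0" "{x} \<in> sets \<mu>" by auto
  next
    fix x assume "x \<in> space \<mu>" "x \<notin> {0..1} - (\<Union>i\<in>{1..k}. interior (X i))"
    then obtain i where "i \<in> {1..k}" "x \<in> interior (X i)" unfolding space by blast
    thus "ln \<bar>deriv T x\<bar> = log_expansion x" by (simp add: deriv_T log_expansion_eq)
  qed
  also obtain K where K: "\<And>x. \<bar>log_expansion x\<bar> \<le> K" using log_expansion_bounded by blast
  have "(\<integral>x. log_expansion x \<partial>\<mu>) = (\<integral>x. log_expansion x * inv_density x \<partial>unit_lborel)"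
    by (rule invariant_measure_integral[OF \<mu> log_expansion_measurable K])
  also have "\<dots> = - entropy"
  proof -
    note int = integral_unit_lborel[OF product_integrable[OF log_expansion_measurable K
      cone_measurable[OF inv_density(1)] cone_bound[OF inv_density(1)]]]
    have "(\<integral>x. log_expansion x * inv_density x \<partial>unit_lborel) = integral {0..1} (\<lambda>x. log_expansion x * inv_density x)"
      by (rule int(2))
    also have "\<dots> = (\<Sum>i\<in>{1..k}. integral {0..1} (\<lambda>x. G i x * (log_expansion (S i x) * inv_density (S i x))))"
      by (rule integral_branches(2)[OF int(1)])
    also have "\<dots> = (\<Sum>i\<in>{1..k}. - integral {0..1} (\<lambda>x. inv_density (S i x) * (ln (G i x) * G i x)))"
    proof (rule sum.cong[OF refl])
      fix i assume i: "i \<in> {1..k}"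
      have "integral {0..1} (\<lambda>x. G i x * (log_expansion (S i x) * inv_density (S i x)))
          = integral {0..1} (\<lambda>x. - (inv_density (S i x) * (ln (G i x) * G i x)))"
      proof (rule integral_spike[OF negligible_finite[OF finite_S_not_interior[OF i]]])
        fix x assume "x \<in> {0..1} - {x \<in> {0..1}. S i x \<notin> interior (X i)}"
        hence "log_expansion (S i x) = - ln (G i x)" by (intro log_expansion_S[OF i]) auto
        thus "- (inv_density (S i x) * (ln (G i x) * G i x)) = G i x * (log_expansion (S i x) * inv_density (S i x))"
          by simp
      qed
      thus "integral {0..1} (\<lambda>x. G i x * (log_expansion (S i x) * inv_density (S i x)))
         = - integral {0..1} (\<lambda>x. inv_density (S i x) * (ln (G i x) * G i x))" by simp
    qed
    also have "\<dots> = - entropy" by (simp only: entropy_def sum_negf)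
    finally show ?thesis .
  qed
  finally show ?thesis .
qed

section \<open>Multipliers of periodic points and asymptotics of the periodic sums\<close>

primrec dSw :: "nat list \<Rightarrow> real \<Rightarrow> real"
  where "dSw [] x = 1" | "dSw (i # w) x = dS i (Sw w x) * dSw w x"

lemma Sw_has_derivative:
  "set w \<subseteq> {1..k} \<Longrightarrow> x \<in> {0..1} \<Longrightarrow> (Sw w has_real_derivative dSw w x) (at x within {0..1})"
proof (induction w)
  case (Cons i w)
  have w: "set w \<subseteq> {1..k}" and i: "i \<in> {1..k}" using Cons.prems(1) by auto
  have "(S i has_real_derivative dS i (Sw w x)) (at (Sw w x) within {0..1})"
    by (rule dS_props(1)[OF i Sw_maps[OF w Cons.prems(2)]])
  hence "(S i has_real_derivative dS i (Sw w x)) (at (Sw w x) within Sw w ` {0..1})"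
    by (rule DERIV_subset) (use Sw_maps[OF w] in blast)
  from DERIV_image_chain[OF this Cons.IH[OF w Cons.prems(2)]] show ?case by (simp add: o_def)
qed (simp add: id_def)

lemma abs_dSw: "\<bar>dSw w x\<bar> = Gw w x"
proof (induction w)
  case (Cons i w)
  thus ?case by (simp add: abs_mult G_def[of i "Sw w x", symmetric])
qed simp

lemma Gw_le: "set w \<subseteq> {1..k} \<Longrightarrow> x \<in> {0..1} \<Longrightarrow> Gw w x \<le> contraction ^ length w"
proof (induction w)
  case (Cons i w)
  have w: "set w \<subseteq> {1..k}" and i: "i \<in> {1..k}" using Cons.prems(1) by auto
  have "G i (Sw w x) * Gw w x \<le> contraction * contraction ^ length w"
    using contraction(3)[OF i Sw_maps[OF w Cons.prems(2)], folded G_def] contraction(1)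
    by (intro mult_mono Cons.IH[OF w Cons.prems(2)] less_imp_le[OF Gw_pos[OF w Cons.prems(2)]]) auto
  thus ?case by simp
qed simp

lemma inverse_branch_eq: "inverse_branch X F w = Sw w"
  by (simp add: inverse_branch_def)

lemma word_fixpoint_eq: "word_fixpoint X F w = fixpt w"
  by (simp add: word_fixpoint_def fixpt_def inverse_branch_eq)

text \<open>The reciprocal of the multiplier. Its sign is kept because the denominators of the
  periodic sums depend on it; the absolute value is \<open>Dw\<close>.\<close>

definition contraction_rate :: "nat list \<Rightarrow> real"
  where "contraction_rate w = dSw w (fixpt w)"

context
  fixes w :: "nat list"
  assumes w: "w \<noteq> []" "set w \<subseteq> {1..k}"
begin

lemma multiplier_eq: "multiplier X F w = 1 / contraction_rate w"
proof -
  have "vector_derivative (Sw w) (at (fixpt w) within {0..1}) = contraction_rate w"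
    unfolding contraction_rate_def
    by (rule vector_derivative_within_closed_interval)
       (use Sw_has_derivative[OF w(2) fixpt(1)[OF w]] fixpt(1)[OF w]
         in \<open>auto simp: has_real_derivative_iff_has_vector_derivative\<close>)
  thus ?thesis by (simp add: multiplier_def inverse_branch_eq word_fixpoint_eq)
qed

lemma abs_contraction_rate: "\<bar>contraction_rate w\<bar> = Dw w"
  by (simp add: contraction_rate_def Dw_def abs_dSw)

lemma Dw_le: "Dw w \<le> contraction ^ length w"
  unfolding Dw_def by (rule Gw_le[OF w(2) fixpt(1)[OF w]])

lemma Dw_le_1: "Dw w \<le> 1"
  using Dw_le power_le_one[of contraction "length w"] contraction by simp

lemma Dw_le_contraction: "Dw w \<le> contraction"
proof -
  have "contraction ^ length w \<le> contraction ^ 1"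
    using contraction w(1) by (intro power_decreasing) (auto simp: Suc_le_eq)
  thus ?thesis using Dw_le by simp
qed

lemma periodic_term_eq:
  "\<bar>multiplier X F w\<bar> powr (-(1 + t)) / (1 - inverse (multiplier X F w))
   = Dw w powr (1 + t) / (1 - contraction_rate w)"
proof -
  have "contraction_rate w \<noteq> 0" using abs_contraction_rate Dw_pos[OF w] by auto
  thus ?thesis unfolding multiplier_eq abs_inverse_powr_minus[OF \<open>contraction_rate w \<noteq> 0\<close>] abs_contraction_rate
    by (simp add: field_simps)
qed

end

lemma words_over_ne: "w \<in> words_over {1..k} (Suc n) \<Longrightarrow> w \<noteq> []"
  and words_over_set: "w \<in> words_over {1..k} (Suc n) \<Longrightarrow> set w \<subseteq> {1..k}"
  and words_over_length: "w \<in> words_over {1..k} (Suc n) \<Longrightarrow> length w = Suc n"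
  by (auto simp: words_over_def)

lemma periodic_sum_eq:
  "periodic_sum k X F (Suc n) t
   = (\<Sum>w\<in>words_over {1..k} (Suc n). Dw w powr (1 + t) / (1 - contraction_rate w))"
  unfolding periodic_sum_def words_eq_words_over
  by (rule sum.cong[OF refl]) (rule periodic_term_eq[OF words_over_ne words_over_set])

text \<open>A crude bound counting words, sufficient for passing to formal coefficients. The
  restriction on \<open>t\<close> keeps the exponent \<open>1 + t\<close> positive, and an open
  interval around 0 is all that differentiation at 0 requires.\<close>

lemma periodic_sum_bound:
  assumes "\<bar>t\<bar> < 1"
  shows "\<bar>periodic_sum k X F (Suc n) t\<bar> \<le> 1 / (1 - contraction) * real k ^ Suc n"
proof -
  have "\<bar>periodic_sum k X F (Suc n) t\<bar> \<le> (\<Sum>w\<in>words_over {1..k} (Suc n). 1 / (1 - contraction))"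
    unfolding periodic_sum_eq
  proof (rule order_trans[OF sum_abs], rule sum_mono)
    fix w assume w: "w \<in> words_over {1..k} (Suc n)"
    note w' = words_over_ne[OF w] words_over_set[OF w]
    have 1: "Dw w powr (1 + t) \<le> 1"
      using Dw_pos[OF w'] Dw_le_1[OF w'] assms by (intro powr_le1) auto
    have 2: "1 - contraction \<le> 1 - contraction_rate w"
      using abs_contraction_rate[OF w'] Dw_le_contraction[OF w'] by linarith
    have "Dw w powr (1 + t) / (1 - contraction_rate w) \<le> 1 / (1 - contraction)"
      using 1 2 contraction by (intro frac_le) auto
    moreover have "0 \<le> Dw w powr (1 + t) / (1 - contraction_rate w)" using 2 contraction by simp
    ultimately show "\<bar>Dw w powr (1 + t) / (1 - contraction_rate w)\<bar> \<le> 1 / (1 - contraction)"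
      by (simp only: abs_of_nonneg)
  qed
  also have "\<dots> = 1 / (1 - contraction) * real k ^ Suc n"
    by (simp add: card_words_over)
  finally show ?thesis .
qed

lemma taylor_coeff_eq:
  assumes "\<bar>t\<bar> < 1"
  shows "taylor_coeff k X F n t = fps_exp_neg (periodic_fps k X F t) $ n"
  by (rule taylor_coeff_eq_fps_nth[OF _ periodic_sum_bound[OF assms]]) (use at_least_two in auto)

definition periodic_fps_deriv :: "real fps"
  where "periodic_fps_deriv = Abs_fps (\<lambda>n. if n = 0 then 0 else
    (\<Sum>w\<in>words_over {1..k} n. Dw w * ln (Dw w) / (1 - contraction_rate w)) / real n)"

lemma periodic_fps_has_derivative:
  "((\<lambda>t. periodic_fps k X F t $ n) has_real_derivative periodic_fps_deriv $ n) (at 0)"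
proof (cases n)
  case (Suc m)
  have "((\<lambda>t. (\<Sum>w\<in>words_over {1..k} (Suc m). Dw w powr (1 + t) / (1 - contraction_rate w)) / real n)
     has_real_derivative (\<Sum>w\<in>words_over {1..k} (Suc m). Dw w * ln (Dw w) / (1 - contraction_rate w)) / real n) (at 0)"
  proof (intro DERIV_cdivide DERIV_sum)
    fix w assume w: "w \<in> words_over {1..k} (Suc m)"
    have D: "0 < Dw w" by (rule Dw_pos[OF words_over_ne[OF w] words_over_set[OF w]])
    have "((\<lambda>t. Dw w powr (1 + t)) has_real_derivative Dw w * ln (Dw w)) (at 0)"
      using D by (auto intro!: derivative_eq_intros)
    thus "((\<lambda>t. Dw w powr (1 + t)) has_real_derivative Dw w * ln (Dw w)) (at 0)" .
  qed
  thus ?thesis by (simp add: periodic_fps_def periodic_fps_deriv_def periodic_sum_eq Suc)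
qed (simp add: periodic_fps_def periodic_fps_deriv_def)

lemma deriv_taylor_coeff_eq:
  "deriv (\<lambda>t. taylor_coeff k X F n t) 0 = (- periodic_fps_deriv * fps_exp_neg (periodic_fps k X F 0)) $ n"
proof -
  have "((\<lambda>t. fps_exp_neg (periodic_fps k X F t) $ n) has_real_derivative
     (- periodic_fps_deriv * fps_exp_neg (periodic_fps k X F 0)) $ n) (at 0)"
    by (rule fps_exp_neg_has_derivative)
       (use periodic_fps_has_derivative in \<open>auto simp: periodic_fps_deriv_def\<close>)
  hence "((\<lambda>t. taylor_coeff k X F n t) has_real_derivative
     (- periodic_fps_deriv * fps_exp_neg (periodic_fps k X F 0)) $ n) (at 0)"
    by (rule has_field_derivative_transform_within_open[of _ _ _ "{-1<..<1}"]) (auto simp: taylor_coeff_eq)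
  thus ?thesis by (rule DERIV_imp_deriv)
qed

text \<open>Combines the trace asymptotics with the removal of the denominators. The factor
  \<open>n\<close> produced by rotating words is cancelled by the division by \<open>n\<close> in
  the exponent series, so the coefficients of the derivative converge to
  \<open>entropy\<close>.\<close>

lemma periodic_sum_asymptotics:
  "\<exists>\<sigma> C. 0 < \<sigma> \<and> \<sigma> < 1 \<and>
     (\<forall>n. \<bar>real (Suc n) * periodic_fps k X F 0 $ Suc n - 1\<bar> \<le> C * \<sigma> ^ Suc n \<and>
          \<bar>periodic_fps_deriv $ Suc n - entropy\<bar> \<le> C * \<sigma> ^ Suc n)"
proof -
  obtain C0 where C0: "\<And>n. \<bar>(\<Sum>w\<in>words_over {1..k} (Suc n). Dw w) - 1\<bar> \<le> C0 * real (n + 2) * rate ^ n"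
    "\<And>n. \<bar>(\<Sum>w\<in>words_over {1..k} (Suc n). Dw w * first_log w) - entropy\<bar> \<le> C0 * real (n + 2) * rate ^ n"
    using periodic_asymptotics[OF cone_const_large] by blast
  \<comment> \<open>A base strictly between \<open>rate\<close> and 1 absorbs the linear factor of
    the trace estimate.\<close>
  define \<sigma> where "\<sigma> = (1 + rate) / 2"
  have \<sigma>: "rate < \<sigma>" "\<sigma> < 1" "0 < \<sigma>" using rate by (auto simp: \<sigma>_def)
  obtain C' where C': "0 \<le> C'" "\<And>n. real (n + 2) * rate ^ n \<le> C' * \<sigma> ^ Suc n"
    by (rule linear_times_geometric_bound[OF rate(1) \<sigma>(1)]) blast
  define C1 where "C1 = \<bar>C0\<bar> * C'"
  have C1: "0 \<le> C1" "C0 * real (n + 2) * rate ^ n \<le> C1 * \<sigma> ^ Suc n" for n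
  proof -
    show "0 \<le> C1" unfolding C1_def using C'(1) by simp
    have "C0 * (real (n + 2) * rate ^ n) \<le> \<bar>C0\<bar> * (C' * \<sigma> ^ Suc n)"
      by (rule mult_mono[OF abs_ge_self C'(2)]) (use rate in auto)
    thus "C0 * real (n + 2) * rate ^ n \<le> C1 * \<sigma> ^ Suc n" unfolding C1_def by (simp only: mult.assoc)
  qed
  define C where "C = C1 + (1 + \<bar>entropy\<bar> + C1) / (1 - contraction)"
  \<comment> \<open>Used twice: \<open>y\<close> is a sum with denominators, \<open>x\<close> the
    same sum without them, and \<open>s\<close> its limit, either 1 or
    \<open>- entropy\<close>.\<close>
  have total: "\<bar>y - s\<bar> \<le> C * \<sigma> ^ Suc n"
    if y: "\<bar>y - x\<bar> \<le> \<bar>x\<bar> * (contraction ^ Suc n / (1 - contraction))" and x: "\<bar>x - s\<bar> \<le> C1 * \<sigma> ^ Suc n"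
      and s: "\<bar>s\<bar> \<le> 1 + \<bar>entropy\<bar>" for x y s :: real and n
  proof -
    have "\<sigma> ^ Suc n \<le> 1" using \<sigma> by (intro power_le_one) auto
    hence "C1 * \<sigma> ^ Suc n \<le> C1 * 1" by (rule mult_left_mono[OF _ C1(1)])
    hence "\<bar>x\<bar> \<le> 1 + \<bar>entropy\<bar> + C1" using x s by linarith
    moreover have "contraction ^ Suc n \<le> \<sigma> ^ Suc n"
      using contraction rate \<sigma> by (intro power_mono) auto
    ultimately have "\<bar>x\<bar> * (contraction ^ Suc n / (1 - contraction))
        \<le> (1 + \<bar>entropy\<bar> + C1) * (\<sigma> ^ Suc n / (1 - contraction))"
      using contraction C1(1) by (intro mult_mono divide_right_mono) auto
    with y x have "\<bar>y - s\<bar> \<le> C1 * \<sigma> ^ Suc n + (1 + \<bar>entropy\<bar> + C1) * (\<sigma> ^ Suc n / (1 - contraction))"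
      by linarith
    also have "\<dots> = C * \<sigma> ^ Suc n" by (simp only: C_def distrib_right times_divide_eq_left times_divide_eq_right)
    finally show ?thesis .
  qed
  have main: "\<bar>real (Suc n) * periodic_fps k X F 0 $ Suc n - 1\<bar> \<le> C * \<sigma> ^ Suc n \<and>
          \<bar>periodic_fps_deriv $ Suc n - entropy\<bar> \<le> C * \<sigma> ^ Suc n" for n
  proof
    let ?W = "words_over {1..k} (Suc n)"
    have e: "\<bar>contraction_rate w\<bar> \<le> contraction ^ Suc n" if "w \<in> ?W" for w
      using abs_contraction_rate[OF words_over_ne[OF that] words_over_set[OF that]]
        Dw_le[OF words_over_ne[OF that] words_over_set[OF that]] words_over_length[OF that] by simp
    have ce: "contraction ^ Suc n \<le> contraction"
      using contraction power_decreasing[of 1 "Suc n" contraction] by simp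
    have D: "0 < Dw w" "Dw w \<le> 1" if "w \<in> ?W" for w
      using Dw_pos[OF words_over_ne[OF that] words_over_set[OF that]]
        Dw_le_1[OF words_over_ne[OF that] words_over_set[OF that]] by auto
    have D0: "0 \<le> (\<Sum>w\<in>?W. Dw w)" by (intro sum_nonneg less_imp_le D)
    have P: "real (Suc n) * periodic_fps k X F 0 $ Suc n = (\<Sum>w\<in>?W. Dw w / (1 - contraction_rate w))"
    proof -
      have "real (Suc n) * periodic_fps k X F 0 $ Suc n = periodic_sum k X F (Suc n) 0"
        by (simp add: periodic_fps_def del: of_nat_Suc)
      also have "\<dots> = (\<Sum>w\<in>?W. Dw w / (1 - contraction_rate w))"
        unfolding periodic_sum_eq by (rule sum.cong[OF refl]) (use D in \<open>simp add: less_imp_le\<close>)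
      finally show ?thesis .
    qed
    have b1: "\<bar>(\<Sum>w\<in>?W. Dw w / (1 - contraction_rate w)) - (\<Sum>w\<in>?W. Dw w)\<bar>
        \<le> (\<Sum>w\<in>?W. Dw w) * (contraction ^ Suc n / (1 - contraction))"
      by (rule sum_divide_one_minus_bound[OF less_imp_le[OF D(1)] e ce contraction(2)])
    show "\<bar>real (Suc n) * periodic_fps k X F 0 $ Suc n - 1\<bar> \<le> C * \<sigma> ^ Suc n"
      unfolding P
      by (rule total[where x = "\<Sum>w\<in>?W. Dw w"]) (use b1 D0 order_trans[OF C0(1) C1(2)] in auto)
    \<comment> \<open>The sign is reversed because \<open>Dw w \<le> 1\<close> makes the logarithm
      nonpositive, whereas the comparison of denominators needs nonnegative weights.\<close>
    define v where "v w = - (Dw w * ln (Dw w)) / real (Suc n)" for w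
    have v: "0 \<le> v w" if "w \<in> ?W" for w
    proof -
      have "Dw w * ln (Dw w) \<le> 0" using D[OF that] by (intro mult_nonneg_nonpos) auto
      thus ?thesis unfolding v_def by (intro divide_nonneg_nonneg) auto
    qed
    have b2: "\<bar>(\<Sum>w\<in>?W. v w / (1 - contraction_rate w)) - (\<Sum>w\<in>?W. v w)\<bar>
        \<le> (\<Sum>w\<in>?W. v w) * (contraction ^ Suc n / (1 - contraction))"
      by (rule sum_divide_one_minus_bound[OF v e ce contraction(2)])
    have sv: "(\<Sum>w\<in>?W. v w) = - (\<Sum>w\<in>?W. Dw w * first_log w)"
      using sum_Dw_ln_Dw[of n] unfolding v_def sum_divide_distrib[symmetric] sum_negf
      by (simp del: of_nat_Suc)
    have svq: "(\<Sum>w\<in>?W. v w / (1 - contraction_rate w)) = - periodic_fps_deriv $ Suc n"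
    proof -
      have "(\<Sum>w\<in>?W. v w / (1 - contraction_rate w))
         = (\<Sum>w\<in>?W. - (Dw w * ln (Dw w) / (1 - contraction_rate w) / real (Suc n)))"
        by (rule sum.cong[OF refl]) (simp add: v_def del: of_nat_Suc)
      also have "\<dots> = - ((\<Sum>w\<in>?W. Dw w * ln (Dw w) / (1 - contraction_rate w)) / real (Suc n))"
        by (simp only: sum_negf sum_divide_distrib)
      finally show ?thesis by (simp add: periodic_fps_deriv_def del: of_nat_Suc)
    qed
    have v0: "0 \<le> (\<Sum>w\<in>?W. v w)" by (rule sum_nonneg[OF v])
    have "\<bar>- periodic_fps_deriv $ Suc n - (- entropy)\<bar> \<le> C * \<sigma> ^ Suc n"
    proof (rule total[where x = "\<Sum>w\<in>?W. v w"])
      show "\<bar>- periodic_fps_deriv $ Suc n - (\<Sum>w\<in>?W. v w)\<bar> \<le> \<bar>\<Sum>w\<in>?W. v w\<bar> * (contraction ^ Suc n / (1 - contraction))"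
        using b2 v0 unfolding svq by simp
      show "\<bar>(\<Sum>w\<in>?W. v w) - (- entropy)\<bar> \<le> C1 * \<sigma> ^ Suc n"
        using order_trans[OF C0(2) C1(2), of n] unfolding sv by (simp add: abs_minus_commute)
    qed simp
    thus "\<bar>periodic_fps_deriv $ Suc n - entropy\<bar> \<le> C * \<sigma> ^ Suc n"
      by (simp add: abs_minus_commute)
  qed
  show ?thesis using \<sigma> main by blast
qed

end

theorem mainTheorem1:
  fixes T :: "real \<Rightarrow> real" and k :: nat and X :: "nat \<Rightarrow> real set"
    and F :: "nat \<Rightarrow> real \<Rightarrow> real" and \<mu> :: "real measure"
  assumes "bernoulli_expanding_map T k X F"
    and "abs_cont_invariant_prob T \<mu>"
  shows "let a = (\<lambda>n. taylor_coeff k X F n 0);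
             a' = (\<lambda>n. deriv (\<lambda>t. taylor_coeff k X F n t) 0)
    in summable (\<lambda>n. \<bar>a' (Suc n)\<bar>)
    \<and> summable (\<lambda>n. \<bar>real (Suc n) * a (Suc n)\<bar>)
    \<and> (\<Sum>n. real (Suc n) * a (Suc n)) \<noteq> 0
    \<and> lyapunov_exponent T \<mu> = - (\<Sum>n. a' (Suc n)) / (\<Sum>n. real (Suc n) * a (Suc n))
    \<and> (\<forall>\<^sub>F N in sequentially. (\<Sum>n=1..N. real n * a n) \<noteq> 0)
    \<and> (\<lambda>N. - (\<Sum>n=1..N. a' n) / (\<Sum>n=1..N. real n * a n)) \<longlonglongrightarrow> lyapunov_exponent T \<mu>"
proof -
  interpret bernoulli_expanding_map T k X F by fact
  define A where "A = fps_exp_neg (periodic_fps k X F 0)"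
  define B where "B = - periodic_fps_deriv * A"
  have a: "taylor_coeff k X F n 0 = A $ n" for n by (simp add: taylor_coeff_eq A_def)
  have a': "deriv (\<lambda>t. taylor_coeff k X F n t) 0 = B $ n" for n
    unfolding deriv_taylor_coeff_eq A_def[symmetric] B_def ..
  obtain \<sigma> C where \<sigma>: "0 < \<sigma>" "\<sigma> < 1"
    and P: "\<And>n. \<bar>real (Suc n) * periodic_fps k X F 0 $ Suc n - 1\<bar> \<le> C * \<sigma> ^ Suc n"
    and Q: "\<And>n. \<bar>periodic_fps_deriv $ Suc n - entropy\<bar> \<le> C * \<sigma> ^ Suc n"
    using periodic_sum_asymptotics by blast
  have L: "lyapunov_exponent T \<mu> = - entropy" by (rule lyapunov_exponent_eq[OF assms(2)])
  have Q': "\<bar>periodic_fps_deriv $ Suc n + lyapunov_exponent T \<mu>\<bar> \<le> C * \<sigma> ^ Suc n" for n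
    using Q[of n] unfolding L by simp
  have Q0: "periodic_fps_deriv $ 0 = 0" by (simp add: periodic_fps_deriv_def)
  note * = determinant_coefficient_sums[OF periodic_fps_nth_0 Q0 A_def B_def \<sigma> P Q']
  have B0: "B $ 0 = 0" by (simp add: B_def Q0)
  \<comment> \<open>The sums start at 1 but formal series at 0. The extra terms vanish:
    \<open>n * a n\<close> through its factor, and the derivative because the constant coefficient
    does not depend on \<open>t\<close>.\<close>
  have shift: "(\<Sum>n. f (Suc n)) = (\<Sum>n. f n)" "(\<lambda>N. \<Sum>n=1..N. f n) \<longlonglongrightarrow> (\<Sum>n. f n)"
    if f: "summable (\<lambda>n. \<bar>f n\<bar>)" "f 0 = 0" for f :: "nat \<Rightarrow> real"
  proof -
    note s = summable_rabs_cancel[OF f(1)]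
    show "(\<Sum>n. f (Suc n)) = (\<Sum>n. f n)" using suminf_split_head[OF s] f(2) by simp
    have "(\<Sum>n=1..N. f n) = (\<Sum>n\<le>N. f n)" for N
      using f(2) by (simp add: sum.atLeast1_atMost_eq sum.atMost_shift)
    thus "(\<lambda>N. \<Sum>n=1..N. f n) \<longlonglongrightarrow> (\<Sum>n. f n)" using summable_LIMSEQ'[OF s] by simp
  qed
  note sA = shift[OF *(2)] and sB = shift[OF *(1) B0]
  have "\<forall>\<^sub>F N in sequentially. (\<Sum>n=1..N. real n * A $ n) \<noteq> 0"
    by (rule tendsto_imp_eventually_ne[OF sA(2) *(3)]) simp
  moreover have "(\<lambda>N. - (\<Sum>n=1..N. B $ n) / (\<Sum>n=1..N. real n * A $ n)) \<longlonglongrightarrow> lyapunov_exponent T \<mu>"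
    unfolding *(4) by (intro tendsto_divide tendsto_minus sA(2) sB(2) *(3)) simp
  moreover have "summable (\<lambda>n. \<bar>B $ Suc n\<bar>)"
    using *(1) by (rule iffD2[OF summable_Suc_iff])
  moreover have "summable (\<lambda>n. \<bar>real (Suc n) * A $ Suc n\<bar>)"
    using *(2) by (rule iffD2[OF summable_Suc_iff])
  ultimately show ?thesis
    unfolding Let_def a a' using *(3,4) sA(1) sB(1) by simp
qed

end
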